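(* Let $1<p<\infty$ and let $\varphi$ be an analytic self-map of $\mathbb D$. Suppose $\omega$ is either of the following weights: (a) $\omega(r)=(1-r)^\alpha\left(\log\frac e{1-r}\right)^\beta$ with $\alpha>-1$ and $\beta\le0$; (b) $\omega(r)=\exp\left(-\beta\left(\log\frac e{1-r}\right)^\alpha\right)$ with $0<\alpha\le1$ and $\beta>0$. Let $X=\{u\in H(\mathbb D):uC_\varphi(A_\omega^p)\subset A_\omega^p\}$. Then $X=H^\infty$ if and only if $\varphi$ is a finite Blaschke product.
   Context: $\mathbb D$ is the open unit disk in $\mathbb C$, $H(\mathbb D)$ is the set of analytic functions on $\mathbb D$, $H^\infty$ is the set of bounded analytic functions on $\mathbb D$, and $dA(z)=\frac1\pi dx\,dy$. Weights are extended radially to $\mathbb D$ by $\omega(z)=\omega(|z|)$. $A_\omega^p$ is the space of $f\in H(\mathbb D)$ with $\|f\|_{A_\omega^p}^p=\int_{\mathbb D}|f|^p\omega\,dA<\infty$. The weighted composition operator is $(uC_\varphi f)(z)=u(z)f(\varphi(z))$. *)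

theory Defs
  imports "HOL-Complex_Analysis.Complex_Analysis"
begin

text \<open>
  Analytic functions on the unit disk are represented by total functions on the complex
  numbers that are holomorphic on \<^term>\<open>ball (0::complex) 1\<close>; their values outside the disk
  are irrelevant in every notion below. A weight is a function of the radius and is extended
  radially by evaluating it at \<^term>\<open>norm z\<close>; only its values on \<^term>\<open>{0..<1::real}\<close> matter.
\<close>

definition dA :: "complex measure" where
  "dA = scale_measure (ennreal (1 / pi)) lborel"

definition H_disk :: "(complex \<Rightarrow> complex) set" where
  "H_disk = {f. f holomorphic_on ball 0 1}"

definition H_infinity :: "(complex \<Rightarrow> complex) set" where
  "H_infinity = {f \<in> H_disk. bounded (f ` ball 0 1)}"

definition bergman :: "real \<Rightarrow> (real \<Rightarrow> real) \<Rightarrow> (complex \<Rightarrow> complex) set" where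
  "bergman p \<omega> = {f \<in> H_disk.
     (\<integral>\<^sup>+z\<in>ball 0 1. ennreal (norm (f z) powr p * \<omega> (norm z)) \<partial>dA) < \<infinity>}"

definition weighted_comp ::
  "(complex \<Rightarrow> complex) \<Rightarrow> (complex \<Rightarrow> complex) \<Rightarrow> (complex \<Rightarrow> complex) \<Rightarrow> complex \<Rightarrow> complex" where
  "weighted_comp u \<phi> f = (\<lambda>z. u z * f (\<phi> z))"

text \<open>
  The factor \<^term>\<open>Moebius_function 0 w z\<close> is \<^term>\<open>(z - w) / (1 - cnj w * z)\<close>. The empty
  product is a unimodular constant, which is never a self-map of the open disk.
\<close>

definition finite_Blaschke_product :: "(complex \<Rightarrow> complex) \<Rightarrow> bool" where
  "finite_Blaschke_product \<phi> \<longleftrightarrow>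
     (\<exists>(c::complex) (n::nat) (a :: nat \<Rightarrow> complex).
        norm c = 1 \<and> (\<forall>k<n. a k \<in> ball 0 1) \<and>
        (\<forall>z\<in>ball 0 1. \<phi> z = c * (\<Prod>k<n. Moebius_function 0 (a k) z)))"

end

theory Submission
  imports Defs
begin

text \<open>
  Both kinds of weight are comparable to powers of the distance to the circle under rescaling of
  that distance, with exponents \<open>-\<kappa> > -1\<close> and \<open>K\<close>. By subharmonicity, \<open>|f(w)|\<^sup>p\<close> is dominated by an
  average of \<open>|f(a)|\<^sup>p\<close> against the kernel \<open>((1 - |a|\<^sup>2) / |1 - cnj a w|)\<^sup>\<gamma> / (1 - |a|)\<^sup>2\<close>, and this kernel is
  controlled by the positive harmonic function \<open>Re ((1 + cnj a w) / (1 - cnj a w))\<close>. Composed with \<open>\<phi>\<close> it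
  remains harmonic, so its circle means are known; this bounds the composition operator without
  Littlewood subordination, and, with Poisson's formula, it also bounds \<open>\<integral> |v|\<^sup>p |f \<circ> \<phi>|\<^sup>p \<omega>\<close> for functions
  \<open>v\<close> that peak near a point \<open>z\<^sub>0\<close> at which \<open>\<phi>\<close> stays away from the circle.

  If \<open>\<phi>\<close> is a finite Blaschke product, then \<open>1 - |\<phi>(z)|\<close> is comparable to \<open>1 - |z|\<close>; testing on normalised
  kernels at the points \<open>\<phi>(z\<^sub>n)\<close> with \<open>|u(z\<^sub>n)|\<close> unbounded and summing them along a sparse subsequence
  contradicts the point evaluation bound. If \<open>\<phi>\<close> is not a finite Blaschke product, then \<open>|\<phi>(z\<^sub>n)|\<close> stays
  away from 1 along some sequence tending to the circle, and a sparse sum of peaks at the \<open>z\<^sub>n\<close> is an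
  unbounded multiplier.
\<close>

section \<open>Rotation invariance and circle means\<close>

text \<open>The inclusion of \<open>H_infinity\<close> in the multiplier set holds for every
  self-map, because composition with \<phi> is bounded; only the reverse inclusion singles out the
  finite Blaschke products. Multipliers are defined merely by mapping the space into itself. Instead
  of deriving an operator bound from this by a closed graph argument, both directions build one
  explicit series, which contradicts the mapping property in one case and is an unbounded multiplier
  in the other. Boundedness of composition says nothing about products with an unbounded u, so the
  integral estimate carries an arbitrary density V from the start; taking V = 1 recovers
  composition. The kernel exponent is K + 4: two powers are exchanged for the harmonic function, K
  powers compensate the decay of the weight, and two make the radial integral converge. The
  condition \<kappa> < 1 keeps the weight integrable up to the circle.\<close>

lemma Complex_measurable [measurable]:
  "(\<lambda>(x, y). Complex x y) \<in> borel_measurable (borel \<Otimes>\<^sub>M borel)"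
proof -
  have "continuous_on UNIV (\<lambda>q::real \<times> real. Complex (fst q) (snd q))"
    unfolding Complex_eq by (intro continuous_intros)
  then show ?thesis
    by (simp add: borel_prod borel_measurable_continuous_onI case_prod_unfold)
qed

text \<open>Lebesgue measure is determined by its values on boxes, and a complex box is a product of
  two intervals. This makes Tonelli in the two coordinates available.\<close>

lemma lborel_complex_eq_distr:
  "(lborel :: complex measure) = distr (lborel \<Otimes>\<^sub>M lborel) borel (\<lambda>(x, y). Complex x y)"
proof (rule lborel_eqI)
  fix l u :: complex
  assume lu: "\<And>b. b \<in> Basis \<Longrightarrow> l \<bullet> b \<le> u \<bullet> b"
  have re: "Re l \<le> Re u" using lu[of 1] by (simp add: Basis_complex_def inner_complex_def)
  have im: "Im l \<le> Im u" using lu[of \<i>] by (simp add: Basis_complex_def inner_complex_def)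
  have eq: "(\<lambda>(x, y). Complex x y) -` box l u \<inter> space (lborel \<Otimes>\<^sub>M lborel) = box (Re l) (Re u) \<times> box (Im l) (Im u)"
    by (auto simp: box_def Basis_complex_def inner_complex_def space_pair_measure)
  show "emeasure (distr (lborel \<Otimes>\<^sub>M lborel) borel (\<lambda>(x, y). Complex x y)) (box l u) = ennreal (\<Prod>b\<in>Basis. (u - l) \<bullet> b)"
    using re im
    by (subst emeasure_distr)
       (simp_all add: eq lborel.emeasure_pair_measure_Times Basis_complex_def inner_complex_def ennreal_mult)
qed simp

lemma nn_integral_lborel_complex:
  assumes [measurable]: "g \<in> borel_measurable borel"
  shows "(\<integral>\<^sup>+z. g z \<partial>lborel) = (\<integral>\<^sup>+x. \<integral>\<^sup>+y. g (Complex x y) \<partial>lborel \<partial>lborel)"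
  by (subst lborel_complex_eq_distr)
     (simp add: nn_integral_distr lborel.nn_integral_fst[symmetric] case_prod_unfold)

lemma Complex_measurable' [measurable (raw)]:
  assumes [measurable]: "f \<in> borel_measurable M" "g \<in> borel_measurable M"
  shows "(\<lambda>x. Complex (f x) (g x)) \<in> borel_measurable M"
  unfolding Complex_eq by measurable

text \<open>
  Substituting first in \<open>x\<close> and then in \<open>y\<close> requires \<open>Re u \<noteq> 0\<close>; the remaining rotations are
  squares of such ones.
\<close>

lemma nn_integral_rotate_aux:
  fixes g :: "complex \<Rightarrow> ennreal"
  assumes [measurable]: "g \<in> borel_measurable borel" and u: "norm u = 1" "Re u \<noteq> 0"
  shows "(\<integral>\<^sup>+z. g (u * z) \<partial>lborel) = (\<integral>\<^sup>+z. g z \<partial>lborel)"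
proof -
  define c s where "c = Re u" and "s = Im u"
  have cs: "c\<^sup>2 + s\<^sup>2 = 1" using u(1) by (simp add: c_def s_def cmod_def)
  have c: "c \<noteq> 0" using u by (simp add: c_def)
  have uc: "u * Complex x y = Complex (c * x - s * y) (s * x + c * y)" for x y
    by (simp add: c_def s_def complex_eq_iff)
  have "(\<integral>\<^sup>+z. g (u * z) \<partial>lborel) = (\<integral>\<^sup>+x. \<integral>\<^sup>+y. g (Complex (c * x - s * y) (s * x + c * y)) \<partial>lborel \<partial>lborel)"
    by (subst nn_integral_lborel_complex) (simp_all add: uc)
  also have "\<dots> = (\<integral>\<^sup>+y. \<integral>\<^sup>+x. g (Complex (c * x - s * y) (s * x + c * y)) \<partial>lborel \<partial>lborel)"
    by (rule lborel_pair.Fubini') simp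
  \<comment> \<open>Substituting for c x - s y leaves a shear, because c^2 + s^2 = 1. The Jacobian
    1/|c| is later cancelled by the |c| from the substitution in y.\<close>
  also have "\<dots> = (\<integral>\<^sup>+y. ennreal (1/\<bar>c\<bar>) * (\<integral>\<^sup>+x. g (Complex x (s / c * x + y / c)) \<partial>lborel) \<partial>lborel)"
  proof (rule nn_integral_cong)
    fix y
    have e: "s * (s * y / c + x / c) + c * y = s / c * x + y / c" for x
    proof -
      have "s * (s * y / c + x / c) + c * y = ((c\<^sup>2 + s\<^sup>2) * y + s * x) / c"
        using c by (simp add: field_simps power2_eq_square)
      then show ?thesis unfolding cs by (simp add: add_divide_distrib)
    qed
    have "(\<integral>\<^sup>+x. g (Complex (c * x - s * y) (s * x + c * y)) \<partial>lborel) =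
      ennreal \<bar>1/c\<bar> * (\<integral>\<^sup>+x. g (Complex (c * (s * y / c + 1 / c * x) - s * y) (s * (s * y / c + 1/c * x) + c * y)) \<partial>lborel)"
      by (rule nn_integral_real_affine) (use c in auto)
    also have "(\<lambda>x. g (Complex (c * (s * y / c + 1 / c * x) - s * y) (s * (s * y / c + 1/c * x) + c * y))) = (\<lambda>x. g (Complex x (s / c * x + y / c)))"
    proof -
      have "c * (s * y / c + 1 / c * x) - s * y = x" for x using c by (simp add: field_simps)
      then show ?thesis using e by (simp add: fun_eq_iff)
    qed
    finally show "(\<integral>\<^sup>+x. g (Complex (c * x - s * y) (s * x + c * y)) \<partial>lborel) = ennreal (1/\<bar>c\<bar>) * (\<integral>\<^sup>+x. g (Complex x (s / c * x + y / c)) \<partial>lborel)"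
      by simp
  qed
  also have "\<dots> = ennreal (1/\<bar>c\<bar>) * (\<integral>\<^sup>+y. \<integral>\<^sup>+x. g (Complex x (s / c * x + y / c)) \<partial>lborel \<partial>lborel)"
    by (rule nn_integral_cmult) simp
  also have "(\<integral>\<^sup>+y. \<integral>\<^sup>+x. g (Complex x (s / c * x + y / c)) \<partial>lborel \<partial>lborel) =
      (\<integral>\<^sup>+x. \<integral>\<^sup>+y. g (Complex x (s / c * x + y / c)) \<partial>lborel \<partial>lborel)"
    by (rule lborel_pair.Fubini') simp
  also have "\<dots> = (\<integral>\<^sup>+x. ennreal \<bar>c\<bar> * (\<integral>\<^sup>+y. g (Complex x y) \<partial>lborel) \<partial>lborel)"
  proof (rule nn_integral_cong)
    fix x
    have "(\<integral>\<^sup>+y. g (Complex x (s / c * x + y / c)) \<partial>lborel) =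
      ennreal \<bar>c\<bar> * (\<integral>\<^sup>+y. g (Complex x (s / c * x + (- s * x + c * y) / c)) \<partial>lborel)"
      by (rule nn_integral_real_affine) (use c in auto)
    also have "(\<lambda>y. g (Complex x (s / c * x + (- s * x + c * y) / c))) = (\<lambda>y. g (Complex x y))"
      using c by (simp add: fun_eq_iff field_simps)
    finally show "(\<integral>\<^sup>+y. g (Complex x (s / c * x + y / c)) \<partial>lborel) = ennreal \<bar>c\<bar> * (\<integral>\<^sup>+y. g (Complex x y) \<partial>lborel)" .
  qed
  also have "\<dots> = ennreal \<bar>c\<bar> * (\<integral>\<^sup>+z. g z \<partial>lborel)"
    by (subst nn_integral_lborel_complex) (simp_all add: nn_integral_cmult)
  finally show ?thesis
    using c by (simp add: mult.assoc[symmetric] ennreal_mult[symmetric])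
qed

lemma nn_integral_rotate:
  fixes g :: "complex \<Rightarrow> ennreal"
  assumes [measurable]: "g \<in> borel_measurable borel" and u: "norm u = 1"
  shows "(\<integral>\<^sup>+z. g (u * z) \<partial>lborel) = (\<integral>\<^sup>+z. g z \<partial>lborel)"
proof (cases "Re u = 0")
  case True
  define v where "v = csqrt u"
  have v: "v * v = u" by (simp add: v_def power2_eq_square[symmetric])
  have "norm v * norm v = 1" using u v by (metis norm_mult)
  then have nv: "norm v = 1" by (simp add: square_eq_1_iff) (use norm_ge_zero[of v] in linarith)
  have "Re v \<noteq> 0"
  proof
    assume "Re v = 0"
    moreover have "(Re v)\<^sup>2 + (Im v)\<^sup>2 = 1"
      using nv by (simp add: cmod_def)
    moreover have "Re u = Re v * Re v - Im v * Im v"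
      by (simp flip: v)
    ultimately have "Re u = - (Im v)\<^sup>2" "(Im v)\<^sup>2 = 1"
      by (simp_all add: power2_eq_square)
    then show False using True by simp
  qed
  then have "(\<integral>\<^sup>+z. g (v * (v * z)) \<partial>lborel) = (\<integral>\<^sup>+z. g (v * z) \<partial>lborel)"
    using nv by (intro nn_integral_rotate_aux[of "\<lambda>z. g (v * z)"]) auto
  also have "\<dots> = (\<integral>\<^sup>+z. g z \<partial>lborel)"
    using nv \<open>Re v \<noteq> 0\<close> by (intro nn_integral_rotate_aux) auto
  finally show ?thesis by (simp add: mult.assoc[symmetric] v)
qed (use assms in \<open>auto intro: nn_integral_rotate_aux\<close>)

lemma cis_measurable [measurable]: "cis \<in> borel_measurable borel"
  by (intro borel_measurable_continuous_onI continuous_intros)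

text \<open>Rotation invariance averaged over all angles stands in for polar coordinates: an
  estimate of the mean over each circle becomes an estimate of the area integral.\<close>

lemma nn_integral_circle_average:
  fixes g :: "complex \<Rightarrow> ennreal"
  assumes [measurable]: "g \<in> borel_measurable borel"
  shows "ennreal (2 * pi) * (\<integral>\<^sup>+z. g z \<partial>lborel) =
         (\<integral>\<^sup>+z. (\<integral>\<^sup>+t\<in>{0..2*pi}. g (cis t * z) \<partial>lborel) \<partial>lborel)"
proof -
  have "(\<integral>\<^sup>+z. (\<integral>\<^sup>+t\<in>{0..2*pi}. g (cis t * z) \<partial>lborel) \<partial>lborel) =
     (\<integral>\<^sup>+t. (\<integral>\<^sup>+z. g (cis t * z) * indicator {0..2*pi} t \<partial>lborel) \<partial>lborel)"
    by (rule lborel_pair.Fubini') simp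
  also have "\<dots> = (\<integral>\<^sup>+t. (\<integral>\<^sup>+z. g z \<partial>lborel) * indicator {0..2*pi} t \<partial>lborel)"
    by (intro nn_integral_cong) (simp add: nn_integral_multc nn_integral_rotate)
  also have "\<dots> = (\<integral>\<^sup>+z. g z \<partial>lborel) * ennreal (2 * pi)"
    by (simp add: nn_integral_cmult)
  finally show ?thesis by (simp add: mult.commute)
qed

section \<open>Poisson's formula and mean values on the unit circle\<close>

lemma Poisson_formula_circle:
  fixes g :: "complex \<Rightarrow> complex"
  assumes cont: "continuous_on (cball 0 1) g" and hol: "g holomorphic_on ball 0 1" and b: "norm b < 1"
  shows "((\<lambda>t. g (cis t) * of_real ((1 - (norm b)\<^sup>2) / (norm (1 - cnj b * cis t))\<^sup>2)) has_integral 2 * pi * g b) {0..2*pi}"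
proof -
  have nz: "1 - cnj b * z \<noteq> 0" if "norm z \<le> 1" for z
  proof
    assume "1 - cnj b * z = 0"
    then have "norm (cnj b * z) = 1" by (metis eq_iff_diff_eq_0 norm_one)
    moreover have "norm (cnj b * z) < 1"
      using b that by (simp add: norm_mult) (smt (verit) mult_left_le norm_ge_zero)
    ultimately show False by simp
  qed
  \<comment> \<open>On the unit circle \<open>G u * u / (u - b)\<close> is \<open>g u\<close> times the Poisson kernel, and \<open>G b = g b\<close>.\<close>
  define G where "G = (\<lambda>u. g u * (1 - of_real ((norm b)\<^sup>2)) / (1 - cnj b * u))"
  have cG: "continuous_on (cball 0 1) G" unfolding G_def
    by (intro continuous_intros cont) (use nz in auto)
  have hG: "G holomorphic_on ball 0 1" unfolding G_def
    by (intro holomorphic_intros hol) (use nz in auto)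
  have "cnj b * b = of_real ((norm b)\<^sup>2)" by (metis complex_norm_square mult.commute of_real_power)
  then have Gb: "G b = g b" using nz[of b] b by (simp add: G_def)
  have "((\<lambda>u. G u / (u - b)) has_contour_integral (2 * of_real pi * \<i> * g b)) (circlepath 0 1)"
    using Cauchy_integral_circlepath[OF cG hG, of b] b Gb by simp
  then have "((\<lambda>t. G (cis t) / (cis t - b) * 1 * \<i> * cis t) has_integral (2 * of_real pi * \<i> * g b)) {0..2*pi}"
    unfolding circlepath_def by (subst (asm) has_contour_integral_part_circlepath_iff) auto
  then have "((\<lambda>t. (- \<i>) * (G (cis t) / (cis t - b) * 1 * \<i> * cis t)) has_integral ((- \<i>) * (2 * of_real pi * \<i> * g b))) {0..2*pi}"
    by (rule has_integral_mult_right)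
  moreover have "(- \<i>) * (G (cis t) / (cis t - b) * 1 * \<i> * cis t) =
     g (cis t) * of_real ((1 - (norm b)\<^sup>2) / (norm (1 - cnj b * cis t))\<^sup>2)" for t
  proof -
    have c: "cis t * cnj (cis t) = 1" using complex_norm_square[of "cis t"] by simp
    have e: "cis t - b = cis t * cnj (1 - cnj b * cis t)"
    proof -
      have "cis t * cnj (1 - cnj b * cis t) = cis t - b * (cis t * cnj (cis t))"
        by (simp add: algebra_simps)
      then show ?thesis unfolding c by simp
    qed
    have "(- \<i>) * (G (cis t) / (cis t - b) * 1 * \<i> * cis t) = G (cis t) * cis t / (cis t - b)"
    proof -
      have "(- \<i>) * (a * 1 * \<i> * w) = a * w" for a w
        by (simp add: complex_eq_iff)
      then show ?thesis by simp
    qed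
    also have "\<dots> = G (cis t) / cnj (1 - cnj b * cis t)" unfolding e by simp
    also have "\<dots> = g (cis t) * (1 - of_real ((norm b)\<^sup>2)) / of_real ((norm (1 - cnj b * cis t))\<^sup>2)"
      unfolding G_def complex_norm_square by simp
    finally show ?thesis by simp
  qed
  ultimately show ?thesis by (simp add: algebra_simps)
qed

lemma mean_value_circle:
  fixes g :: "complex \<Rightarrow> complex"
  assumes cont: "continuous_on (cball 0 1) g" and hol: "g holomorphic_on ball 0 1"
  shows "((\<lambda>t. g (cis t)) has_integral 2 * pi * g 0) {0..2*pi}"
  using Poisson_formula_circle[OF assms, of 0] by simp

lemma has_integral_Re:
  assumes "(f has_integral I) S"
  shows "((\<lambda>x. Re (f x)) has_integral Re I) S"
  using has_integral_linear[OF assms bounded_linear_Re] by (simp add: o_def)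

lemma nn_integral_Poisson_circle:
  fixes g :: "complex \<Rightarrow> complex"
  assumes cont: "continuous_on (cball 0 1) g" and hol: "g holomorphic_on ball 0 1" and b: "norm b < 1"
    and pos: "\<And>z. z \<in> cball 0 1 \<Longrightarrow> 0 \<le> Re (g z)"
  shows "(\<integral>\<^sup>+t\<in>{0..2*pi}. ennreal (Re (g (cis t)) * ((1 - (norm b)\<^sup>2) / (norm (1 - cnj b * cis t))\<^sup>2)) \<partial>lborel)
         = ennreal (2 * pi * Re (g b))"
proof -
  have "((\<lambda>t. Re (g (cis t) * of_real ((1 - (norm b)\<^sup>2) / (norm (1 - cnj b * cis t))\<^sup>2))) has_integral Re (2 * pi * g b)) {0..2*pi}"
    by (rule has_integral_Re) (use Poisson_formula_circle[OF cont hol b] in simp)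
  then have I: "((\<lambda>t. Re (g (cis t)) * ((1 - (norm b)\<^sup>2) / (norm (1 - cnj b * cis t))\<^sup>2)) has_integral (2 * pi * Re (g b))) {0..2*pi}"
    by simp
  show ?thesis
    using b by (intro nn_integral_has_integral_lebesgue' I mult_nonneg_nonneg divide_nonneg_nonneg pos)
      (auto simp: power_le_one)
qed

text \<open>Jensen's inequality for the convex function \<open>x powr p\<close>, obtained by
  integrating its tangent line at c = |g 0|. The linear term is bounded below by the mean value
  property and the triangle inequality.\<close>

lemma submean_circle:
  fixes g :: "complex \<Rightarrow> complex"
  assumes cont: "continuous_on (cball 0 1) g" and hol: "g holomorphic_on ball 0 1" and p: "1 < p"
  shows "ennreal (2 * pi * norm (g 0) powr p) \<le> (\<integral>\<^sup>+t\<in>{0..2*pi}. ennreal (norm (g (cis t)) powr p) \<partial>lborel)"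
proof -
  define c where "c = norm (g 0)"
  have cn: "continuous_on {0..2*pi} (\<lambda>t. norm (g (cis t)))"
    by (intro continuous_intros continuous_on_compose2[OF cont]) auto
  then have cp: "continuous_on {0..2*pi} (\<lambda>t. norm (g (cis t)) powr p)"
    using p by (intro continuous_on_powr'[OF cn continuous_on_const]) auto
  obtain J where J: "((\<lambda>t. norm (g (cis t))) has_integral J) {0..2*pi}"
    using integrable_continuous_real[OF cn] by (auto simp: integrable_on_def)
  obtain L where L: "((\<lambda>t. norm (g (cis t)) powr p) has_integral L) {0..2*pi}"
    using integrable_continuous_real[OF cp] by (auto simp: integrable_on_def)
  have mv: "((\<lambda>t. g (cis t)) has_integral 2 * pi * g 0) {0..2*pi}"
    by (rule mean_value_circle[OF cont hol])
  have "norm (2 * pi * g 0) \<le> J"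
    using integral_norm_bound_integral[of "\<lambda>t. g (cis t)" "{0..2*pi}" "\<lambda>t. norm (g (cis t))"] mv J
    by (metis has_integral_integrable_integral order_refl)
  then have J2: "2 * pi * c \<le> J" by (simp add: norm_mult c_def)
  \<comment> \<open>The conjugate exponent: Young's inequality for x and
    \<open>c powr (p - 1)\<close> is the tangent line bound, since (p - 1) * q = p.\<close>
  define q where "q = p / (p - 1)"
  have q: "q > 1" "1/p + 1/q = 1" using p by (auto simp: q_def field_simps)
  have qp: "(p - 1) * q = p" using p by (simp add: q_def)
  \<comment> \<open>the tangent line of \<open>x powr p\<close> at \<open>c\<close>\<close>
  have young: "p * (c powr (p - 1)) * x - (p - 1) * c powr p \<le> x powr p" if "x \<ge> 0" for x
  proof -
    have "x * c powr (p-1) \<le> x powr p / p + (c powr (p-1)) powr q / q"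
      using Youngs_inequality[OF p q] that by simp
    also have "(c powr (p-1)) powr q / q = c powr p * (p-1) / p"
      by (simp add: powr_powr qp) (simp add: q_def)
    finally show ?thesis using p by (simp add: field_simps)
  qed
  have I: "((\<lambda>t. p * (c powr (p - 1)) * norm (g (cis t)) - (p - 1) * c powr p) has_integral
      (p * (c powr (p - 1)) * J - 2 * pi * ((p - 1) * c powr p))) {0..2*pi}"
    using has_integral_diff[OF has_integral_mult_right[OF J, of "p * (c powr (p - 1))"]
       has_integral_const_real[of "(p - 1) * c powr p" 0 "2*pi"]] by simp
  have "p * (c powr (p - 1)) * J - 2 * pi * ((p - 1) * c powr p) \<le> L"
    by (rule has_integral_le[OF I L]) (simp add: young)
  moreover have "p * (c powr (p - 1)) * J \<ge> p * (c powr (p - 1)) * (2 * pi * c)"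
    using J2 p by (intro mult_left_mono) auto
  moreover have "p * (c powr (p - 1)) * (2 * pi * c) = 2 * pi * p * c powr p"
    using powr_mult_base[of c "p-1"] by (simp add: c_def algebra_simps)
  moreover have "2 * pi * ((p - 1) * c powr p) = 2 * pi * p * c powr p - 2 * pi * c powr p"
    by (simp add: algebra_simps)
  ultimately have "2 * pi * c powr p \<le> L" by linarith
  then show ?thesis
    using nn_integral_has_integral_lebesgue'[OF _ L] by (simp add: c_def ennreal_leI)
qed


text \<open>The disk of radius sqrt x has area pi * x, so the squared modulus is uniformly
  distributed. Comparing both measures on half-lines suffices.\<close>

lemma radial_distribution_disk:
  "distr (density lborel (indicator (ball (0::complex) 1))) borel (\<lambda>z. (norm z)\<^sup>2)
   = density lborel (\<lambda>t::real. ennreal pi * indicator {0..1} t)"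
proof (rule measure_eqI_lessThan)
  have cb: "emeasure lborel (cball (0::complex) r) = ennreal (pi * r\<^sup>2)" if "r \<ge> 0" for r
    using emeasure_cball[OF that, of "0::complex"] by (simp add: unit_ball_vol_2)
  have b: "emeasure lborel (ball (0::complex) 1) = ennreal pi"
    using emeasure_ball[of 1 "0::complex"] by (simp add: unit_ball_vol_2)
  have L: "emeasure (distr (density lborel (indicator (ball (0::complex) 1))) borel (\<lambda>z. (norm z)\<^sup>2)) {x<..}
     = emeasure lborel ({z. x < (norm z)\<^sup>2} \<inter> ball (0::complex) 1)" for x :: real
  proof -
    have [measurable]: "{z. x < (norm z)\<^sup>2} \<in> sets (borel :: complex measure)" by measurable
    have "(\<lambda>z. (norm z)\<^sup>2) -` {x<..} = {z::complex. x < (norm z)\<^sup>2}" by auto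
    then show ?thesis
      by (simp add: emeasure_distr emeasure_restricted Int_commute)
  qed
  have R: "emeasure (density lborel (\<lambda>t::real. ennreal pi * indicator {0..1} t)) {x<..} =
    ennreal pi * emeasure lborel ({0..1} \<inter> {x<..})" for x
    by (simp add: emeasure_density nn_integral_cmult indicator_inter_arith[symmetric] mult.assoc)
  show eq: "emeasure (distr (density lborel (indicator (ball (0::complex) 1))) borel (\<lambda>z. (norm z)\<^sup>2)) {x<..}
    = emeasure (density lborel (\<lambda>t::real. ennreal pi * indicator {0..1} t)) {x<..}" for x
  proof -
    consider "x < 0" | "0 \<le> x" "x < 1" | "1 \<le> x" by linarith
    then show ?thesis
    proof cases
      case 1
      then have "{z. x < (norm z)\<^sup>2} \<inter> ball (0::complex) 1 = ball 0 1" "{0..1} \<inter> {x<..} = {0..1}"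
        by (auto intro: less_le_trans)
      then show ?thesis unfolding L R by (simp add: b)
    next
      case 2
      have lt: "x < (norm z)\<^sup>2 \<longleftrightarrow> sqrt x < norm z" for z :: complex
        by (metis real_sqrt_less_iff real_sqrt_abs abs_of_nonneg norm_ge_zero)
      have e: "{z. x < (norm z)\<^sup>2} \<inter> ball (0::complex) 1 = ball 0 1 - cball 0 (sqrt x)" "{0..1} \<inter> {x<..} = {x<..1}"
        using 2 by (auto simp: lt)
      have "sqrt x < 1" using 2 by simp
      then have sub: "cball (0::complex) (sqrt x) \<subseteq> ball 0 1" by (intro cball_subset_ball_iff[THEN iffD2]) (simp add: \<open>sqrt x < 1\<close>)
      have "emeasure lborel (ball 0 1 - cball (0::complex) (sqrt x)) = ennreal pi - ennreal (pi * x)"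
        using 2 by (subst emeasure_Diff[OF _ _ _ sub]) (simp_all add: b cb)
      also have "\<dots> = ennreal (pi * (1 - x))"
        using 2 by (subst ennreal_minus) (auto simp: algebra_simps)
      finally show ?thesis unfolding L R e using 2 by (simp add: ennreal_mult)
    next
      case 3
      then have "{z. x < (norm z)\<^sup>2} \<inter> ball (0::complex) 1 = {}" "{0..1} \<inter> {x<..} = {}"
        by (auto simp: not_less) (smt (verit) power_le_one norm_ge_zero)+
      then show ?thesis unfolding L R by simp
    qed
  qed
  show "emeasure (distr (density lborel (indicator (ball (0::complex) 1))) borel (\<lambda>z. (norm z)\<^sup>2)) {x<..} < \<infinity>" for x
    unfolding eq R by (auto simp: ennreal_mult_less_top intro: le_less_trans[OF emeasure_mono[of _ "{0..1}"]])
qed auto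

text \<open>Analytic functions are constrained only on the disk, so measurability is asked of their
  product with its indicator.\<close>

lemma ennreal_continuous_indicator_measurable:
  fixes g :: "'a::topological_space \<Rightarrow> real"
  assumes "S \<in> sets borel" "continuous_on S g"
  shows "(\<lambda>x. ennreal (g x) * indicator S x) \<in> borel_measurable borel"
proof -
  have "(\<lambda>x. indicat_real S x *\<^sub>R g x) \<in> borel_measurable borel"
    by (rule borel_measurable_continuous_on_indicator[OF assms])
  then have "(\<lambda>x. ennreal (indicat_real S x *\<^sub>R g x)) \<in> borel_measurable borel" by measurable
  also have "(\<lambda>x. ennreal (indicat_real S x *\<^sub>R g x)) = (\<lambda>x. ennreal (g x) * indicator S x)"
    by (auto simp: indicator_def)
  finally show ?thesis .
qed

text \<open>In the uniformly distributed variable |z|^2 the integral is one-dimensional. Replacing 1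
  - |z| by the smaller (1 - |z|^2) / 2 only increases the value of a decreasing h and makes the
  substitution affine.\<close>

lemma nn_integral_disk_radial_le:
  fixes h :: "real \<Rightarrow> ennreal"
  assumes [measurable]: "h \<in> borel_measurable borel"
    and dec: "\<And>x y. 0 < x \<Longrightarrow> x \<le> y \<Longrightarrow> y \<le> 1 \<Longrightarrow> h y \<le> h x"
  shows "(\<integral>\<^sup>+z\<in>ball (0::complex) 1. h (1 - norm z) \<partial>lborel) \<le> ennreal (2 * pi) * (\<integral>\<^sup>+x\<in>{0..1}. h x \<partial>lborel)"
proof -
  have "(\<integral>\<^sup>+z\<in>ball (0::complex) 1. h (1 - norm z) \<partial>lborel)
      \<le> (\<integral>\<^sup>+z\<in>ball (0::complex) 1. h ((1 - (norm z)\<^sup>2) / 2) \<partial>lborel)"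
  proof (rule nn_integral_mono)
    fix z :: complex
    show "h (1 - norm z) * indicator (ball 0 1) z \<le> h ((1 - (norm z)\<^sup>2) / 2) * indicator (ball 0 1) z"
    proof (cases "norm z < 1")
      case True
      have "(norm z)\<^sup>2 < 1" using True by (simp add: power_less_one_iff abs_square_less_1)
      then have i1: "0 < (1 - (norm z)\<^sup>2) / 2" by simp
      have "1 - norm z - (1 - (norm z)\<^sup>2) / 2 = (1 - norm z)\<^sup>2 / 2"
        by (simp add: power2_eq_square field_simps)
      then have i2: "(1 - (norm z)\<^sup>2) / 2 \<le> 1 - norm z"
        by (metis diff_ge_0_iff_ge zero_le_divide_iff zero_le_numeral zero_le_power2)
      have "h (1 - norm z) \<le> h ((1 - (norm z)\<^sup>2) / 2)"
        by (rule dec[OF i1 i2]) simp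
      then show ?thesis by (intro mult_right_mono) auto
    qed auto
  qed
  also have "\<dots> = (\<integral>\<^sup>+z. h ((1 - (norm z)\<^sup>2) / 2) \<partial>density lborel (indicator (ball (0::complex) 1)))"
    by (subst nn_integral_density) (auto simp: mult.commute intro: borel_measurable_indicator)
  also have "\<dots> = (\<integral>\<^sup>+t. h ((1 - t) / 2) \<partial>distr (density lborel (indicator (ball (0::complex) 1))) borel (\<lambda>z. (norm z)\<^sup>2))"
    by (subst nn_integral_distr) auto
  also have "\<dots> = ennreal pi * (\<integral>\<^sup>+t. indicator {0..1} t * h ((1 - t) / 2) \<partial>lborel)"
    unfolding radial_distribution_disk by (simp add: nn_integral_density nn_integral_cmult mult.assoc)
  also have "(\<integral>\<^sup>+t. indicator {0..1} t * h ((1 - t) / 2) \<partial>lborel) = ennreal 2 * (\<integral>\<^sup>+x. indicator {0..1} (1 - 2 * x) * h x \<partial>lborel)"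
    by (subst nn_integral_real_affine[where c="-2" and t=1]) auto
  \<comment> \<open>The new variable (1 - t) / 2 runs through [0, 1/2] only.\<close>
  also have "(\<integral>\<^sup>+x. indicator {0..1::real} (1 - 2 * x) * h x \<partial>lborel) \<le> (\<integral>\<^sup>+x\<in>{0..1}. h x \<partial>lborel)"
    by (intro nn_integral_mono) (auto simp: indicator_def)
  also have "ennreal pi * (ennreal 2 * (\<integral>\<^sup>+x\<in>{0..1}. h x \<partial>lborel)) = ennreal (2 * pi) * (\<integral>\<^sup>+x\<in>{0..1}. h x \<partial>lborel)"
    by (simp add: ennreal_mult mult_ac)
  finally show ?thesis by (simp add: mult_left_mono)
qed

text \<open>The circle version is applied to y -> f (w + y * z) for each z in the disk of radius R
  about 0, and the results are integrated over z.\<close>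

lemma submean_disk:
  fixes f :: "complex \<Rightarrow> complex"
  assumes hol: "f holomorphic_on S" and "open S" and sub: "ball w R \<subseteq> S" and "0 < R" and p: "1 < p"
  shows "ennreal (pi * R\<^sup>2 * norm (f w) powr p) \<le> (\<integral>\<^sup>+z\<in>ball w R. ennreal (norm (f z) powr p) \<partial>lborel)"
proof -
  have cont: "continuous_on S f" by (rule holomorphic_on_imp_continuous_on[OF hol])
  define G where "G = (\<lambda>z. ennreal (norm (f (w + z)) powr p) * indicator (ball 0 R) z)"
  have hw: "(\<lambda>z. f (w + z)) holomorphic_on ball 0 R"
    by (rule holomorphic_on_compose_gen[of "\<lambda>z. w + z" _ f S, unfolded o_def])
       (use sub in \<open>auto intro!: holomorphic_intros hol\<close>)
  have cw: "continuous_on (ball 0 R) (\<lambda>z. f (w + z))"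
    by (rule holomorphic_on_imp_continuous_on[OF hw])
  have Gm [measurable]: "G \<in> borel_measurable borel" unfolding G_def
    using p by (intro ennreal_continuous_indicator_measurable continuous_on_powr'[OF continuous_on_norm[OF cw] continuous_on_const]) auto
  have Gf: "G (z - w) = ennreal (norm (f z) powr p) * indicator (ball w R) z" for z
    by (auto simp: G_def indicator_def dist_norm norm_minus_commute)
  have tr: "(\<integral>\<^sup>+z. G z \<partial>lborel) = (\<integral>\<^sup>+z\<in>ball w R. ennreal (norm (f z) powr p) \<partial>lborel)"
  proof -
    have "(\<integral>\<^sup>+z. G z \<partial>lborel) = (\<integral>\<^sup>+z. G z \<partial>(distr lborel borel ((+) (- w))))"
      by (simp add: lborel_distr_plus)
    also have "\<dots> = (\<integral>\<^sup>+z. G (z - w) \<partial>lborel)"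
      by (subst nn_integral_distr) auto
    finally show ?thesis by (simp add: Gf)
  qed
  have "ennreal (2 * pi) * ennreal (pi * R\<^sup>2 * norm (f w) powr p)
      = (\<integral>\<^sup>+z. ennreal (2 * pi * norm (f w) powr p) * indicator (ball (0::complex) R) z \<partial>lborel)"
  proof -
    have "(\<integral>\<^sup>+z. ennreal (2 * pi * norm (f w) powr p) * indicator (ball (0::complex) R) z \<partial>lborel)
      = ennreal (2 * pi * norm (f w) powr p) * ennreal (pi * R\<^sup>2)"
      using \<open>0 < R\<close> emeasure_ball[of R "0::complex"]
      by (subst nn_integral_cmult_indicator) (auto simp: unit_ball_vol_2)
    then show ?thesis by (simp add: ennreal_mult[symmetric] mult_ac)
  qed
  also have "\<dots> \<le> (\<integral>\<^sup>+z. (\<integral>\<^sup>+t\<in>{0..2*pi}. G (cis t * z) \<partial>lborel) \<partial>lborel)"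
  proof (rule nn_integral_mono)
    fix z :: complex
    show "ennreal (2 * pi * norm (f w) powr p) * indicator (ball 0 R) z \<le> (\<integral>\<^sup>+t\<in>{0..2*pi}. G (cis t * z) \<partial>lborel)"
    proof (cases "norm z < R")
      case True
      have yz: "norm (y * z) < R" if "norm y \<le> 1" for y
        using True that by (smt (verit) mult_left_le_one_le norm_ge_zero norm_mult)
      then have m: "(\<lambda>y. y * z) ` cball 0 1 \<subseteq> ball 0 R" by auto
      have "ennreal (2 * pi * norm ((\<lambda>y. f (w + y * z)) 0) powr p) \<le> (\<integral>\<^sup>+t\<in>{0..2*pi}. ennreal (norm ((\<lambda>y. f (w + y * z)) (cis t)) powr p) \<partial>lborel)"
      proof (rule submean_circle[OF _ _ p])
        show "continuous_on (cball 0 1) (\<lambda>y. f (w + y * z))"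
          by (rule continuous_on_compose2[OF cw _ m]) (intro continuous_intros)
        show "(\<lambda>y. f (w + y * z)) holomorphic_on ball 0 1"
          by (intro holomorphic_on_compose_gen[of "\<lambda>y. y * z" _ "\<lambda>y. f (w + y)" "ball 0 R", unfolded o_def] hw)
             (auto intro!: holomorphic_intros yz simp del: norm_mult)
      qed
      also have "\<dots> = (\<integral>\<^sup>+t\<in>{0..2*pi}. G (cis t * z) \<partial>lborel)"
        using True by (intro nn_integral_cong) (simp add: G_def norm_mult)
      finally show ?thesis using True by simp
    qed simp
  qed
  also have "\<dots> = ennreal (2 * pi) * (\<integral>\<^sup>+z. G z \<partial>lborel)"
    by (rule nn_integral_circle_average[symmetric]) simp
  finally show ?thesis
    unfolding tr by (subst (asm) ennreal_mult_le_mult_iff) auto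
qed

lemma Re_Cayley_transform: 
  assumes "u \<noteq> (1::complex)"
  shows "Re ((1 + u) / (1 - u)) = (1 - (norm u)\<^sup>2) / (norm (1 - u))\<^sup>2"
  by (simp add: Re_divide cmod_power2) (simp add: algebra_simps power2_eq_square)

lemma continuous_on_norm_powr:
  assumes "continuous_on S f" "0 < (p::real)"
  shows "continuous_on S (\<lambda>z. norm (f z :: complex) powr p)"
  using assms by (intro continuous_on_powr'[OF continuous_on_norm[OF assms(1)] continuous_on_const]) auto

section \<open>The kernel\<close>

lemma norm_cnj_mult_less_1:
  assumes "norm a < 1" "norm w < 1"
  shows "norm (cnj a * w) < 1"
  using norm_mult_less[of "cnj a" 1 w 1] assms by simp

lemma norm_one_minus_cnj_mult_ge:
  assumes "norm a < 1" "norm w < 1"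
  shows "1 - norm w \<le> norm (1 - cnj a * w)" "1 - norm a \<le> norm (1 - cnj a * w)"
    "1 - norm a * norm w \<le> norm (1 - cnj a * w)"
proof -
  have "1 - norm (cnj a * w) \<le> norm (1 - cnj a * w)" by (metis norm_one norm_triangle_ineq2)
  then show *: "1 - norm a * norm w \<le> norm (1 - cnj a * w)" by (simp add: norm_mult)
  have "norm a * norm w \<le> norm w" "norm a * norm w \<le> norm a"
    using assms by (auto intro: mult_left_le_one_le mult_left_le)
  then show "1 - norm w \<le> norm (1 - cnj a * w)" "1 - norm a \<le> norm (1 - cnj a * w)"
    using * by linarith+
qed

lemma one_minus_cnj_mult_nonzero:
  assumes "norm a < 1" "norm w < 1"
  shows "1 - cnj a * w \<noteq> 0"
  using norm_one_minus_cnj_mult_ge(1)[OF assms] assms by auto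

text \<open>Modulus of a Szegoe-type kernel, normalised to be 1 at w = a.\<close>

definition bkernel :: "complex \<Rightarrow> complex \<Rightarrow> real" where
  "bkernel a w = (1 - (norm a)\<^sup>2) / norm (1 - cnj a * w)"

text \<open>For |a| < 1 an analytic map of the disk into the right half plane, the Cayley transform
  of cnj a * w. Its real part is the positive harmonic function that replaces the square of the
  kernel.\<close>

definition cayley :: "complex \<Rightarrow> complex \<Rightarrow> complex" where
  "cayley a w = (1 + cnj a * w) / (1 - cnj a * w)"

lemma Re_cayley:
  assumes "norm a < 1" "norm w < 1"
  shows "Re (cayley a w) = (1 - (norm a)\<^sup>2 * (norm w)\<^sup>2) / (norm (1 - cnj a * w))\<^sup>2"
  using one_minus_cnj_mult_nonzero[OF assms] Re_Cayley_transform[of "cnj a * w"]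
  by (simp add: cayley_def norm_mult power_mult_distrib)

lemma Re_cayley_ge:
  assumes "norm a < 1" "norm w < 1"
  shows "(1 - (norm a)\<^sup>2) / (norm (1 - cnj a * w))\<^sup>2 \<le> Re (cayley a w)"
  unfolding Re_cayley[OF assms]
  using assms by (intro divide_right_mono) (auto simp: mult_left_le power_le_one)

lemma Re_cayley_nonneg:
  assumes "norm a < 1" "norm w < 1"
  shows "0 \<le> Re (cayley a w)"
  using assms by (intro order_trans[OF _ Re_cayley_ge[OF assms]]) (auto simp: power_le_one)

lemma Re_cayley_le:
  assumes "norm a < 1" "norm w < 1"
  shows "Re (cayley a w) \<le> 2 / (1 - norm w)"
proof -
  have "Re (cayley a w) \<le> norm (cayley a w)" by (rule complex_Re_le_cmod)
  also have "\<dots> \<le> 2 / (1 - norm w)"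
    unfolding cayley_def norm_divide
    using norm_one_minus_cnj_mult_ge[OF assms] norm_triangle_ineq[of 1 "cnj a * w"] norm_cnj_mult_less_1[OF assms] assms
    by (intro frac_le) auto
  finally show ?thesis .
qed

lemma bkernel_nonneg: "norm a < 1 \<Longrightarrow> 0 \<le> bkernel a w"
  by (simp add: bkernel_def power_le_one)

text \<open>The last bound is the decisive one: two powers of the kernel are exchanged for the
  harmonic function at the price of the factor 1 - |a|. The other two bounds control all remaining
  powers.\<close>

lemma bkernel_bounds:
  assumes "norm a < 1" "norm w < 1"
  shows "bkernel a w \<le> 2" "bkernel a w \<le> 2 * (1 - norm a) / (1 - norm w)"
    "(bkernel a w)\<^sup>2 \<le> 2 * (1 - norm a) * Re (cayley a w)"
proof -
  have e: "1 - (norm a)\<^sup>2 = (1 + norm a) * (1 - norm a)" by (simp add: power2_eq_square algebra_simps)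
  have le: "1 - (norm a)\<^sup>2 \<le> 2 * (1 - norm a)" unfolding e using assms by (intro mult_right_mono) auto
  have ge0: "0 \<le> 1 - (norm a)\<^sup>2" using assms by (simp add: power_le_one)
  have "bkernel a w \<le> 2 * (1 - norm a) / (1 - norm a)"
    unfolding bkernel_def using le assms norm_one_minus_cnj_mult_ge[OF assms] by (intro frac_le) auto
  also have "2 * (1 - norm a) / (1 - norm a) = 2"
    using assms by (intro nonzero_mult_div_cancel_right) auto
  finally show "bkernel a w \<le> 2" .
  show "bkernel a w \<le> 2 * (1 - norm a) / (1 - norm w)"
    unfolding bkernel_def using le assms norm_one_minus_cnj_mult_ge[OF assms] by (intro frac_le) auto
  have "(bkernel a w)\<^sup>2 = (1 - (norm a)\<^sup>2) * ((1 - (norm a)\<^sup>2) / (norm (1 - cnj a * w))\<^sup>2)"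
    by (simp add: bkernel_def power_divide power2_eq_square)
  also have "\<dots> \<le> (2 * (1 - norm a)) * Re (cayley a w)"
    using le ge0 assms by (intro mult_mono Re_cayley_ge) auto
  finally show "(bkernel a w)\<^sup>2 \<le> 2 * (1 - norm a) * Re (cayley a w)" .
qed

text \<open>With X = 1 - |w|, a point a at distance less than X / 2 from w has 1 - |a|^2 >= X / 2,
  while |1 - cnj a * w| <= 2 * X + X / 2. The quotient of these bounds is 1/5.\<close>

lemma bkernel_near_diagonal:
  assumes w: "norm w < 1" and a: "norm (a - w) < (1 - norm w) / 2"
  shows "1/5 \<le> bkernel a w" "norm a < 1" "(1 - norm w) / 2 \<le> 1 - norm a" "1 - norm a \<le> 3/2 * (1 - norm w)"
proof -
  define X where "X = 1 - norm w"
  have X: "0 < X" using w by (simp add: X_def)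
  have "norm a \<le> norm w + norm (a - w)" "norm w \<le> norm a + norm (a - w)"
    by (metis add.commute diff_add_cancel norm_triangle_ineq, metis norm_triangle_sub norm_minus_commute)
  then show 1: "norm a < 1" "(1 - norm w) / 2 \<le> 1 - norm a" "1 - norm a \<le> 3/2 * (1 - norm w)"
    using a w by (simp_all add: field_simps)
  have "1 - cnj a * w = of_real (1 - (norm w)\<^sup>2) + cnj (w - a) * w"
    by (simp add: algebra_simps complex_norm_square flip: of_real_power)
  then have "norm (1 - cnj a * w) \<le> \<bar>1 - (norm w)\<^sup>2\<bar> + norm (w - a) * norm w"
    by (metis norm_triangle_ineq norm_of_real norm_mult complex_mod_cnj)
  also have "\<bar>1 - (norm w)\<^sup>2\<bar> \<le> 2 * X"
  proof -
    have "1 - (norm w)\<^sup>2 = (1 + norm w) * X" by (simp add: X_def power2_eq_square algebra_simps)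
    then show ?thesis using w X by (simp add: abs_mult)
  qed
  also have "norm (w - a) * norm w \<le> X / 2 * 1"
    using a w X by (intro mult_mono) (auto simp: X_def norm_minus_commute)
  finally have up: "norm (1 - cnj a * w) \<le> 5/2 * X" by simp
  have "(norm a)\<^sup>2 \<le> norm a" using 1 by (simp add: power2_eq_square mult_left_le)
  then have lo: "X / 2 \<le> 1 - (norm a)\<^sup>2" using 1 by (simp add: X_def)
  have "(X / 2) / (5/2 * X) \<le> bkernel a w"
    unfolding bkernel_def using X lo up one_minus_cnj_mult_nonzero[OF 1(1) w] by (intro frac_le) auto
  then show "1/5 \<le> bkernel a w" using X by simp
qed

lemma continuous_on_bkernel:
  assumes "continuous_on S f" "continuous_on S g" "\<And>x. x \<in> S \<Longrightarrow> norm (f x) < 1" "\<And>x. x \<in> S \<Longrightarrow> norm (g x) < 1"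
  shows "continuous_on S (\<lambda>x. bkernel (f x) (g x))"
  unfolding bkernel_def using assms one_minus_cnj_mult_nonzero
  by (intro continuous_intros) auto

text \<open>On the disk of radius (1 - |w|) / 2 about w the kernel is at least 1/5 and 1 - |a| is at
  most 3/2 * (1 - |w|). Both can be inserted into the submean inequality at the cost of constants,
  after which the integral may extend over the whole disk.\<close>

lemma pointwise_le_bkernel_integral:
  fixes f :: "complex \<Rightarrow> complex"
  assumes hol: "f holomorphic_on ball 0 1" and p: "1 < p" and w: "norm w < 1" and \<gamma>: "0 \<le> \<gamma>"
  shows "ennreal (norm (f w) powr p) \<le> ennreal (9 * 5 powr \<gamma> / pi) *
     (\<integral>\<^sup>+a\<in>ball 0 1. ennreal (norm (f a) powr p * bkernel a w powr \<gamma> / (1 - norm a)\<^sup>2) \<partial>lborel)"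
proof -
  define X where "X = 1 - norm w"
  have X: "0 < X" using w by (simp add: X_def)
  define I where "I = (\<integral>\<^sup>+a\<in>ball 0 1. ennreal (norm (f a) powr p * bkernel a w powr \<gamma> / (1 - norm a)\<^sup>2) \<partial>lborel)"
  have sub: "ball w (X/2) \<subseteq> ball 0 1"
    using bkernel_near_diagonal(2)[OF w] by (auto simp: X_def dist_norm norm_minus_commute)
  have cf: "continuous_on (ball 0 1) f" by (rule holomorphic_on_imp_continuous_on[OF hol])
  have c1: "continuous_on (ball 0 1) (\<lambda>a. norm (f a) powr p)"
    using p by (intro continuous_on_powr'[OF continuous_on_norm[OF cf] continuous_on_const]) auto
  have c2: "continuous_on (ball 0 1) (\<lambda>a. bkernel a w powr \<gamma>)"
  proof (intro continuous_on_powr continuous_on_bkernel continuous_on_id continuous_on_const)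
    show "\<forall>a\<in>ball 0 1. bkernel a w \<noteq> 0"
      using one_minus_cnj_mult_nonzero w by (auto simp: bkernel_def abs_square_eq_1)
  qed (use w in auto)
  have "continuous_on (ball 0 1) (\<lambda>a. norm (f a) powr p * bkernel a w powr \<gamma> / (1 - norm a)\<^sup>2)"
    by (intro continuous_on_divide continuous_on_mult c1 c2 continuous_intros) auto
  then have [measurable]: "(\<lambda>a. ennreal (norm (f a) powr p * bkernel a w powr \<gamma> / (1 - norm a)\<^sup>2) * indicator (ball 0 1) a) \<in> borel_measurable borel"
    by (intro ennreal_continuous_indicator_measurable) auto
  have "ennreal (pi * (X/2)\<^sup>2 * norm (f w) powr p) \<le> (\<integral>\<^sup>+z\<in>ball w (X/2). ennreal (norm (f z) powr p) \<partial>lborel)"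
    by (rule submean_disk[OF hol _ sub _ p]) (use X in auto)
  also have "\<dots> \<le> (\<integral>\<^sup>+a. ennreal (5 powr \<gamma> * (9/4) * X\<^sup>2) * (ennreal (norm (f a) powr p * bkernel a w powr \<gamma> / (1 - norm a)\<^sup>2) * indicator (ball 0 1) a) \<partial>lborel)"
  proof (rule nn_integral_mono)
    fix a
    show "ennreal (norm (f a) powr p) * indicator (ball w (X/2)) a \<le> 
       ennreal (5 powr \<gamma> * (9/4) * X\<^sup>2) * (ennreal (norm (f a) powr p * bkernel a w powr \<gamma> / (1 - norm a)\<^sup>2) * indicator (ball 0 1) a)"
    proof (cases "a \<in> ball w (X/2)")
      case True
      then have a: "norm (a - w) < (1 - norm w) / 2" by (simp add: X_def dist_norm norm_minus_commute)
      note b = bkernel_near_diagonal[OF w a]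
      have "1 = 5 powr \<gamma> * (1/5) powr \<gamma>" by (simp add: powr_mult[symmetric])
      also have "\<dots> \<le> 5 powr \<gamma> * bkernel a w powr \<gamma>"
        using b \<gamma> by (intro mult_left_mono powr_mono2) auto
      finally have 1: "1 \<le> 5 powr \<gamma> * bkernel a w powr \<gamma>" .
      have "(1 - norm a)\<^sup>2 \<le> (3/2 * X)\<^sup>2" using b by (intro power_mono) (auto simp: X_def)
      then have 2: "1 \<le> 9/4 * X\<^sup>2 / (1 - norm a)\<^sup>2" using b by (simp add: power_mult_distrib power_divide field_simps)
      have "1 * 1 \<le> (5 powr \<gamma> * bkernel a w powr \<gamma>) * (9/4 * X\<^sup>2 / (1 - norm a)\<^sup>2)"
        by (intro mult_mono 1 2) auto
      then have "norm (f a) powr p * 1 \<le> norm (f a) powr p * ((5 powr \<gamma> * bkernel a w powr \<gamma>) * (9/4 * X\<^sup>2 / (1 - norm a)\<^sup>2))"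
        by (intro mult_left_mono) auto
      then have "norm (f a) powr p \<le> (5 powr \<gamma> * (9/4) * X\<^sup>2) * (norm (f a) powr p * bkernel a w powr \<gamma> / (1 - norm a)\<^sup>2)"
        by (simp add: mult_ac)
      then show ?thesis using True b by (simp add: ennreal_mult[symmetric] ennreal_leI)
    qed auto
  qed
  also have "\<dots> = ennreal (5 powr \<gamma> * (9/4) * X\<^sup>2) * I"
    unfolding I_def by (rule nn_integral_cmult) simp
  finally have "ennreal (pi * (X/2)\<^sup>2 * norm (f w) powr p) \<le> ennreal (5 powr \<gamma> * (9/4) * X\<^sup>2) * I" .
  then have "ennreal (4 / (pi * X\<^sup>2)) * ennreal (pi * (X/2)\<^sup>2 * norm (f w) powr p) \<le> ennreal (4 / (pi * X\<^sup>2)) * (ennreal (5 powr \<gamma> * (9/4) * X\<^sup>2) * I)"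
    by (intro mult_left_mono) auto
  also have "ennreal (4 / (pi * X\<^sup>2)) * ennreal (pi * (X/2)\<^sup>2 * norm (f w) powr p) = ennreal (norm (f w) powr p)"
    using X by (simp add: ennreal_mult[symmetric] power_divide)
  also have "ennreal (4 / (pi * X\<^sup>2)) * (ennreal (5 powr \<gamma> * (9/4) * X\<^sup>2) * I) = ennreal (9 * 5 powr \<gamma> / pi) * I"
    using X by (simp add: ennreal_mult[symmetric] mult.assoc[symmetric])
  finally show ?thesis unfolding I_def .
qed

section \<open>Doubling weights\<close>

text \<open>
  The \<open>p\<close>-th power of the norm, up to the factor \<open>\<pi>\<close>.
\<close>

definition wnorm :: "real \<Rightarrow> (real \<Rightarrow> real) \<Rightarrow> (complex \<Rightarrow> complex) \<Rightarrow> ennreal" where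
  "wnorm p \<omega> f = (\<integral>\<^sup>+z\<in>ball 0 1. ennreal (norm (f z) powr p * \<omega> (norm z)) \<partial>lborel)"

text \<open>The two exponents play different roles: toward the circle the weight may grow at most
  like the power -\<kappa>, which is integrable, and may decay at most like the power K, which the
  kernel exponents have to beat.\<close>

locale doubling_weight =
  fixes \<omega> :: "real \<Rightarrow> real" and \<kappa> K :: real
  assumes weight_pos: "\<And>r. 0 \<le> r \<Longrightarrow> r < 1 \<Longrightarrow> 0 < \<omega> r"
    and weight_cont: "continuous_on {0..<1} \<omega>"
    and \<kappa>: "0 \<le> \<kappa>" "\<kappa> < 1" and K: "0 \<le> K"
    and weight_upper: "\<And>r s. 0 \<le> r \<Longrightarrow> r \<le> s \<Longrightarrow> s < 1 \<Longrightarrow> \<omega> s \<le> ((1 - s) / (1 - r)) powr (- \<kappa>) * \<omega> r"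
    and weight_lower: "\<And>r s. 0 \<le> r \<Longrightarrow> r \<le> s \<Longrightarrow> s < 1 \<Longrightarrow> \<omega> r \<le> ((1 - r) / (1 - s)) powr K * \<omega> s"
begin

lemma weight_nonneg: "0 \<le> r \<Longrightarrow> r < 1 \<Longrightarrow> 0 \<le> \<omega> r"
  using weight_pos by (simp add: less_imp_le)

lemma continuous_on_weight: "continuous_on (ball (0::complex) 1) (\<lambda>z. \<omega> (norm z))"
  by (rule continuous_on_compose2[OF weight_cont]) (auto intro!: continuous_intros)

lemma wnorm_measurable:
  assumes "f holomorphic_on ball 0 1" "0 < p"
  shows "(\<lambda>z. ennreal (norm (f z) powr p * \<omega> (norm z)) * indicator (ball 0 1) z) \<in> borel_measurable borel"
  using assms
  by (intro ennreal_continuous_indicator_measurable continuous_on_mult continuous_on_norm_powr continuous_on_weight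
       holomorphic_on_imp_continuous_on) auto

text \<open>If a is farther from the circle than w, the ratio of the distances is at most 3/2 and
  enters with exponent \<kappa> <= 1; otherwise it is at most 2 and enters with exponent K. The
  constant covers both cases.\<close>

lemma weight_le_nearby:
  fixes w a :: complex
  assumes w: "norm w < 1" and a: "norm (a - w) < (1 - norm w) / 2"
  shows "\<omega> (norm w) \<le> 2 powr (K + 1) * \<omega> (norm a)"
proof -
  note b = bkernel_near_diagonal[OF w a]
  have pos: "0 < \<omega> (norm a)" using b by (intro weight_pos) auto
  show ?thesis
  proof (cases "norm a \<le> norm w")
    case True
    have "\<omega> (norm w) \<le> ((1 - norm w) / (1 - norm a)) powr (- \<kappa>) * \<omega> (norm a)"
      using True w by (intro weight_upper) auto
    also have "((1 - norm w) / (1 - norm a)) powr (- \<kappa>) = ((1 - norm a) / (1 - norm w)) powr \<kappa>"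
      using w b by (simp add: powr_minus powr_divide field_simps)
    also have "\<dots> \<le> (3/2) powr \<kappa>"
      using w b \<kappa> by (intro powr_mono2) (auto simp: field_simps)
    also have "\<dots> \<le> (3/2) powr 1" using \<kappa> by (intro powr_mono) auto
    also have "\<dots> \<le> 2 powr 1" by simp
    also have "\<dots> \<le> 2 powr (K + 1)" using K by (intro powr_mono) auto
    finally show ?thesis using pos by (simp add: mult_right_mono)
  next
    case False
    have "\<omega> (norm w) \<le> ((1 - norm w) / (1 - norm a)) powr K * \<omega> (norm a)"
      using False b by (intro weight_lower) auto
    also have "((1 - norm w) / (1 - norm a)) powr K \<le> 2 powr K"
      using w b K by (intro powr_mono2) (auto simp: field_simps)
    also have "\<dots> \<le> 2 powr (K + 1)" using K by (intro powr_mono) auto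
    finally show ?thesis using pos by (simp add: mult_right_mono)
  qed
qed

text \<open>The area submean property on a disk where the weight is bounded below by a multiple of
  its value at w. It turns norm bounds into bounds that are uniform on compact subsets of the
  disk.\<close>

lemma point_evaluation:
  assumes hol: "f holomorphic_on ball 0 1" and p: "1 < p" and w: "norm w < 1"
  shows "ennreal (norm (f w) powr p * (\<omega> (norm w) * (1 - norm w)\<^sup>2)) \<le> ennreal (4 * 2 powr (K + 1) / pi) * wnorm p \<omega> f"
proof -
  define X where "X = 1 - norm w"
  have X: "0 < X" using w by (simp add: X_def)
  have wp: "0 < \<omega> (norm w)" using w by (intro weight_pos) auto
  have sub: "ball w (X/2) \<subseteq> ball 0 1"
    using bkernel_near_diagonal(2)[OF w] by (auto simp: X_def dist_norm norm_minus_commute)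
  have "ennreal (\<omega> (norm w)) * ennreal (pi * (X/2)\<^sup>2 * norm (f w) powr p)
     \<le> ennreal (\<omega> (norm w)) * (\<integral>\<^sup>+z\<in>ball w (X/2). ennreal (norm (f z) powr p) \<partial>lborel)"
    by (intro mult_left_mono submean_disk[OF hol _ sub _ p]) (use X in auto)
  also have "\<dots> = (\<integral>\<^sup>+z. ennreal (\<omega> (norm w)) * (ennreal (norm (f z) powr p) * indicator (ball w (X/2)) z) \<partial>lborel)"
  proof (rule nn_integral_cmult[symmetric])
    show "(\<lambda>z. ennreal (norm (f z) powr p) * indicator (ball w (X/2)) z) \<in> borel_measurable lborel"
      using p ennreal_continuous_indicator_measurable[OF _ continuous_on_norm_powr[OF continuous_on_subset[OF holomorphic_on_imp_continuous_on[OF hol] sub]], of p]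
      by simp
  qed
  also have "\<dots> \<le> (\<integral>\<^sup>+z. ennreal (2 powr (K + 1)) * (ennreal (norm (f z) powr p * \<omega> (norm z)) * indicator (ball 0 1) z) \<partial>lborel)"
  proof (rule nn_integral_mono)
    fix z
    show "ennreal (\<omega> (norm w)) * (ennreal (norm (f z) powr p) * indicator (ball w (X/2)) z) \<le>
      ennreal (2 powr (K + 1)) * (ennreal (norm (f z) powr p * \<omega> (norm z)) * indicator (ball 0 1) z)"
    proof (cases "z \<in> ball w (X/2)")
      case True
      then have a: "norm (z - w) < (1 - norm w) / 2" by (simp add: X_def dist_norm norm_minus_commute)
      have z: "norm z < 1" using True sub by auto
      have "\<omega> (norm w) * norm (f z) powr p \<le> 2 powr (K + 1) * \<omega> (norm z) * norm (f z) powr p"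
        by (intro mult_right_mono weight_le_nearby[OF w a]) auto
      then show ?thesis using True z wp weight_pos[of "norm z"]
        by (simp add: ennreal_mult[symmetric] ennreal_leI mult_ac less_imp_le)
    qed auto
  qed
  also have "\<dots> = ennreal (2 powr (K + 1)) * wnorm p \<omega> f"
    unfolding wnorm_def using p by (intro nn_integral_cmult) (simp add: wnorm_measurable[OF hol])
  finally have "ennreal (4 / pi) * (ennreal (\<omega> (norm w)) * ennreal (pi * (X/2)\<^sup>2 * norm (f w) powr p))
     \<le> ennreal (4 / pi) * (ennreal (2 powr (K + 1)) * wnorm p \<omega> f)"
    by (intro mult_left_mono) auto
  also have "\<dots> = ennreal (4 * 2 powr (K + 1) / pi) * wnorm p \<omega> f"
    by (simp add: mult.assoc[symmetric] ennreal_mult[symmetric])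
  also have "ennreal (4 / pi) * (ennreal (\<omega> (norm w)) * ennreal (pi * (X/2)\<^sup>2 * norm (f w) powr p)) =
      ennreal (norm (f w) powr p * (\<omega> (norm w) * (1 - norm w)\<^sup>2))"
    using wp by (simp add: ennreal_mult[symmetric] X_def[symmetric] power_divide mult_ac)
  finally show ?thesis .
qed

text \<open>The constant of \<open>radial_integral_le\<close>: after scaling by s, the summand 1 /
  (1 - \<kappa>) is the integral of the power -\<kappa> over [0, 1], and 1 that of the power -2 over
  the remaining half-line.\<close>

definition C\<^sub>0 :: real where "C\<^sub>0 = 2 * pi * (1 / (1 - \<kappa>) + 1)"

lemma C0_pos: "0 < C\<^sub>0"
  using \<kappa> by (simp add: C\<^sub>0_def add_pos_pos)

text \<open>The integral behaves as if only the annulus of width s at the circle counted. Inside it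
  the upper weight bound is integrable; farther from the circle, K of the M powers pay for the lower
  weight bound and at least two remain for convergence.\<close>

lemma radial_integral_le:
  assumes s: "0 < s" "s \<le> 1" and M: "K + 2 \<le> M"
  shows "(\<integral>\<^sup>+z\<in>ball (0::complex) 1. ennreal (\<omega> (norm z) * min 1 (s / (1 - norm z)) powr M) \<partial>lborel) \<le> ennreal (C\<^sub>0 * s * \<omega> (1 - s))"
proof -
  \<comment> \<open>A majorant of the integrand in x = 1 - |z|, divided by
    \<open>\<omega> (1 - s)\<close>. It is decreasing, as \<open>nn_integral_disk_radial_le\<close>
    requires.\<close>
  define h :: "real \<Rightarrow> real" where "h = (\<lambda>x. if x \<le> s then (x / s) powr (- \<kappa>) else (s / x) ^ 2)"
  have hm [measurable]: "h \<in> borel_measurable borel" unfolding h_def by measurable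
  have wp: "0 < \<omega> (1 - s)" using s by (intro weight_pos) auto
  have le1: "1 \<le> (x / s) powr (- \<kappa>)" if "0 < x" "x \<le> s" for x
  proof -
    have "(1::real) powr \<kappa> \<le> (s / x) powr \<kappa>" using that s \<kappa> by (intro powr_mono2) auto
    then show ?thesis using that s by (simp add: powr_minus powr_divide field_simps)
  qed
  have dec: "h y \<le> h x" if "0 < x" "x \<le> y" "y \<le> 1" for x y
  proof -
    consider "y \<le> s" | "x \<le> s" "s < y" | "s < x" by linarith
    then show ?thesis
    proof cases
      case 1
      have "(y / s) powr (- \<kappa>) \<le> (x / s) powr (- \<kappa>)"
        using that s \<kappa> by (intro powr_mono2') (auto simp: divide_right_mono)
      then show ?thesis using 1 that by (simp add: h_def)
    next
      case 2
      have "(s / y) ^ 2 \<le> 1" using 2 s by (intro power_le_one) auto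
      then show ?thesis using 2 that le1[of x] by (simp add: h_def)
    next
      case 3
      have "(s / y) ^ 2 \<le> (s / x) ^ 2" using 3 that s by (intro power_mono frac_le) auto
      then show ?thesis using 3 that by (simp add: h_def)
    qed
  qed
  have pt: "\<omega> (1 - x) * min 1 (s / x) powr M \<le> \<omega> (1 - s) * h x" if x: "0 < x" "x \<le> 1" for x
  proof (cases "x \<le> s")
    case True
    have "\<omega> (1 - x) \<le> (x / s) powr (- \<kappa>) * \<omega> (1 - s)"
      using weight_upper[of "1 - s" "1 - x"] True x s by simp
    then show ?thesis using True x by (simp add: h_def mult_ac min_def field_simps)
  next
    case False
    have "\<omega> (1 - x) \<le> (x / s) powr K * \<omega> (1 - s)"
      using weight_lower[of "1 - x" "1 - s"] False x s by simp
    then have "\<omega> (1 - x) * (s / x) powr M \<le> ((x / s) powr K * \<omega> (1 - s)) * (s / x) powr (K + 2)"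
      using False x s M K wp by (intro mult_mono powr_mono') auto
    also have "\<dots> = \<omega> (1 - s) * (s / x)^2"
      using x s by (simp add: powr_add powr_divide field_simps)
    finally show ?thesis using False x by (simp add: h_def min_def field_simps)
  qed
  have "(\<integral>\<^sup>+z\<in>ball (0::complex) 1. ennreal (\<omega> (norm z) * min 1 (s / (1 - norm z)) powr M) \<partial>lborel)
      \<le> (\<integral>\<^sup>+z\<in>ball (0::complex) 1. (ennreal (\<omega> (1 - s)) * ennreal (h (1 - norm z))) \<partial>lborel)"
  proof (rule nn_integral_mono)
    fix z :: complex
    show "ennreal (\<omega> (norm z) * min 1 (s / (1 - norm z)) powr M) * indicator (ball 0 1) z
       \<le> ennreal (\<omega> (1 - s)) * ennreal (h (1 - norm z)) * indicator (ball 0 1) z"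
      using pt[of "1 - norm z"] wp by (auto simp: indicator_def ennreal_mult'[symmetric] intro!: ennreal_leI)
  qed
  also have "\<dots> \<le> ennreal (2 * pi) * (\<integral>\<^sup>+x\<in>{0..1}. (ennreal (\<omega> (1 - s)) * ennreal (h x)) \<partial>lborel)"
    by (rule nn_integral_disk_radial_le) (auto intro!: mult_left_mono ennreal_leI dec)
  also have "(\<integral>\<^sup>+x\<in>{0..1}. (ennreal (\<omega> (1 - s)) * ennreal (h x)) \<partial>lborel) = ennreal (\<omega> (1 - s)) * (\<integral>\<^sup>+x\<in>{0..1}. ennreal (h x) \<partial>lborel)"
    by (simp add: mult.assoc nn_integral_cmult)
  also have "(\<integral>\<^sup>+x\<in>{0..1}. ennreal (h x) \<partial>lborel) \<le> ennreal (s / (1 - \<kappa>) + s)"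
  proof -
    have I1: "((\<lambda>x. s powr \<kappa> * x powr (- \<kappa>)) has_integral s powr \<kappa> * (s powr (- \<kappa> + 1) / (- \<kappa> + 1))) {0..s}"
      by (intro has_integral_mult_right has_integral_powr_from_0) (use \<kappa> s in auto)
    have I2: "((\<lambda>x. s\<^sup>2 * x powr (- 2)) has_integral s\<^sup>2 * (- (s powr (- 2 + 1)) / (- 2 + 1))) {s..}"
      by (intro has_integral_mult_right has_integral_powr_to_inf) (use s in auto)
    have e1: "s powr \<kappa> * (s powr (- \<kappa> + 1) / (- \<kappa> + 1)) = s / (1 - \<kappa>)"
      using s powr_add[of s \<kappa> "- \<kappa> + 1"] by simp
    have e2: "s\<^sup>2 * (- (s powr (- 2 + 1)) / (- 2 + 1)) = s"
      using s by (simp add: powr_minus power2_eq_square field_simps)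
    have "(\<integral>\<^sup>+x\<in>{0..1}. ennreal (h x) \<partial>lborel)
       \<le> (\<integral>\<^sup>+x. ennreal (s powr \<kappa> * x powr (- \<kappa>)) * indicator {0..s} x + ennreal (s\<^sup>2 * x powr (- 2)) * indicator {s..} x \<partial>lborel)"
    proof (rule nn_integral_mono)
      fix x :: real
      show "ennreal (h x) * indicator {0..1} x \<le> ennreal (s powr \<kappa> * x powr (- \<kappa>)) * indicator {0..s} x + ennreal (s\<^sup>2 * x powr (- 2)) * indicator {s..} x"
      proof (cases "0 \<le> x \<and> x \<le> s")
        case True
        then have "h x = s powr \<kappa> * x powr (- \<kappa>)"
          using s by (simp add: h_def powr_divide powr_minus field_simps)
        then show ?thesis using True s by (auto simp: indicator_def)
      next
        case False
        then have "h x = s\<^sup>2 * x powr (- 2)" if "0 \<le> x"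
          using s that by (simp add: h_def power_divide powr_minus field_simps)
        then show ?thesis using False s by (auto simp: indicator_def)
      qed
    qed
    also have "\<dots> = (\<integral>\<^sup>+x. ennreal (s powr \<kappa> * x powr (- \<kappa>)) * indicator {0..s} x \<partial>lborel) + (\<integral>\<^sup>+x. ennreal (s\<^sup>2 * x powr (- 2)) * indicator {s..} x \<partial>lborel)"
      by (rule nn_integral_add) auto
    also have "\<dots> = ennreal (s / (1 - \<kappa>)) + ennreal s"
      using nn_integral_has_integral_lebesgue'[OF _ I1] nn_integral_has_integral_lebesgue'[OF _ I2] unfolding e1 e2 by simp
    finally show ?thesis using s \<kappa> by (simp add: ennreal_plus)
  qed
  also have "ennreal (2 * pi) * (ennreal (\<omega> (1 - s)) * ennreal (s / (1 - \<kappa>) + s)) = ennreal (C\<^sub>0 * s * \<omega> (1 - s))"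
    using s \<kappa> wp by (simp add: ennreal_mult[symmetric] C\<^sub>0_def algebra_simps)
  finally show ?thesis by (simp add: mult_left_mono)
qed

text \<open>Two of the M + 2 powers become the harmonic function, whose circle means against V are
  at most Q. The other M become a radial factor, because \<phi> shrinks the distance to the circle
  at most by the factor c.\<close>

lemma kernel_integral_le:
  fixes \<phi> :: "complex \<Rightarrow> complex" and V :: "complex \<Rightarrow> real"
  assumes \<phi>: "continuous_on (ball 0 1) \<phi>" "\<phi> ` ball 0 1 \<subseteq> ball 0 1"
    and c: "0 < c" "c \<le> 1" "\<And>z. norm z < 1 \<Longrightarrow> c * (1 - norm z) \<le> 1 - norm (\<phi> z)"
    and V: "continuous_on (ball 0 1) V" "\<And>z. norm z < 1 \<Longrightarrow> 0 \<le> V z"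
    and M: "K + 2 \<le> M" and Q: "0 \<le> Q" and a: "norm a < 1"
    and mean: "\<And>z. norm z < 1 \<Longrightarrow>
       (\<integral>\<^sup>+t\<in>{0..2*pi}. ennreal (Re (cayley a (\<phi> (cis t * z))) * V (cis t * z)) \<partial>lborel) \<le> ennreal (2 * pi * Q)"
  shows "(\<integral>\<^sup>+z\<in>ball 0 1. ennreal (bkernel a (\<phi> z) powr (M + 2) * V z * \<omega> (norm z)) \<partial>lborel)
     \<le> ennreal (2 * (2 / c) powr M * C\<^sub>0 * Q * ((1 - norm a)\<^sup>2 * \<omega> (norm a)))"
proof -
  define s where "s = 1 - norm a"
  have s: "0 < s" "s \<le> 1" using a by (auto simp: s_def)
  have M0: "0 \<le> M" using M K by linarith
  have \<phi>1: "norm (\<phi> z) < 1" if "norm z < 1" for z using \<phi>(2) that by (simp add: image_subset_iff)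
  define R :: "complex \<Rightarrow> real" where "R = (\<lambda>z. \<omega> (norm z) * min 1 (s / (1 - norm z)) powr M)"
  have R0: "0 \<le> R z" if "norm z < 1" for z using that weight_nonneg by (simp add: R_def)
  define P :: "complex \<Rightarrow> real" where "P = (\<lambda>z. Re (cayley a (\<phi> z)) * V z)"
  have P0: "0 \<le> P z" if "norm z < 1" for z using that V(2) \<phi>1 a by (simp add: P_def Re_cayley_nonneg)
  have cP: "continuous_on (ball 0 1) P"
    unfolding P_def cayley_def using one_minus_cnj_mult_nonzero[OF a] \<phi>1
    by (intro continuous_intros \<phi>(1) V(1)) auto
  have cR: "continuous_on (ball 0 1) R"
    unfolding R_def by (intro continuous_on_mult continuous_on_weight continuous_on_powr continuous_intros) (use s in \<open>auto simp: min_def split: if_splits\<close>)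
  define G where "G = (\<lambda>z. ennreal (P z * R z) * indicator (ball 0 1) z)"
  have [measurable]: "G \<in> borel_measurable borel"
    unfolding G_def by (intro ennreal_continuous_indicator_measurable continuous_on_mult cP cR) auto
  have [measurable]: "(\<lambda>z. ennreal (R z) * indicator (ball 0 1) z) \<in> borel_measurable borel"
    by (intro ennreal_continuous_indicator_measurable cR) auto
  have [measurable]: "(\<lambda>z. ennreal (P z) * indicator (ball 0 1) z) \<in> borel_measurable borel"
    by (intro ennreal_continuous_indicator_measurable cP) auto
  have pt: "bkernel a (\<phi> z) powr (M + 2) * V z * \<omega> (norm z) \<le> 2 * s * (2 / c) powr M * (P z * R z)" if z: "norm z < 1" for z
  proof -
    note b = bkernel_bounds[OF a \<phi>1[OF z]]
    have b0: "0 \<le> bkernel a (\<phi> z)" by (rule bkernel_nonneg[OF a])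
    \<comment> \<open>At distance at least s from the circle the second kernel bound gives the
      decay. Closer to the circle the bound 2 is enough, as 2 <= 2 / c.\<close>
    have b2: "bkernel a (\<phi> z) \<le> (2 / c) * min 1 (s / (1 - norm z))"
    proof (cases "s \<le> 1 - norm z")
      case True
      have "bkernel a (\<phi> z) \<le> 2 * s / (1 - norm (\<phi> z))" using b(2) by (simp add: s_def)
      also have "\<dots> \<le> 2 * s / (c * (1 - norm z))"
        using c z s by (intro frac_le) auto
      also have "\<dots> = (2 / c) * min 1 (s / (1 - norm z))"
      proof -
        have "min 1 (s / (1 - norm z)) = s / (1 - norm z)" using True z by (intro min_absorb2) simp
        then show ?thesis by simp
      qed
      finally show ?thesis .
    next
      case False
      have "2 \<le> 2 / c" using c by (simp add: field_simps)
      moreover have "min 1 (s / (1 - norm z)) = 1" using False z by (intro min_absorb1) simp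
      ultimately show ?thesis using b(1) by simp
    qed
    have "bkernel a (\<phi> z) powr (M + 2) = bkernel a (\<phi> z) powr M * (bkernel a (\<phi> z))\<^sup>2"
      using b0 by (simp add: powr_add)
    also have "\<dots> \<le> ((2 / c) * min 1 (s / (1 - norm z))) powr M * (2 * s * Re (cayley a (\<phi> z)))"
      using b0 b2 b(3) M0 by (intro mult_mono powr_mono2) (auto simp: s_def)
    also have "((2 / c) * min 1 (s / (1 - norm z))) powr M = (2 / c) powr M * min 1 (s / (1 - norm z)) powr M"
      by (rule powr_mult)
    finally have "bkernel a (\<phi> z) powr (M + 2) * (V z * \<omega> (norm z)) \<le>
       (2 / c) powr M * min 1 (s / (1 - norm z)) powr M * (2 * s * Re (cayley a (\<phi> z))) * (V z * \<omega> (norm z))"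
      by (rule mult_right_mono) (use V(2)[OF z] weight_nonneg[of "norm z"] z in auto)
    then show ?thesis by (simp add: P_def R_def mult_ac)
  qed
  \<comment> \<open>\<open>R\<close> is radial, so averaging over rotations affects only
    \<open>P\<close>, whose circle means are bounded by \<open>mean\<close>.\<close>
  have "ennreal (2 * pi) * (\<integral>\<^sup>+z. G z \<partial>lborel) = (\<integral>\<^sup>+z. (\<integral>\<^sup>+t\<in>{0..2*pi}. G (cis t * z) \<partial>lborel) \<partial>lborel)"
    by (rule nn_integral_circle_average) simp
  also have "\<dots> \<le> (\<integral>\<^sup>+z. ennreal (2 * pi * Q) * (ennreal (R z) * indicator (ball 0 1) z) \<partial>lborel)"
  proof (rule nn_integral_mono)
    fix z :: complex
    show "(\<integral>\<^sup>+t\<in>{0..2*pi}. G (cis t * z) \<partial>lborel) \<le> ennreal (2 * pi * Q) * (ennreal (R z) * indicator (ball 0 1) z)"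
    proof (cases "norm z < 1")
      case True
      have "(\<lambda>t. ennreal (P (cis t * z)) * indicator {0..2*pi} t) =
        (\<lambda>t. ennreal (P (cis t * z)) * indicator (ball 0 1) (cis t * z) * indicator {0..2*pi} t)"
        using True by (auto simp: norm_mult indicator_def)
      also have "\<dots> \<in> borel_measurable borel"
        by (intro borel_measurable_times_ennreal measurable_compose[OF _ \<open>(\<lambda>z. ennreal (P z) * indicator (ball 0 1) z) \<in> _\<close>]) auto
      finally have [measurable]: "(\<lambda>t. ennreal (P (cis t * z)) * indicator {0..2*pi} t) \<in> borel_measurable borel" .
      have "(\<integral>\<^sup>+t\<in>{0..2*pi}. G (cis t * z) \<partial>lborel) = (\<integral>\<^sup>+t. ennreal (R z) * (ennreal (P (cis t * z)) * indicator {0..2*pi} t) \<partial>lborel)"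
        using True R0[OF True] P0
        by (intro nn_integral_cong) (simp add: G_def norm_mult R_def ennreal_mult[symmetric] mult_ac indicator_def)
      also have "\<dots> = ennreal (R z) * (\<integral>\<^sup>+t\<in>{0..2*pi}. ennreal (P (cis t * z)) \<partial>lborel)"
        by (rule nn_integral_cmult) simp
      also have "\<dots> \<le> ennreal (R z) * ennreal (2 * pi * Q)"
        using mean[OF True] unfolding P_def by (intro mult_left_mono) auto
      finally show ?thesis using True by (simp add: mult_ac)
    qed (simp add: G_def norm_mult)
  qed
  also have "\<dots> = ennreal (2 * pi * Q) * (\<integral>\<^sup>+z\<in>ball 0 1. ennreal (R z) \<partial>lborel)"
    by (rule nn_integral_cmult) simp
  also have "\<dots> \<le> ennreal (2 * pi * Q) * ennreal (C\<^sub>0 * s * \<omega> (1 - s))"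
    unfolding R_def by (intro mult_left_mono radial_integral_le s M) auto
  also have "\<dots> = ennreal (2 * pi) * ennreal (Q * (C\<^sub>0 * s * \<omega> (1 - s)))"
    using Q s C0_pos weight_nonneg[of "1 - s"] by (simp add: ennreal_mult[symmetric] mult_ac)
  finally have GQ: "(\<integral>\<^sup>+z. G z \<partial>lborel) \<le> ennreal (Q * (C\<^sub>0 * s * \<omega> (1 - s)))"
    by (subst (asm) ennreal_mult_le_mult_iff) auto
  have "(\<integral>\<^sup>+z\<in>ball 0 1. ennreal (bkernel a (\<phi> z) powr (M + 2) * V z * \<omega> (norm z)) \<partial>lborel)
     \<le> (\<integral>\<^sup>+z. ennreal (2 * s * (2 / c) powr M) * G z \<partial>lborel)"
  proof (rule nn_integral_mono)
    fix z :: complex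
    show "ennreal (bkernel a (\<phi> z) powr (M + 2) * V z * \<omega> (norm z)) * indicator (ball 0 1) z \<le> ennreal (2 * s * (2 / c) powr M) * G z"
      using pt[of z] s P0[of z] R0[of z] by (auto simp: G_def indicator_def ennreal_mult[symmetric] intro!: ennreal_leI)
  qed
  also have "\<dots> = ennreal (2 * s * (2 / c) powr M) * (\<integral>\<^sup>+z. G z \<partial>lborel)"
    by (rule nn_integral_cmult) simp
  also have "\<dots> \<le> ennreal (2 * s * (2 / c) powr M) * ennreal (Q * (C\<^sub>0 * s * \<omega> (1 - s)))"
    by (intro mult_left_mono GQ) auto
  also have "\<dots> = ennreal (2 * (2 / c) powr M * C\<^sub>0 * Q * (s\<^sup>2 * \<omega> (1 - s)))"
    using s Q C0_pos weight_nonneg[of "1 - s"] by (simp add: ennreal_mult[symmetric] mult_ac power2_eq_square)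
  finally show ?thesis by (simp add: s_def)
qed

text \<open>A Schur type argument: the kernel majorant of |f|^p is inserted at \<phi> z and the
  integrals are exchanged. The integral over z returns (1 - |a|)^2 times the weight at a, which
  cancels the singular factor of the majorant and leaves the norm of f.\<close>

lemma composition_integral_le:
  fixes \<phi> :: "complex \<Rightarrow> complex" and V :: "complex \<Rightarrow> real"
  assumes p: "1 < p" and f: "f holomorphic_on ball 0 1"
    and \<phi>: "continuous_on (ball 0 1) \<phi>" "\<phi> ` ball 0 1 \<subseteq> ball 0 1"
    and c: "0 < c" "c \<le> 1" "\<And>z. norm z < 1 \<Longrightarrow> c * (1 - norm z) \<le> 1 - norm (\<phi> z)"
    and V: "continuous_on (ball 0 1) V" "\<And>z. norm z < 1 \<Longrightarrow> 0 \<le> V z"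
    and Q: "0 \<le> Q"
    and mean: "\<And>a z. norm a < 1 \<Longrightarrow> norm z < 1 \<Longrightarrow>
       (\<integral>\<^sup>+t\<in>{0..2*pi}. ennreal (Re (cayley a (\<phi> (cis t * z))) * V (cis t * z)) \<partial>lborel) \<le> ennreal (2 * pi * Q)"
  shows "(\<integral>\<^sup>+z\<in>ball 0 1. ennreal (norm (f (\<phi> z)) powr p * V z * \<omega> (norm z)) \<partial>lborel)
     \<le> ennreal (18 * 5 powr (K + 4) / pi * (2 / c) powr (K + 2) * C\<^sub>0 * Q) * wnorm p \<omega> f"
proof -
  \<comment> \<open>The least exponent that \<open>kernel_integral_le\<close> admits: M = K + 2,
    plus the two powers spent on the harmonic function.\<close>
  define \<gamma> where "\<gamma> = K + 2 + 2"
  have \<gamma>: "0 \<le> \<gamma>" using K by (simp add: \<gamma>_def)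
  define B where "B = 2 * (2 / c) powr (K + 2) * C\<^sub>0 * Q"
  have B0: "0 \<le> B" using Q C0_pos by (simp add: B_def)
  have \<phi>1: "norm (\<phi> z) < 1" if "norm z < 1" for z using \<phi>(2) that by (simp add: image_subset_iff)
  define D where "D = ball (0::complex) 1"
  have cf: "continuous_on D (\<lambda>a. norm (f a) powr p)"
    unfolding D_def using p by (intro continuous_on_norm_powr holomorphic_on_imp_continuous_on[OF f]) auto
  define H :: "complex \<Rightarrow> complex \<Rightarrow> real" where
    "H = (\<lambda>z a. (norm (f a) powr p * bkernel a (\<phi> z) powr \<gamma> / (1 - norm a)\<^sup>2) * (V z * \<omega> (norm z)))"
  \<comment> \<open>Cut off to the bidisk, where joint continuity supplies the measurability needed
    for exchanging the integrals.\<close>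
  define J where "J = (\<lambda>q. ennreal (H (fst q) (snd q)) * indicator (D \<times> D) q)"
  have "continuous_on (D \<times> D) (\<lambda>q. H (fst q) (snd q))"
    unfolding H_def
  proof (intro continuous_on_mult continuous_on_divide)
    show "continuous_on (D \<times> D) (\<lambda>x. cmod (f (snd x)) powr p)"
      by (rule continuous_on_compose2[OF cf continuous_on_snd[OF continuous_on_id]]) auto
    show "continuous_on (D \<times> D) (\<lambda>x. bkernel (snd x) (\<phi> (fst x)) powr \<gamma>)"
    proof (intro continuous_on_powr continuous_on_bkernel continuous_on_snd continuous_on_id continuous_on_const)
      show "continuous_on (D \<times> D) (\<lambda>x. \<phi> (fst x))"
        by (rule continuous_on_compose2[OF \<phi>(1) continuous_on_fst[OF continuous_on_id]]) (auto simp: D_def)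
      show "\<forall>x\<in>D \<times> D. bkernel (snd x) (\<phi> (fst x)) \<noteq> 0"
        using one_minus_cnj_mult_nonzero \<phi>1 by (auto simp: bkernel_def abs_square_eq_1 D_def)
    qed (use \<phi>1 in \<open>auto simp: D_def\<close>)
    show "continuous_on (D \<times> D) (\<lambda>x. V (fst x))"
      by (rule continuous_on_compose2[OF V(1) continuous_on_fst[OF continuous_on_id]]) (auto simp: D_def)
    show "continuous_on (D \<times> D) (\<lambda>x. \<omega> (norm (fst x)))"
      by (rule continuous_on_compose2[OF continuous_on_weight continuous_on_fst[OF continuous_on_id]]) (auto simp: D_def)
  qed (auto intro!: continuous_intros simp: D_def)
  then have "J \<in> borel_measurable borel"
    unfolding J_def by (intro ennreal_continuous_indicator_measurable) (auto simp: D_def borel_Times)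
  then have [measurable]: "J \<in> borel_measurable (borel \<Otimes>\<^sub>M borel)" by (simp add: borel_prod)
  have Vw0: "0 \<le> V z * \<omega> (norm z)" if "norm z < 1" for z
    using V(2) weight_nonneg that by simp
  have mk: "(\<lambda>a. ennreal (norm (f a) powr p * bkernel a w powr \<gamma> / (1 - norm a)\<^sup>2) * indicator (ball 0 1) a) \<in> borel_measurable borel" if "norm w < 1" for w
  proof -
    have cw: "continuous_on (ball 0 1) (\<lambda>a. bkernel a w powr \<gamma>)"
    proof (intro continuous_on_powr continuous_on_bkernel continuous_on_id continuous_on_const)
      show "\<forall>a\<in>ball 0 1. bkernel a w \<noteq> 0"
        using one_minus_cnj_mult_nonzero that by (auto simp: bkernel_def abs_square_eq_1)
    qed (use that in auto)
    then show ?thesis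
      by (intro ennreal_continuous_indicator_measurable continuous_on_divide continuous_on_mult cf[unfolded D_def] cw
            continuous_on_power continuous_on_diff continuous_on_norm continuous_on_id continuous_on_const) auto
  qed
  have "(\<integral>\<^sup>+z\<in>ball 0 1. ennreal (norm (f (\<phi> z)) powr p * V z * \<omega> (norm z)) \<partial>lborel)
     \<le> (\<integral>\<^sup>+z. ennreal (9 * 5 powr \<gamma> / pi) * (\<integral>\<^sup>+a. J (z, a) \<partial>lborel) \<partial>lborel)"
  proof (rule nn_integral_mono)
    fix z :: complex
    show "ennreal (norm (f (\<phi> z)) powr p * V z * \<omega> (norm z)) * indicator (ball 0 1) z \<le> ennreal (9 * 5 powr \<gamma> / pi) * (\<integral>\<^sup>+a. J (z, a) \<partial>lborel)"
    proof (cases "norm z < 1")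
      case True
      have "ennreal (norm (f (\<phi> z)) powr p) * ennreal (V z * \<omega> (norm z)) \<le> ennreal (9 * 5 powr \<gamma> / pi) *
          (\<integral>\<^sup>+a\<in>ball 0 1. ennreal (norm (f a) powr p * bkernel a (\<phi> z) powr \<gamma> / (1 - norm a)\<^sup>2) \<partial>lborel) * ennreal (V z * \<omega> (norm z))"
        by (intro mult_right_mono pointwise_le_bkernel_integral[OF f p \<phi>1[OF True] \<gamma>]) auto
      also have "\<dots> = ennreal (9 * 5 powr \<gamma> / pi) * (\<integral>\<^sup>+a. ennreal (norm (f a) powr p * bkernel a (\<phi> z) powr \<gamma> / (1 - norm a)\<^sup>2) * indicator (ball 0 1) a * ennreal (V z * \<omega> (norm z)) \<partial>lborel)"
        by (subst nn_integral_multc) (use mk[OF \<phi>1[OF True]] in \<open>auto simp: mult.assoc\<close>)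
      also have "(\<lambda>a. ennreal (norm (f a) powr p * bkernel a (\<phi> z) powr \<gamma> / (1 - norm a)\<^sup>2) * indicator (ball 0 1) a * ennreal (V z * \<omega> (norm z)))
         = (\<lambda>a. J (z, a))"
      proof (rule ext)
        fix a
        let ?X = "norm (f a) powr p * bkernel a (\<phi> z) powr \<gamma> / (1 - norm a)\<^sup>2"
        have e: "ennreal ?X * ennreal (V z * \<omega> (norm z)) = ennreal (?X * (V z * \<omega> (norm z)))"
          by (rule ennreal_mult''[symmetric, OF Vw0[OF True]])
        show "ennreal ?X * indicator (ball 0 1) a * ennreal (V z * \<omega> (norm z)) = J (z, a)"
        proof (cases "norm a < 1")
          case a: True
          then have "ennreal ?X * indicator (ball 0 1) a * ennreal (V z * \<omega> (norm z)) = ennreal ?X * ennreal (V z * \<omega> (norm z))"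
            by simp
          also note e
          also have "ennreal (?X * (V z * \<omega> (norm z))) = J (z, a)"
            using a True by (simp add: J_def H_def D_def)
          finally show ?thesis .
        qed (simp add: J_def D_def)
      qed
      finally show ?thesis using True Vw0[OF True] by (simp add: ennreal_mult[symmetric] mult_ac)
    qed simp
  qed
  also have "\<dots> = ennreal (9 * 5 powr \<gamma> / pi) * (\<integral>\<^sup>+z. (\<integral>\<^sup>+a. J (z, a) \<partial>lborel) \<partial>lborel)"
    by (rule nn_integral_cmult) simp
  also have "(\<integral>\<^sup>+z. (\<integral>\<^sup>+a. J (z, a) \<partial>lborel) \<partial>lborel) = (\<integral>\<^sup>+a. (\<integral>\<^sup>+z. J (z, a) \<partial>lborel) \<partial>lborel)"
    by (rule lborel_pair.Fubini') (simp add: case_prod_eta)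
  also have "\<dots> \<le> (\<integral>\<^sup>+a. ennreal B * (ennreal (norm (f a) powr p * \<omega> (norm a)) * indicator (ball 0 1) a) \<partial>lborel)"
  proof (rule nn_integral_mono)
    fix a :: complex
    show "(\<integral>\<^sup>+z. J (z, a) \<partial>lborel) \<le> ennreal B * (ennreal (norm (f a) powr p * \<omega> (norm a)) * indicator (ball 0 1) a)"
    proof (cases "norm a < 1")
      case True
      \<comment> \<open>The factors independent of z; the denominator is cancelled by the bound for
        the integral over z.\<close>
      define d where "d = norm (f a) powr p / (1 - norm a)\<^sup>2"
      have d0: "0 \<le> d" by (simp add: d_def)
      have ck: "continuous_on (ball 0 1) (\<lambda>z. bkernel a (\<phi> z) powr \<gamma>)"
      proof (intro continuous_on_powr continuous_on_bkernel \<phi> continuous_on_const)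
        show "\<forall>z\<in>ball 0 1. bkernel a (\<phi> z) \<noteq> 0"
          using one_minus_cnj_mult_nonzero[OF True] \<phi>1 True by (auto simp: bkernel_def abs_square_eq_1)
      qed (use True \<phi>1 in auto)
      have km: "(\<lambda>z. ennreal (bkernel a (\<phi> z) powr \<gamma> * V z * \<omega> (norm z)) * indicator (ball 0 1) z) \<in> borel_measurable borel"
        by (intro ennreal_continuous_indicator_measurable continuous_on_mult ck V continuous_on_weight) auto
      have "(\<integral>\<^sup>+z. J (z, a) \<partial>lborel) = (\<integral>\<^sup>+z. ennreal d * (ennreal (bkernel a (\<phi> z) powr \<gamma> * V z * \<omega> (norm z)) * indicator (ball 0 1) z) \<partial>lborel)"
      proof (rule nn_integral_cong)
        fix z :: complex
        show "J (z, a) = ennreal d * (ennreal (bkernel a (\<phi> z) powr \<gamma> * V z * \<omega> (norm z)) * indicator (ball 0 1) z)"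
        proof (cases "norm z < 1")
          case z: True
          have "J (z, a) = ennreal (d * (bkernel a (\<phi> z) powr \<gamma> * V z * \<omega> (norm z)))"
            using True z by (simp add: J_def H_def D_def d_def mult_ac)
          then show ?thesis using z by (simp add: ennreal_mult'[OF d0])
        qed (simp add: J_def D_def)
      qed
      also have "\<dots> = ennreal d * (\<integral>\<^sup>+z\<in>ball 0 1. ennreal (bkernel a (\<phi> z) powr \<gamma> * V z * \<omega> (norm z)) \<partial>lborel)"
        by (rule nn_integral_cmult) (use km in simp)
      also have "\<dots> \<le> ennreal d * ennreal (B * ((1 - norm a)\<^sup>2 * \<omega> (norm a)))"
        unfolding \<gamma>_def B_def
        by (intro mult_left_mono kernel_integral_le \<phi> c V Q True mean) auto
      also have "\<dots> = ennreal (B * (norm (f a) powr p * \<omega> (norm a)))"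
        using True d0 B0 weight_nonneg[of "norm a"] by (simp add: ennreal_mult[symmetric] d_def)
      finally show ?thesis using True B0 by (simp add: ennreal_mult')
    qed (simp add: J_def D_def)
  qed
  also have "\<dots> = ennreal B * wnorm p \<omega> f"
    unfolding wnorm_def using wnorm_measurable[OF f, of p] p by (intro nn_integral_cmult) simp
  also have "ennreal (9 * 5 powr \<gamma> / pi) * (ennreal B * wnorm p \<omega> f) = ennreal (18 * 5 powr (K + 4) / pi * (2 / c) powr (K + 2) * C\<^sub>0 * Q) * wnorm p \<omega> f"
    using B0 by (simp add: mult.assoc[symmetric] ennreal_mult[symmetric] B_def \<gamma>_def add.assoc)
  finally show ?thesis by (simp add: mult_left_mono)
qed

end

section \<open>Schwarz--Pick and peak functions\<close>

lemma one_minus_norm_Moebius_sq: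
  assumes w: "norm w < 1" and z: "norm z < 1"
  shows "1 - (norm (Moebius_function 0 w z))\<^sup>2 = (1 - (norm w)\<^sup>2) * (1 - (norm z)\<^sup>2) / (norm (1 - cnj w * z))\<^sup>2"
proof -
  have nz: "(norm (1 - cnj w * z))\<^sup>2 \<noteq> 0" using one_minus_cnj_mult_nonzero[OF w z] by simp
  have "(norm (1 - cnj w * z))\<^sup>2 - (norm (z - w))\<^sup>2 = (1 - (norm w)\<^sup>2) * (1 - (norm z)\<^sup>2)"
    by (simp add: cmod_power2) (simp add: algebra_simps power2_eq_square)
  then show ?thesis
    using nz by (simp add: Moebius_function_simple norm_divide power_divide field_simps)
qed

text \<open>The Schwarz lemma for \<phi> placed between Moebius maps that carry 0 to z0 and \<phi>
  z0 to 0. The denominator at \<phi> z is at least \<delta>, because \<phi> z0 has distance at least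
  \<delta> from the circle. The case z0 = 0 gives the general boundary estimate; z0 near the circle
  serves the peaks.\<close>

lemma Schwarz_Pick_lower_bound:
  assumes hol: "\<phi> holomorphic_on ball 0 1" and self: "\<And>z. norm z < 1 \<Longrightarrow> norm (\<phi> z) < 1"
    and z0: "norm z0 < 1" and z: "norm z < 1" and \<delta>: "0 < \<delta>" "norm (\<phi> z0) \<le> 1 - \<delta>"
  shows "\<delta>\<^sup>2 / 2 * ((1 - (norm z0)\<^sup>2) * (1 - (norm z)\<^sup>2) / (norm (1 - cnj z0 * z))\<^sup>2) \<le> 1 - norm (\<phi> z)"
proof -
  define g where "g = Moebius_function 0 (\<phi> z0) \<circ> (\<phi> \<circ> Moebius_function 0 (- z0))"
  define \<xi> where "\<xi> = Moebius_function 0 z0 z"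
  have M: "norm (Moebius_function 0 (- z0) w) < 1" if "norm w < 1" for w
    using Moebius_function_norm_lt_1[of "- z0" w 0] that z0 by simp
  have \<xi>1: "norm \<xi> < 1" unfolding \<xi>_def by (rule Moebius_function_norm_lt_1[OF z0 z])
  have gh: "g holomorphic_on ball 0 1"
    unfolding g_def
  proof (intro holomorphic_on_compose_gen[where t = "ball 0 1"])
    show "Moebius_function 0 (- z0) holomorphic_on ball 0 1" using z0 by (intro Moebius_function_holomorphic) simp
    show "Moebius_function 0 (\<phi> z0) holomorphic_on ball 0 1" using self[OF z0] by (rule Moebius_function_holomorphic)
  qed (use hol self M in \<open>auto simp: image_subset_iff\<close>)
  have g0: "g 0 = 0" by (simp add: g_def Moebius_function_of_zero Moebius_function_eq_zero)
  have "norm (g \<xi>) \<le> norm \<xi>"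
    by (rule Schwarz_Lemma(1)[OF gh g0 _ \<xi>1]) (auto simp: g_def intro!: Moebius_function_norm_lt_1 self z0 M)
  moreover have "g \<xi> = Moebius_function 0 (\<phi> z0) (\<phi> z)"
    using Moebius_function_compose[of "- z0" z0 z] z0 z by (simp add: g_def \<xi>_def)
  ultimately have "(norm (Moebius_function 0 (\<phi> z0) (\<phi> z)))\<^sup>2 \<le> (norm \<xi>)\<^sup>2" by (simp add: power_mono)
  then have "(1 - (norm z0)\<^sup>2) * (1 - (norm z)\<^sup>2) / (norm (1 - cnj z0 * z))\<^sup>2
     \<le> (1 - (norm (\<phi> z0))\<^sup>2) * (1 - (norm (\<phi> z))\<^sup>2) / (norm (1 - cnj (\<phi> z0) * \<phi> z))\<^sup>2"
    using one_minus_norm_Moebius_sq[OF z0 z] one_minus_norm_Moebius_sq[OF self[OF z0] self[OF z]] unfolding \<xi>_def by linarith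
  also have "\<dots> \<le> 1 * (2 * (1 - norm (\<phi> z))) / \<delta>\<^sup>2"
  proof (intro frac_le mult_mono power_mono)
    have "1 - (norm (\<phi> z))\<^sup>2 = (1 + norm (\<phi> z)) * (1 - norm (\<phi> z))" by (simp add: power2_eq_square algebra_simps)
    also have "\<dots> \<le> 2 * (1 - norm (\<phi> z))" using self[OF z] by (intro mult_right_mono) auto
    finally show "1 - (norm (\<phi> z))\<^sup>2 \<le> 2 * (1 - norm (\<phi> z))" .
    show "\<delta> \<le> norm (1 - cnj (\<phi> z0) * \<phi> z)"
      using norm_one_minus_cnj_mult_ge(2)[OF self[OF z0] self[OF z]] \<delta> by simp
  qed (use \<delta> self[OF z] self[OF z0] in \<open>auto simp: power_le_one\<close>)
  finally show ?thesis using \<delta> by (simp add: field_simps)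
qed

lemma self_map_boundary_distance:
  assumes hol: "\<phi> holomorphic_on ball 0 1" and self: "\<And>z. norm z < 1 \<Longrightarrow> norm (\<phi> z) < 1"
  obtains c where "0 < c" "c \<le> 1" "\<And>z. norm z < 1 \<Longrightarrow> c * (1 - norm z) \<le> 1 - norm (\<phi> z)"
proof
  define \<delta> where "\<delta> = 1 - norm (\<phi> 0)"
  have \<delta>: "0 < \<delta>" "\<delta> \<le> 1" using self[of 0] by (auto simp: \<delta>_def)
  show "0 < \<delta>\<^sup>2 / 2" "\<delta>\<^sup>2 / 2 \<le> 1" using \<delta> power_le_one[of \<delta> 2] by auto
  fix z :: complex assume z: "norm z < 1"
  have "(norm z)\<^sup>2 \<le> norm z" using z by (simp add: power2_eq_square mult_left_le)
  then have "\<delta>\<^sup>2 / 2 * (1 - norm z) \<le> \<delta>\<^sup>2 / 2 * (1 - (norm z)\<^sup>2)" by (intro mult_left_mono) auto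
  also have "\<dots> \<le> 1 - norm (\<phi> z)"
    using Schwarz_Pick_lower_bound[OF hol self _ z \<delta>(1), of 0] by (simp add: \<delta>_def)
  finally show "\<delta>\<^sup>2 / 2 * (1 - norm z) \<le> 1 - norm (\<phi> z)" .
qed

text \<open>For |z| < 1 the function y -> cayley a (\<phi> (y * z)) is analytic in a neighbourhood
  of the closed unit disk, so Poisson's formula applies. The choice b = 0 yields plain circle means;
  other b handle densities dominated by a Poisson kernel.\<close>

lemma cayley_Poisson_mean:
  assumes hol: "\<phi> holomorphic_on ball 0 1" and self: "\<And>z. norm z < 1 \<Longrightarrow> norm (\<phi> z) < 1"
    and a: "norm a < 1" and z: "norm z < 1" and b: "norm b < 1"
  shows "(\<integral>\<^sup>+t\<in>{0..2*pi}. ennreal (Re (cayley a (\<phi> (cis t * z))) * ((1 - (norm b)\<^sup>2) / (norm (1 - cnj b * cis t))\<^sup>2)) \<partial>lborel)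
     = ennreal (2 * pi * Re (cayley a (\<phi> (b * z))))"
proof -
  have yz: "norm (y * z) < 1" if "norm y \<le> 1" for y
    using z that by (smt (verit) mult_left_le_one_le norm_ge_zero norm_mult)
  have h: "(\<lambda>w. cayley a (\<phi> w)) holomorphic_on ball 0 1"
    unfolding cayley_def using one_minus_cnj_mult_nonzero[OF a] self
    by (intro holomorphic_intros hol) auto
  have "(\<lambda>y. cayley a (\<phi> (y * z))) holomorphic_on ball 0 1"
    by (rule holomorphic_on_compose_gen[of "\<lambda>y. y * z" _ "\<lambda>w. cayley a (\<phi> w)" "ball 0 1", unfolded o_def])
       (auto intro!: holomorphic_intros h yz simp del: norm_mult)
  moreover have "continuous_on (cball 0 1) (\<lambda>y. cayley a (\<phi> (y * z)))"
    by (rule continuous_on_compose2[OF holomorphic_on_imp_continuous_on[OF h]])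
       (auto intro!: continuous_intros yz simp del: norm_mult)
  ultimately show ?thesis
    by (intro nn_integral_Poisson_circle b Re_cayley_nonneg a self yz) auto
qed

lemma cayley_mean_le:
  assumes hol: "\<phi> holomorphic_on ball 0 1" and self: "\<And>z. norm z < 1 \<Longrightarrow> norm (\<phi> z) < 1"
    and a: "norm a < 1" and z: "norm z < 1"
  shows "(\<integral>\<^sup>+t\<in>{0..2*pi}. ennreal (Re (cayley a (\<phi> (cis t * z)))) \<partial>lborel) \<le> ennreal (2 * pi * (2 / (1 - norm (\<phi> 0))))"
proof -
  have "2 * pi * Re (cayley a (\<phi> 0)) \<le> 2 * pi * (2 / (1 - norm (\<phi> 0)))"
    by (intro mult_left_mono Re_cayley_le a self) auto
  then show ?thesis
    using cayley_Poisson_mean[OF hol self a z, of 0] by (simp del: times_divide_eq_right add: ennreal_leI)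
qed

text \<open>
  The exponent makes \<^term>\<open>peak p z0 z0\<close> tend to infinity as \<^term>\<open>z0\<close> approaches the circle, while the
  bound of \<open>peak_mean_le\<close> below tends to 0.
\<close>

definition peak :: "real \<Rightarrow> complex \<Rightarrow> complex \<Rightarrow> complex" where
  "peak p z0 z = of_real ((1 - (norm z0)\<^sup>2) powr (- 1 / (2 * p))) * ((1 - of_real ((norm z0)\<^sup>2)) / (1 - cnj z0 * z)) ^ 2"

lemma norm_peak:
  assumes "norm z0 < 1"
  shows "norm (peak p z0 z) = (1 - (norm z0)\<^sup>2) powr (- 1 / (2 * p)) * (bkernel z0 z)\<^sup>2"
proof -
  have "norm (1 - complex_of_real ((norm z0)\<^sup>2)) = 1 - (norm z0)\<^sup>2"
    using assms by (metis abs_of_nonneg diff_ge_0_iff_ge less_imp_le norm_ge_zero norm_of_real of_real_1 of_real_diff power_le_one)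
  then show ?thesis
    by (simp add: peak_def norm_mult norm_power norm_divide bkernel_def)
qed

lemma holomorphic_on_peak: "norm z0 < 1 \<Longrightarrow> peak p z0 holomorphic_on ball 0 1"
  unfolding peak_def using one_minus_cnj_mult_nonzero[of z0] by (intro holomorphic_intros) auto

text \<open>On each circle the p-th power of the peak is dominated by a multiple of a Poisson
  kernel: one square of the kernel has exactly that shape, and the other powers are bounded.
  Poisson's formula then evaluates the harmonic function at z0 * |z|^2, where Schwarz-Pick controls
  the distance of \<phi> from the circle.\<close>

lemma peak_mean_le:
  assumes hol: "\<phi> holomorphic_on ball 0 1" and self: "\<And>z. norm z < 1 \<Longrightarrow> norm (\<phi> z) < 1"
    and a: "norm a < 1" and z: "norm z < 1" and z0: "norm z0 < 1"
    and \<delta>: "0 < \<delta>" "norm (\<phi> z0) \<le> 1 - \<delta>" and p: "1 < p"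
  shows "(\<integral>\<^sup>+t\<in>{0..2*pi}. ennreal (Re (cayley a (\<phi> (cis t * z))) * norm (peak p z0 (cis t * z)) powr p) \<partial>lborel)
    \<le> ennreal (2 * pi * (4 powr p / \<delta>\<^sup>2 * (1 - (norm z0)\<^sup>2) powr (1/2)))"
proof -
  define y where "y = 1 - (norm z0)\<^sup>2"
  have y: "0 < y" using z0 by (simp add: y_def abs_square_less_1)
  \<comment> \<open>Chosen so that cnj b * cis t = cnj z0 * (cis t * z); moreover b * z = |z|^2 * z0
    lies on the radius through z0.\<close>
  define b where "b = z0 * cnj z"
  have nb: "norm b = norm z0 * norm z" by (simp add: b_def norm_mult)
  have b: "norm b < 1" using norm_mult_less[of z0 1 "cnj z" 1] z z0 by (simp add: b_def)
  define d where "d = 1 - (norm b)\<^sup>2"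
  have d: "0 < d" using b by (simp add: d_def abs_square_less_1)
  \<comment> \<open>Collects \<open>y powr (- 1 / 2)\<close> from the peak, \<open>y\<^sup>2\<close>
    from the square of the kernel, the bound for its other powers, and 1 / d to normalise the
    Poisson kernel.\<close>
  define k where "k = y powr (3/2) * 4 powr (p - 1) / d"
  have k: "0 \<le> k" using d by (simp add: k_def)
  have cz: "norm (cis t * z) < 1" for t using z by (simp add: norm_mult)
  have pt: "Re (cayley a (\<phi> (cis t * z))) * norm (peak p z0 (cis t * z)) powr p
    \<le> k * (Re (cayley a (\<phi> (cis t * z))) * (d / (norm (1 - cnj b * cis t))\<^sup>2))" for t
  proof -
    define q where "q = bkernel z0 (cis t * z)"
    have q0: "0 \<le> q" unfolding q_def by (rule bkernel_nonneg[OF z0])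
    have q2: "q \<le> 2" unfolding q_def by (rule bkernel_bounds(1)[OF z0 cz])
    have e: "q\<^sup>2 = y\<^sup>2 / (norm (1 - cnj b * cis t))\<^sup>2"
      by (simp add: q_def bkernel_def power_divide y_def b_def mult_ac)
    have "norm (peak p z0 (cis t * z)) powr p = y powr (- 1 / 2) * (q\<^sup>2) powr p"
      using y p by (simp add: norm_peak[OF z0] powr_mult powr_powr y_def[symmetric] q_def[symmetric])
    also have "(q\<^sup>2) powr p = (q\<^sup>2) powr (p - 1) * q\<^sup>2"
      using p powr_mult_base[of "q\<^sup>2" "p - 1"] by (simp add: mult.commute)
    also have "\<dots> \<le> 4 powr (p - 1) * q\<^sup>2"
      using q0 q2 p power_mono[of q 2 2] by (intro mult_right_mono powr_mono2) auto
    also have "y powr (- 1 / 2) * (4 powr (p - 1) * q\<^sup>2) = k * (d / (norm (1 - cnj b * cis t))\<^sup>2)"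
    proof -
      have "y powr (- 1 / 2) * y\<^sup>2 = y powr (3/2)"
        using y powr_add[of y "- 1 / 2" 2] by simp
      then show ?thesis using d by (simp add: e k_def)
    qed
    finally have "norm (peak p z0 (cis t * z)) powr p \<le> k * (d / (norm (1 - cnj b * cis t))\<^sup>2)"
      using y by (simp add: mult_left_mono)
    then have "Re (cayley a (\<phi> (cis t * z))) * norm (peak p z0 (cis t * z)) powr p
      \<le> Re (cayley a (\<phi> (cis t * z))) * (k * (d / (norm (1 - cnj b * cis t))\<^sup>2))"
      by (intro mult_left_mono Re_cayley_nonneg a self cz)
    then show ?thesis by (simp add: mult_ac)
  qed
  have r0: "0 \<le> Re (cayley a (\<phi> (cis t * z)))" for t by (intro Re_cayley_nonneg a self cz)
  have bz: "norm (b * z) < 1" using norm_mult_less[of b 1 z 1] b z by simp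
  have cc: "cnj w * w = of_real ((norm w)\<^sup>2)" for w
    by (metis complex_norm_square mult.commute of_real_power)
  have "cnj z0 * (b * z) = (cnj z0 * z0) * (cnj z * z)"
    by (simp add: b_def mult_ac)
  also have "\<dots> = of_real ((norm b)\<^sup>2)"
    unfolding cc nb power_mult_distrib by simp
  finally have "cnj z0 * (b * z) = of_real ((norm b)\<^sup>2)" .
  then have nd: "norm (1 - cnj z0 * (b * z)) = d"
    using d by (metis abs_of_pos d_def norm_of_real of_real_1 of_real_diff)
  have "d \<le> 1 - (norm (b * z))\<^sup>2"
    using z by (simp add: d_def norm_mult power_mult_distrib mult_left_le power_le_one)
  then have "\<delta>\<^sup>2 / 2 * (y * d / d\<^sup>2) \<le> \<delta>\<^sup>2 / 2 * (y * (1 - (norm (b * z))\<^sup>2) / d\<^sup>2)"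
    using y by (intro mult_left_mono divide_right_mono) auto
  also have "\<dots> \<le> 1 - norm (\<phi> (b * z))"
    using Schwarz_Pick_lower_bound[OF hol self z0 bz \<delta>] by (simp add: nd y_def)
  \<comment> \<open>The reciprocal of this bound is of order d / y. Its d cancels the 1 / d in
    \<open>k\<close>, so the final estimate is uniform in z.\<close>
  finally have low: "\<delta>\<^sup>2 / 2 * (y / d) \<le> 1 - norm (\<phi> (b * z))" using d by (simp add: power2_eq_square)
  have "Re (cayley a (\<phi> (b * z))) \<le> 2 / (1 - norm (\<phi> (b * z)))"
    by (rule Re_cayley_le[OF a self[OF bz]])
  also have "\<dots> \<le> 2 / (\<delta>\<^sup>2 / 2 * (y / d))"
    using low y d \<delta> self[OF bz] by (intro divide_left_mono mult_pos_pos) auto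
  finally have up: "Re (cayley a (\<phi> (b * z))) \<le> 4 * d / (\<delta>\<^sup>2 * y)" by simp
  have "(\<integral>\<^sup>+t\<in>{0..2*pi}. ennreal (Re (cayley a (\<phi> (cis t * z))) * norm (peak p z0 (cis t * z)) powr p) \<partial>lborel)
    \<le> (\<integral>\<^sup>+t. ennreal k * (ennreal (Re (cayley a (\<phi> (cis t * z))) * (d / (norm (1 - cnj b * cis t))\<^sup>2)) * indicator {0..2*pi} t) \<partial>lborel)"
    using pt k r0 by (intro nn_integral_mono) (auto simp: indicator_def ennreal_mult'[symmetric] intro!: ennreal_leI)
  also have "\<dots> = ennreal k * (\<integral>\<^sup>+t\<in>{0..2*pi}. ennreal (Re (cayley a (\<phi> (cis t * z))) * (d / (norm (1 - cnj b * cis t))\<^sup>2)) \<partial>lborel)"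
  proof (rule nn_integral_cmult)
    have nz: "1 - cnj b * cis t \<noteq> 0" for t
    proof
      assume "1 - cnj b * cis t = 0"
      then have "norm (cnj b * cis t) = 1" by (metis eq_iff_diff_eq_0 norm_one)
      then show False using b by (simp add: norm_mult)
    qed
    have "continuous_on UNIV (\<lambda>t. Re (cayley a (\<phi> (cis t * z))) * (d / (norm (1 - cnj b * cis t))\<^sup>2))"
      unfolding cayley_def using one_minus_cnj_mult_nonzero[OF a self[OF cz]] nz
      by (intro continuous_intros continuous_on_compose2[OF holomorphic_on_imp_continuous_on[OF hol]])
         (auto simp: norm_mult z)
    then have "(\<lambda>t. Re (cayley a (\<phi> (cis t * z))) * (d / (norm (1 - cnj b * cis t))\<^sup>2)) \<in> borel_measurable borel"
      by (rule borel_measurable_continuous_onI)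
    then show "(\<lambda>t. ennreal (Re (cayley a (\<phi> (cis t * z))) * (d / (norm (1 - cnj b * cis t))\<^sup>2)) * indicator {0..2*pi} t) \<in> borel_measurable lborel"
      by measurable
  qed
  also have "\<dots> = ennreal k * ennreal (2 * pi * Re (cayley a (\<phi> (b * z))))"
    unfolding d_def by (subst cayley_Poisson_mean[OF hol self a z b]) simp_all
  also have "\<dots> \<le> ennreal k * ennreal (2 * pi * (4 * d / (\<delta>\<^sup>2 * y)))"
    by (intro mult_left_mono ennreal_leI up) auto
  also have "\<dots> = ennreal (k * (2 * pi * (4 * d / (\<delta>\<^sup>2 * y))))"
    by (rule ennreal_mult'[OF k, symmetric])
  also have "k * (2 * pi * (4 * d / (\<delta>\<^sup>2 * y))) = 2 * pi * (4 powr p / \<delta>\<^sup>2 * y powr (1/2))"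
  proof -
    have "4 powr p = 4 * 4 powr (p - 1)" using powr_mult_base[of 4 "p - 1"] by simp
    moreover have "y powr (3/2) = y * y powr (1/2)" using powr_mult_base[of y "1/2"] y by simp
    ultimately show ?thesis using d y by (simp add: k_def)
  qed
  finally show ?thesis by (simp add: y_def)
qed

section \<open>Gliding hump\<close>

text \<open>Here n numbers functions and m test points. Each index is chosen so far out that its
  function is small at the earlier test points and its diagonal value exceeds k + 1 plus the bounds
  of all earlier functions. At a chosen test point the later terms add up to at most 1, so the
  diagonal survives by at least k.\<close>

lemma gliding_hump:
  fixes E :: "nat \<Rightarrow> nat \<Rightarrow> complex" and b \<beta> :: "nat \<Rightarrow> real"
  assumes col: "\<And>m. (\<lambda>n. E n m) \<longlonglongrightarrow> 0" and row: "\<And>n. \<exists>B. \<forall>m. norm (E n m) \<le> B"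
    and diag: "filterlim (\<lambda>n. norm (E n n)) at_top sequentially"
    and b: "b \<longlonglongrightarrow> 0" and \<beta>: "\<And>k. 0 < \<beta> k"
  shows "\<exists>r. (\<forall>k. b (r k) \<le> \<beta> k) \<and>
    (\<forall>k S. (\<lambda>j. E (r j) (r k)) sums S \<longrightarrow> real k \<le> norm S)"
proof -
  obtain B where B: "\<And>n m. norm (E n m) \<le> B n" using row by metis
  \<comment> \<open>The choice depends on the list L of indices chosen so far; its length is the
    number of the current step.\<close>
  have ex: "\<exists>n. b n \<le> \<beta> (length L) \<and> (\<forall>m\<in>set L. norm (E n m) \<le> (1/2) ^ Suc (length L)) \<and>
      real (length L) + 1 + sum_list (map B L) \<le> norm (E n n)" for L
  proof -
    have "\<forall>\<^sub>F n in sequentially. b n < \<beta> (length L)"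
      using order_tendstoD(2)[OF b \<beta>] .
    moreover have "\<forall>\<^sub>F n in sequentially. \<forall>m\<in>set L. norm (E n m) < (1/2) ^ Suc (length L)"
    proof (intro eventually_ball_finite finite_set ballI)
      fix m
      have "(\<lambda>n. norm (E n m)) \<longlonglongrightarrow> 0" using col[of m] by (simp add: tendsto_norm_zero)
      then show "\<forall>\<^sub>F n in sequentially. norm (E n m) < (1/2) ^ Suc (length L)"
        by (rule order_tendstoD(2)) simp
    qed
    moreover have "\<forall>\<^sub>F n in sequentially. real (length L) + 1 + sum_list (map B L) \<le> norm (E n n)"
      using diag by (simp add: filterlim_at_top)
    ultimately have "\<forall>\<^sub>F n in sequentially. b n \<le> \<beta> (length L) \<and> (\<forall>m\<in>set L. norm (E n m) \<le> (1/2) ^ Suc (length L)) \<and>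
      real (length L) + 1 + sum_list (map B L) \<le> norm (E n n)"
      by eventually_elim (auto intro: less_imp_le)
    then show ?thesis by (metis (mono_tags, lifting) eventually_happens sequentially_bot)
  qed
  then obtain pick where pick: "\<And>L. b (pick L) \<le> \<beta> (length L)" "\<And>L m. m \<in> set L \<Longrightarrow> norm (E (pick L) m) \<le> (1/2) ^ Suc (length L)"
     "\<And>L. real (length L) + 1 + sum_list (map B L) \<le> norm (E (pick L) (pick L))"
    by metis
  \<comment> \<open>\<open>L k\<close> lists \<open>r (k - 1)\<close>, ..., \<open>r 0\<close>, with
    the latest choice at the head.\<close>
  define L where "L = rec_nat [] (\<lambda>_ l. pick l # l)"
  define r where "r = (\<lambda>k. pick (L k))"
  have r_eq: "pick (L k) = r k" for k by (simp add: r_def)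
  have L0: "L 0 = []" and LS: "L (Suc k) = r k # L k" for k by (simp_all add: L_def r_def)
  have len: "length (L k) = k" for k by (induction k) (simp_all add: L0 LS)
  have setL: "set (L k) = r ` {..<k}" for k by (induction k) (simp_all add: L0 LS lessThan_Suc)
  have sumL: "sum_list (map B (L k)) = (\<Sum>j<k. B (r j))" for k by (induction k) (simp_all add: L0 LS)
  have "b (r k) \<le> \<beta> k" for k using pick(1)[of "L k"] by (simp add: r_def len)
  moreover have "real k \<le> norm S" if S: "(\<lambda>j. E (r j) (r k)) sums S" for k S
  proof -
    have small: "norm (E (r j) (r k)) \<le> (1/2) ^ Suc j" if "k < j" for j
      using pick(2)[of "r k" "L j"] that by (auto simp: r_eq len setL)
    have big: "real k + 1 + (\<Sum>j<k. B (r j)) \<le> norm (E (r k) (r k))"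
      using pick(3)[of "L k"] by (simp add: r_eq len sumL)
    have s1: "(\<lambda>j. E (r (j + Suc k)) (r k)) sums (S - (\<Sum>j<Suc k. E (r j) (r k)))"
      by (rule sums_split_initial_segment[OF S])
    have s2: "(\<lambda>j. (1/2::real) ^ Suc (j + Suc k)) sums ((1/2) ^ Suc k)"
      using sums_mult2[OF power_half_series, of "(1/2) ^ Suc k"] by (simp add: power_add mult_ac)
    have "norm (\<Sum>j. E (r (j + Suc k)) (r k)) \<le> (\<Sum>j. (1/2) ^ Suc (j + Suc k))"
      by (rule norm_suminf_le[OF small sums_summable[OF s2]]) simp
    then have "norm (S - (\<Sum>j<Suc k. E (r j) (r k))) \<le> (1/2) ^ Suc k"
      unfolding sums_unique[OF s1, symmetric] sums_unique[OF s2, symmetric] .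
    also have "\<dots> \<le> 1" by (rule power_le_one) auto
    finally have tail: "norm (S - (\<Sum>j<k. E (r j) (r k)) - E (r k) (r k)) \<le> 1" by (simp add: algebra_simps)
    have "norm (\<Sum>j<k. E (r j) (r k)) \<le> (\<Sum>j<k. B (r j))"
      by (rule sum_norm_le) (rule B)
    moreover have "norm (E (r k) (r k)) \<le> norm S + norm (\<Sum>j<k. E (r j) (r k)) + norm (S - (\<Sum>j<k. E (r j) (r k)) - E (r k) (r k))"
    proof -
      have "E (r k) (r k) = S - (\<Sum>j<k. E (r j) (r k)) - (S - (\<Sum>j<k. E (r j) (r k)) - E (r k) (r k))" by simp
      then show ?thesis by (smt (verit) norm_triangle_ineq4)
    qed
    ultimately show ?thesis using big tail by linarith
  qed
  ultimately show ?thesis by blast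
qed

text \<open>A crude substitute for Minkowski's inequality: some single term carries at least the
  fraction (1/2)^(k+1) of the sum. The resulting factor is harmless against terms whose norms decay
  like 4^-k.\<close>

lemma weighted_powr_suminf_le:
  fixes c :: "nat \<Rightarrow> complex"
  assumes sm: "summable (\<lambda>k. norm (c k))" and p: "0 < p" and w: "0 \<le> w"
  shows "ennreal (norm (\<Sum>k. c k) powr p * w) \<le> (\<Sum>k. ennreal ((2 ^ Suc k) powr p) * ennreal (norm (c k) powr p * w))"
proof -
  define F where "F = norm (\<Sum>k. c k)"
  \<comment> \<open>as the weights \<open>(1/2) ^ Suc k\<close> sum to 1\<close>
  have "\<exists>k. F \<le> 2 ^ Suc k * norm (c k)"
  proof (rule ccontr)
    assume "\<not> ?thesis"
    then have lt: "0 < F * (1/2) ^ Suc k - norm (c k)" for k by (simp add: not_le field_simps)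
    have s: "(\<lambda>k. F * (1/2) ^ Suc k) sums F" using sums_mult[OF power_half_series, of F] by simp
    have "0 < (\<Sum>k. F * (1/2) ^ Suc k - norm (c k))"
      by (intro suminf_pos summable_diff sm sums_summable[OF s] lt)
    also have "\<dots> = F - (\<Sum>k. norm (c k))"
      using suminf_diff[OF sums_summable[OF s] sm] sums_unique[OF s] by simp
    finally show False using summable_norm[OF sm] by (simp add: F_def)
  qed
  then obtain k where k: "F \<le> 2 ^ Suc k * norm (c k)" by blast
  have "F powr p \<le> (2 ^ Suc k * norm (c k)) powr p" using k p by (intro powr_mono2) (auto simp: F_def)
  then have "F powr p * w \<le> (2 ^ Suc k) powr p * (norm (c k) powr p * w)"
    using mult_right_mono[OF _ w] by (simp add: powr_mult mult.assoc[symmetric])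
  then have "ennreal (F powr p * w) \<le> ennreal ((2 ^ Suc k) powr p) * ennreal (norm (c k) powr p * w)"
    by (simp add: ennreal_mult'[symmetric] ennreal_leI)
  also have "\<dots> \<le> (\<Sum>k. ennreal ((2 ^ Suc k) powr p) * ennreal (norm (c k) powr p * w))"
    using sum_le_suminf[of "\<lambda>k. ennreal ((2 ^ Suc k) powr p) * ennreal (norm (c k) powr p * w)" "{k}"] by simp
  finally show ?thesis by (simp add: F_def)
qed

section \<open>Series in Bergman spaces with geometrically small terms\<close>

context doubling_weight
begin

text \<open>Point evaluation on compact disks turns the norm decay into values of order 4^-k, hence
  locally uniform convergence. For the norm, the loss of 2^((k+1)p) against 4^(-kp) leaves a
  geometric series of ratio 2^-p.\<close>

lemma bergman_series:
  assumes hol: "\<And>k. g k holomorphic_on ball 0 1" and p: "1 < p" and B: "0 \<le> B"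
    and small: "\<And>k. wnorm p \<omega> (g k) \<le> ennreal (B * (4 ^ k) powr (- p))"
  shows "\<And>z. norm z < 1 \<Longrightarrow> summable (\<lambda>k. norm (g k z))"
    and "(\<lambda>z. \<Sum>k. g k z) holomorphic_on ball 0 1"
    and "wnorm p \<omega> (\<lambda>z. \<Sum>k. g k z) < \<infinity>"
proof -
  define C where "C = 4 * 2 powr (K + 1) / pi"
  have C: "0 \<le> C" by (simp add: C_def)
  have bound: "\<exists>A. \<forall>k. \<forall>z\<in>cball 0 r. norm (g k z) \<le> A * (1/4) ^ k" if r: "r < 1" for r
  proof (cases "cball (0::complex) r = {}")
    case False
    \<comment> \<open>The factor in the point evaluation bound; it has a positive minimum on a
      compact disk.\<close>
    define W where "W = (\<lambda>z::complex. \<omega> (norm z) * (1 - norm z)\<^sup>2)"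
    have sub: "cball (0::complex) r \<subseteq> ball 0 1" using r by auto
    have "continuous_on (cball 0 r) W" unfolding W_def
      by (intro continuous_on_mult continuous_on_subset[OF continuous_on_weight sub] continuous_intros)
    from continuous_attains_inf[OF compact_cball False this]
    obtain z1 where z1: "z1 \<in> cball 0 r" "\<And>z. z \<in> cball 0 r \<Longrightarrow> W z1 \<le> W z"
      by meson
    have W1: "0 < W z1" using z1(1) sub weight_pos[of "norm z1"] by (auto simp: W_def)
    have "norm (g k z) \<le> (C * B / W z1) powr (1/p) * (1/4) ^ k" if z: "z \<in> cball 0 r" for k z
    proof -
      have zn: "norm z < 1" using z sub by auto
      have "ennreal (norm (g k z) powr p * W z) \<le> ennreal C * wnorm p \<omega> (g k)"
        unfolding W_def C_def by (rule point_evaluation[OF hol p zn])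
      also have "\<dots> \<le> ennreal C * ennreal (B * (4 ^ k) powr (- p))" by (intro mult_left_mono small) auto
      also have "\<dots> = ennreal (C * (B * (4 ^ k) powr (- p)))" using C B by (simp add: ennreal_mult)
      finally have "norm (g k z) powr p * W z \<le> C * (B * (4 ^ k) powr (- p))"
        using C B by (subst (asm) ennreal_le_iff) auto
      moreover have "norm (g k z) powr p * W z1 \<le> norm (g k z) powr p * W z"
        by (intro mult_left_mono z1 z) auto
      ultimately have "norm (g k z) powr p \<le> C * B / W z1 * (4 ^ k) powr (- p)"
        using W1 by (simp add: field_simps)
      then have "(norm (g k z) powr p) powr (1/p) \<le> (C * B / W z1 * (4 ^ k) powr (- p)) powr (1/p)"
        using p by (intro powr_mono2) auto
      also have "\<dots> = (C * B / W z1) powr (1/p) * (4 ^ k) powr (- 1)"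
      proof -
        have "(C * B / W z1 * (4 ^ k) powr (- p)) powr (1/p) = (C * B / W z1) powr (1/p) * ((4 ^ k) powr (- p)) powr (1/p)"
          by (rule powr_mult)
        also have "((4 ^ k) powr (- p)) powr (1/p) = ((4::real) ^ k) powr (- 1)"
          using p by (simp only: powr_powr) simp
        finally show ?thesis .
      qed
      also have "(4 ^ k) powr (- 1) = ((1/4) ^ k :: real)" by (simp add: powr_minus power_one_over inverse_eq_divide)
      finally show ?thesis using p by (simp add: powr_powr)
    qed
    then show ?thesis by blast
  qed auto
  show sm: "summable (\<lambda>k. norm (g k z))" if z: "norm z < 1" for z
  proof -
    obtain A where "\<forall>k. \<forall>w\<in>cball 0 (norm z). norm (g k w) \<le> A * (1/4) ^ k" using bound[OF z] by blast
    then have "norm (norm (g k z)) \<le> A * (1/4) ^ k" for k by simp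
    then show ?thesis by (rule summable_comparison_test'[rotated]) (intro summable_mult summable_geometric, simp)
  qed
  show "(\<lambda>z. \<Sum>k. g k z) holomorphic_on ball 0 1"
  proof (rule holomorphic_uniform_sequence[where f = "\<lambda>n z. \<Sum>k<n. g k z"])
    show "(\<lambda>z. \<Sum>k<n. g k z) holomorphic_on ball 0 1" for n by (intro holomorphic_on_sum hol)
    fix z :: complex assume "z \<in> ball 0 1"
    then have z: "norm z < 1" by simp
    define d where "d = (1 - norm z) / 2"
    have d: "0 < d" using z by (simp add: d_def)
    have sub: "cball z d \<subseteq> cball 0 (norm z + d)"
    proof
      fix x assume "x \<in> cball z d"
      then have "norm (x - z) \<le> d" by (simp add: dist_norm norm_minus_commute)
      then show "x \<in> cball 0 (norm z + d)" using norm_triangle_sub[of x z] by simp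
    qed
    have r: "norm z + d < 1" using z by (simp add: d_def field_simps)
    obtain A where A: "\<forall>k. \<forall>w\<in>cball 0 (norm z + d). norm (g k w) \<le> A * (1/4) ^ k" using bound[OF r] by blast
    have "uniform_limit (cball z d) (\<lambda>n z. \<Sum>k<n. g k z) (\<lambda>z. \<Sum>k. g k z) sequentially"
      by (rule Weierstrass_m_test[where M = "\<lambda>k. A * (1/4) ^ k"])
         (use A sub in \<open>auto intro!: summable_mult summable_geometric\<close>)
    moreover have "cball z d \<subseteq> ball 0 1" using sub r by auto
    ultimately show "\<exists>d>0. cball z d \<subseteq> ball 0 1 \<and> uniform_limit (cball z d) (\<lambda>n z. \<Sum>k<n. g k z) (\<lambda>z. \<Sum>k. g k z) sequentially"
      using d by blast
  qed simp
  have p0: "0 < p" using p by simp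
  have "wnorm p \<omega> (\<lambda>z. \<Sum>k. g k z) \<le> (\<integral>\<^sup>+z. (\<Sum>k. ennreal ((2 ^ Suc k) powr p) * (ennreal (norm (g k z) powr p * \<omega> (norm z)) * indicator (ball 0 1) z)) \<partial>lborel)"
    unfolding wnorm_def
  proof (rule nn_integral_mono)
    fix z :: complex
    show "ennreal (norm (\<Sum>k. g k z) powr p * \<omega> (norm z)) * indicator (ball 0 1) z
      \<le> (\<Sum>k. ennreal ((2 ^ Suc k) powr p) * (ennreal (norm (g k z) powr p * \<omega> (norm z)) * indicator (ball 0 1) z))"
      using weighted_powr_suminf_le[OF sm p0 weight_nonneg, of z "norm z"] by (cases "norm z < 1") auto
  qed
  also have "\<dots> = (\<Sum>k. \<integral>\<^sup>+z. ennreal ((2 ^ Suc k) powr p) * (ennreal (norm (g k z) powr p * \<omega> (norm z)) * indicator (ball 0 1) z) \<partial>lborel)"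
    using wnorm_measurable[OF hol p0] by (intro nn_integral_suminf) simp
  also have "\<dots> = (\<Sum>k. ennreal ((2 ^ Suc k) powr p) * wnorm p \<omega> (g k))"
    unfolding wnorm_def using wnorm_measurable[OF hol p0] by (intro suminf_cong nn_integral_cmult) simp
  also have "\<dots> \<le> (\<Sum>k. ennreal (2 powr p * B * ((1/2) powr p) ^ k))"
  proof (rule suminf_le)
    fix k
    have "ennreal ((2 ^ Suc k) powr p) * wnorm p \<omega> (g k) \<le> ennreal ((2 ^ Suc k) powr p) * ennreal (B * (4 ^ k) powr (- p))"
      by (intro mult_left_mono small) auto
    also have "\<dots> = ennreal ((2 ^ Suc k) powr p * (B * (4 ^ k) powr (- p)))" by (simp add: ennreal_mult')
    also have "(2 ^ Suc k) powr p * (B * (4 ^ k) powr (- p)) = 2 powr p * B * ((1/2) powr p) ^ k"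
    proof -
      have e: "(4::real) ^ k = 2 ^ k * 2 ^ k" by (simp add: power_mult_distrib[symmetric])
      have "(2 ^ k) powr p * (4 ^ k) powr (- p) = (2 ^ k) powr (- p)"
        unfolding e by (simp add: powr_mult powr_minus field_simps)
      also have "\<dots> = ((1/2) powr p) ^ k"
        by (simp add: powr_realpow[symmetric] powr_powr powr_minus powr_divide inverse_eq_divide mult.commute power_divide)
      finally show ?thesis by (simp add: powr_mult mult_ac)
    qed
    finally show "ennreal ((2 ^ Suc k) powr p) * wnorm p \<omega> (g k) \<le> ennreal (2 powr p * B * ((1/2) powr p) ^ k)" .
  qed auto
  also have "\<dots> < \<infinity>"
  proof -
    have "(1/2) powr p < (1/2) powr (0::real)" using p by (intro powr_less_mono') auto
    then have "summable (\<lambda>k. 2 powr p * B * ((1/2) powr p) ^ k)" by (intro summable_mult summable_geometric) auto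
    then show ?thesis using B by (subst suminf_ennreal2) (auto simp: less_top)
  qed
  finally show "wnorm p \<omega> (\<lambda>z. \<Sum>k. g k z) < \<infinity>" .
qed

text \<open>\<Lambda> m is the scale at which values at the test point w m are measured. Null norms
  make the columns vanish by point evaluation, and the threshold imposed on b is the decay that
  \<open>bergman_series\<close> asks for.\<close>

lemma bergman_gliding_hump:
  assumes hol: "\<And>n. g n holomorphic_on ball 0 1" and p: "1 < p"
    and norms: "\<And>n. wnorm p \<omega> (g n) \<le> ennreal (b n)" and b: "b \<longlonglongrightarrow> 0"
    and w: "\<And>m. norm (w m) < 1"
    and row: "\<And>n. \<exists>B. \<forall>m. norm (\<Lambda> m * g n (w m)) \<le> B"
    and diag: "filterlim (\<lambda>n. norm (\<Lambda> n * g n (w n))) at_top sequentially"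
  obtains r where "\<And>k. b (r k) \<le> (4 ^ k) powr (- p)"
    and "\<And>k. wnorm p \<omega> (g (r k)) \<le> ennreal (1 * (4 ^ k) powr (- p))"
    and "\<And>k. real k \<le> norm (\<Lambda> (r k) * (\<Sum>j. g (r j) (w (r k))))"
proof -
  have col: "(\<lambda>n. \<Lambda> m * g n (w m)) \<longlonglongrightarrow> 0" for m
  proof -
    define C where "C = 4 * 2 powr (K + 1) / pi"
    define W where "W = \<omega> (norm (w m)) * (1 - norm (w m))\<^sup>2"
    have W: "0 < W" using w[of m] weight_pos[of "norm (w m)"] by (simp add: W_def)
    have C: "0 \<le> C" by (simp add: C_def)
    have le: "norm (g n (w m)) \<le> (C / W * \<bar>b n\<bar>) powr (1/p)" for n
    proof -
      have "ennreal (norm (g n (w m)) powr p * W) \<le> ennreal C * wnorm p \<omega> (g n)"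
        unfolding W_def C_def by (rule point_evaluation[OF hol p w])
      also have "\<dots> \<le> ennreal C * ennreal \<bar>b n\<bar>"
        by (intro mult_left_mono order_trans[OF norms] ennreal_leI) auto
      also have "\<dots> = ennreal (C * \<bar>b n\<bar>)" using C by (simp add: ennreal_mult)
      finally have "norm (g n (w m)) powr p * W \<le> C * \<bar>b n\<bar>" using C by (subst (asm) ennreal_le_iff) auto
      then have "norm (g n (w m)) powr p \<le> C / W * \<bar>b n\<bar>" using W by (simp add: field_simps)
      then have "(norm (g n (w m)) powr p) powr (1/p) \<le> (C / W * \<bar>b n\<bar>) powr (1/p)"
        using p by (intro powr_mono2) auto
      then show ?thesis using p by (simp add: powr_powr)
    qed
    have "(\<lambda>n. (C / W * \<bar>b n\<bar>) powr (1/p)) \<longlonglongrightarrow> (C / W * \<bar>0\<bar>) powr (1/p)"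
      using p C W by (intro tendsto_powr' tendsto_intros b) (auto intro!: always_eventually)
    then have "(\<lambda>n. (C / W * \<bar>b n\<bar>) powr (1/p)) \<longlonglongrightarrow> 0" by simp
    then have "(\<lambda>n. g n (w m)) \<longlonglongrightarrow> 0"
      by (rule Lim_null_comparison[rotated]) (intro always_eventually allI le)
    then show ?thesis by (intro tendsto_mult_right_zero)
  qed
  obtain r where r: "\<And>k. b (r k) \<le> (4 ^ k) powr (- p)"
    "\<And>k S. (\<lambda>j. \<Lambda> (r k) * g (r j) (w (r k))) sums S \<Longrightarrow> real k \<le> norm S"
    using gliding_hump[of "\<lambda>n m. \<Lambda> m * g n (w m)" b "\<lambda>k. (4 ^ k) powr (- p)", OF col row diag b] by auto
  have n: "wnorm p \<omega> (g (r k)) \<le> ennreal (1 * (4 ^ k) powr (- p))" for k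
    using order_trans[OF norms ennreal_leI[OF r(1)]] by simp
  have l: "real k \<le> norm (\<Lambda> (r k) * (\<Sum>j. g (r j) (w (r k))))" for k
  proof (rule r(2))
    have "summable (\<lambda>j. g (r j) (w (r k)))"
      using bergman_series(1)[of "\<lambda>j. g (r j)" p 1, OF hol p _ n w] by (rule summable_norm_cancel) simp
    then show "(\<lambda>j. \<Lambda> (r k) * g (r j) (w (r k))) sums (\<Lambda> (r k) * (\<Sum>j. g (r j) (w (r k))))"
      by (intro sums_mult summable_sums)
  qed
  show ?thesis by (rule that[of r]) (rule r(1) n l)+
qed

end

section \<open>Finite Blaschke products\<close>

text \<open>Limits as |z| tends to 1 from inside, uniformly in the argument of z.\<close>

abbreviation circle_filter :: "complex filter" where
  "circle_filter \<equiv> filtercomap norm (at_left 1)"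

lemma eventually_circle_filter:
  "eventually P circle_filter \<longleftrightarrow> (\<exists>R. 0 \<le> R \<and> R < 1 \<and> (\<forall>z. R < norm z \<and> norm z < 1 \<longrightarrow> P z))"
proof
  assume "eventually P circle_filter"
  then obtain Q where Q: "eventually Q (at_left (1::real))" "\<And>z. Q (norm z) \<Longrightarrow> P z"
    by (auto simp: eventually_filtercomap)
  from Q(1) obtain b where b: "b < 1" "\<And>y. b < y \<Longrightarrow> y < 1 \<Longrightarrow> Q y"
    by (auto simp: eventually_at_left[of 0 1])
  show "\<exists>R. 0 \<le> R \<and> R < 1 \<and> (\<forall>z. R < norm z \<and> norm z < 1 \<longrightarrow> P z)"
    using b Q(2) by (intro exI[of _ "max b 0"]) auto
next
  assume "\<exists>R. 0 \<le> R \<and> R < 1 \<and> (\<forall>z. R < norm z \<and> norm z < 1 \<longrightarrow> P z)"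
  then obtain R where R: "R < 1" "\<And>z. R < norm z \<Longrightarrow> norm z < 1 \<Longrightarrow> P z" by auto
  have "eventually (\<lambda>y. R < y \<and> y < 1) (at_left 1)"
    using R(1) by (auto simp: eventually_at_left[of 0 1])
  then have "eventually (\<lambda>z. R < norm z \<and> norm z < 1) circle_filter" by (rule eventually_filtercomapI)
  then show "eventually P circle_filter" by (rule eventually_mono) (use R(2) in auto)
qed

lemma eventually_in_disk: "eventually (\<lambda>z. norm z < 1) circle_filter"
  by (auto simp: eventually_circle_filter intro!: exI[of _ 0])

text \<open>The identity for 1 - |M|^2, with M the Moebius value, bounds it by (1 - |z|^2) / (1 -
  |a|)^2.\<close>

lemma norm_Moebius_tendsto_1:
  assumes a: "norm a < 1"
  shows "((\<lambda>z. norm (Moebius_function 0 a z)) \<longlongrightarrow> 1) circle_filter"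
proof -
  have n: "(norm \<longlongrightarrow> 1) circle_filter"
    by (rule filterlim_mono[OF filterlim_filtercomap _ order_refl]) (simp add: at_within_def)
  have z: "((\<lambda>z. (1 - (norm a)\<^sup>2) * (1 - (norm z)\<^sup>2) / (norm (1 - cnj a * z))\<^sup>2) \<longlongrightarrow> 0) circle_filter"
  proof (rule tendsto_sandwich)
    show "((\<lambda>z. 0) \<longlongrightarrow> (0::real)) circle_filter" by simp
    have "((\<lambda>z. (1 - (norm z)\<^sup>2) / (1 - norm a)\<^sup>2) \<longlongrightarrow> (1 - 1\<^sup>2) / (1 - norm a)\<^sup>2) circle_filter"
      by (intro tendsto_intros n) (use a in auto)
    then show "((\<lambda>z. (1 - (norm z)\<^sup>2) / (1 - norm a)\<^sup>2) \<longlongrightarrow> 0) circle_filter" by simp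
    show "\<forall>\<^sub>F z in circle_filter. 0 \<le> (1 - (norm a)\<^sup>2) * (1 - (norm z)\<^sup>2) / (norm (1 - cnj a * z))\<^sup>2"
      using eventually_in_disk by (rule eventually_mono) (use a in \<open>auto simp: power_le_one\<close>)
    show "\<forall>\<^sub>F z in circle_filter. (1 - (norm a)\<^sup>2) * (1 - (norm z)\<^sup>2) / (norm (1 - cnj a * z))\<^sup>2 \<le> (1 - (norm z)\<^sup>2) / (1 - norm a)\<^sup>2"
      using eventually_in_disk
    proof (rule eventually_mono)
      fix z :: complex assume z: "norm z < 1"
      have "(1 - (norm a)\<^sup>2) * (1 - (norm z)\<^sup>2) \<le> 1 * (1 - (norm z)\<^sup>2)"
        using a z by (intro mult_right_mono) (auto simp: power_le_one)
      then show "(1 - (norm a)\<^sup>2) * (1 - (norm z)\<^sup>2) / (norm (1 - cnj a * z))\<^sup>2 \<le> (1 - (norm z)\<^sup>2) / (1 - norm a)\<^sup>2"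
        using a z norm_one_minus_cnj_mult_ge(2)[OF a z]
        by (intro frac_le power_mono) (auto simp: power_le_one)
    qed
  qed
  have "((\<lambda>z. sqrt (1 - (1 - (norm a)\<^sup>2) * (1 - (norm z)\<^sup>2) / (norm (1 - cnj a * z))\<^sup>2)) \<longlongrightarrow> sqrt (1 - 0)) circle_filter"
    by (intro tendsto_intros z)
  moreover have "\<forall>\<^sub>F z in circle_filter. sqrt (1 - (1 - (norm a)\<^sup>2) * (1 - (norm z)\<^sup>2) / (norm (1 - cnj a * z))\<^sup>2) = norm (Moebius_function 0 a z)"
    using eventually_in_disk
    by (rule eventually_mono) (use one_minus_norm_Moebius_sq[OF a, symmetric] in simp)
  ultimately show ?thesis by (simp add: tendsto_cong)
qed

text \<open>Maximum modulus on a disk containing z whose radius is so close to 1 that |g| < 1 + e on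
  its boundary.\<close>

lemma norm_le_1_of_circle_limit:
  assumes hol: "g holomorphic_on ball 0 1" and lim: "((\<lambda>z. norm (g z)) \<longlongrightarrow> 1) circle_filter"
    and z: "norm z < 1"
  shows "norm (g z) \<le> 1"
proof (rule field_le_epsilon)
  fix e :: real assume "0 < e"
  then have "\<forall>\<^sub>F z in circle_filter. norm (g z) < 1 + e" by (intro order_tendstoD(2)[OF lim]) simp
  then obtain R where R: "0 \<le> R" "R < 1" "\<And>z. R < norm z \<Longrightarrow> norm z < 1 \<Longrightarrow> norm (g z) < 1 + e"
    by (auto simp: eventually_circle_filter)
  define r where "r = (1 + max R (norm z)) / 2"
  have r: "R < r" "norm z < r" "r < 1" "0 < r" using R z by (auto simp: r_def max_def)
  have sub: "cball 0 r \<subseteq> ball (0::complex) 1" using r by auto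
  show "norm (g z) \<le> 1 + e"
  proof (rule maximum_modulus_frontier[where S = "cball 0 r" and f = g])
    show "g holomorphic_on interior (cball 0 r)"
      using sub by (intro holomorphic_on_subset[OF hol]) auto
    show "continuous_on (closure (cball 0 r)) g"
      using sub by (simp add: holomorphic_on_imp_continuous_on holomorphic_on_subset[OF hol])
    show "norm (g w) \<le> 1 + e" if "w \<in> frontier (cball 0 r)" for w
      using that r R(3)[of w] by (simp add: less_imp_le)
  qed (use r in auto)
qed

text \<open>The preceding bound holds for g and for 1 / g, so |g| = 1 throughout and the maximum
  modulus principle applies.\<close>

lemma nonvanishing_circle_limit_constant:
  assumes hol: "g holomorphic_on ball 0 1" and lim: "((\<lambda>z. norm (g z)) \<longlongrightarrow> 1) circle_filter"
    and nz: "\<And>z. norm z < 1 \<Longrightarrow> g z \<noteq> 0"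
  obtains c where "norm c = 1" "\<And>z. norm z < 1 \<Longrightarrow> g z = c"
proof -
  have "(\<lambda>z. inverse (g z)) holomorphic_on ball 0 1" by (intro holomorphic_intros hol) (use nz in auto)
  moreover have "((\<lambda>z. norm (inverse (g z))) \<longlongrightarrow> 1) circle_filter"
    using tendsto_inverse[OF lim] by (simp add: norm_inverse)
  ultimately have inv: "norm (inverse (g z)) \<le> 1" if "norm z < 1" for z
    using that by (rule norm_le_1_of_circle_limit)
  have "1 \<le> norm (g z)" if "norm z < 1" for z
    using inv[OF that] nz[OF that] by (simp add: norm_inverse inverse_le_1_iff)
  then have one: "norm (g z) = 1" if "norm z < 1" for z
    using norm_le_1_of_circle_limit[OF hol lim that] that by (simp add: order_antisym)
  have "g constant_on ball 0 1"
    by (rule maximum_modulus_principle[OF hol, of "ball 0 1" 0]) (auto simp: one)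
  then obtain c where c: "\<And>z. norm z < 1 \<Longrightarrow> g z = c" by (auto simp: constant_on_def)
  show ?thesis by (rule that[of c]) (use one[of 0] c in auto)
qed

lemma finite_Blaschke_product_mult_power:
  assumes h: "finite_Blaschke_product h" and \<alpha>: "norm \<alpha> < 1"
    and \<phi>: "\<And>z. norm z < 1 \<Longrightarrow> \<phi> z = h z * Moebius_function 0 \<alpha> z ^ m"
  shows "finite_Blaschke_product \<phi>"
proof -
  obtain c and n :: nat and a where c: "norm c = 1" "\<forall>k<n. a k \<in> ball 0 1"
    "\<forall>z\<in>ball 0 1. h z = c * (\<Prod>k<n. Moebius_function 0 (a k) z)"
    using h unfolding finite_Blaschke_product_def by blast
  define a' where "a' = (\<lambda>k. if k < n then a k else \<alpha>)"
  have "(\<Prod>k<n+m. Moebius_function 0 (a' k) z) = (\<Prod>k<n. Moebius_function 0 (a k) z) * Moebius_function 0 \<alpha> z ^ m" for z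
    by (induction m) (auto simp: a'_def mult_ac)
  then have "\<forall>z\<in>ball 0 1. \<phi> z = c * (\<Prod>k<n+m. Moebius_function 0 (a' k) z)"
    using c(3) \<phi> by (simp add: mult.assoc)
  moreover have "\<forall>k<n+m. a' k \<in> ball 0 1" using c(2) \<alpha> by (simp add: a'_def)
  ultimately show ?thesis using c(1) unfolding finite_Blaschke_product_def by blast
qed

text \<open>Induction on the number of distinct zeros, which is finite because \<phi> has none near
  the circle. A zero is divided out with its full multiplicity, so that it leaves the zero set while
  the limit at the circle persists. Without zeros \<phi> is a unimodular constant, the empty
  product.\<close>

lemma circle_limit_imp_finite_Blaschke_product:
  assumes "\<phi> holomorphic_on ball 0 1" and "((\<lambda>z. norm (\<phi> z)) \<longlongrightarrow> 1) circle_filter"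
  shows "finite_Blaschke_product \<phi>"
  using assms
proof (induction "card {z \<in> ball 0 1. \<phi> z = 0}" arbitrary: \<phi> rule: less_induct)
  case less
  note hol = less.prems(1) and lim = less.prems(2)
  show ?case
  proof (cases "\<exists>z. norm z < 1 \<and> \<phi> z = 0")
    case False
    then obtain c where c: "norm c = 1" "\<And>z. norm z < 1 \<Longrightarrow> \<phi> z = c"
      using nonvanishing_circle_limit_constant[OF hol lim] by metis
    show ?thesis unfolding finite_Blaschke_product_def
      using c by (intro exI[of _ c] exI[of _ 0]) auto
  next
    case True
    then obtain \<alpha> where \<alpha>: "norm \<alpha> < 1" "\<phi> \<alpha> = 0" by blast
    have "\<forall>\<^sub>F z in circle_filter. 0 < norm (\<phi> z)" by (rule order_tendstoD(1)[OF lim]) simp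
    then obtain R where R: "0 \<le> R" "R < 1" "\<And>z. R < norm z \<Longrightarrow> norm z < 1 \<Longrightarrow> \<phi> z \<noteq> 0"
      by (auto simp: eventually_circle_filter)
    have nc: "\<not> \<phi> constant_on ball 0 1"
    proof
      assume c: "\<phi> constant_on ball 0 1"
      \<comment> \<open>A point beyond radius R, where \<phi> cannot vanish although \<phi> \<alpha>
        = 0.\<close>
      define x where "x = complex_of_real ((1 + R) / 2)"
      have x: "norm x = (1 + R) / 2" unfolding x_def norm_of_real using R by simp
      have "\<phi> x = \<phi> \<alpha>" using c \<alpha>(1) R(1,2) x by (auto simp: constant_on_def)
      moreover have "\<phi> x \<noteq> 0" by (rule R(3)) (use R x in auto)
      ultimately show False using \<alpha> by simp
    qed
    have "finite {z \<in> cball 0 R. \<phi> z = 0}"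
      by (rule holomorphic_compact_finite_zeros[OF hol _ _ _ _ nc]) (use R in auto)
    moreover have "{z \<in> ball 0 1. \<phi> z = 0} \<subseteq> {z \<in> cball 0 R. \<phi> z = 0}"
      using R(3) by (auto simp: not_less[symmetric])
    ultimately have fin: "finite {z \<in> ball 0 1. \<phi> z = 0}" by (rule finite_subset[rotated])
    have mem: "\<alpha> \<in> ball 0 1" using \<alpha> by simp
    obtain g r m where g: "0 < m" "0 < r" "ball \<alpha> r \<subseteq> ball 0 1" "g holomorphic_on ball \<alpha> r"
      "\<And>w. w \<in> ball \<alpha> r \<Longrightarrow> \<phi> w = (w - \<alpha>) ^ m * g w" "\<And>w. w \<in> ball \<alpha> r \<Longrightarrow> g w \<noteq> 0"
      by (rule holomorphic_factor_zero_nonconstant[OF hol open_ball connected_ball mem \<alpha>(2) nc]) blast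
    \<comment> \<open>The quotient with its removable singularity filled in: near \<alpha> the local
      factorisation cancels the power of z - \<alpha>.\<close>
    define h where "h = (\<lambda>z. if z \<in> ball \<alpha> r then g z * (1 - cnj \<alpha> * z) ^ m else \<phi> z / Moebius_function 0 \<alpha> z ^ m)"
    have Mnz: "Moebius_function 0 \<alpha> z \<noteq> 0" if "norm z < 1" "z \<noteq> \<alpha>" for z
      using that one_minus_cnj_mult_nonzero[OF \<alpha>(1) that(1)] by (simp add: Moebius_function_simple)
    have h1: "h z = \<phi> z / Moebius_function 0 \<alpha> z ^ m" if "norm z < 1" "z \<noteq> \<alpha>" for z
      using that one_minus_cnj_mult_nonzero[OF \<alpha>(1) that(1)] g(5)[of z]
      by (auto simp: h_def Moebius_function_simple power_divide)
    have un: "ball 0 1 = ball \<alpha> r \<union> (ball 0 1 - {\<alpha>})" using g(2,3) by auto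
    have "h holomorphic_on ball \<alpha> r"
      by (rule holomorphic_transform[of "\<lambda>z. g z * (1 - cnj \<alpha> * z) ^ m"])
         (auto intro!: holomorphic_intros g simp: h_def)
    moreover have "h holomorphic_on (ball 0 1 - {\<alpha>})"
    proof (rule holomorphic_transform[of "\<lambda>z. \<phi> z / Moebius_function 0 \<alpha> z ^ m"])
      show "(\<lambda>z. \<phi> z / Moebius_function 0 \<alpha> z ^ m) holomorphic_on ball 0 1 - {\<alpha>}"
        by (intro holomorphic_intros holomorphic_on_subset[OF hol] holomorphic_on_subset[OF Moebius_function_holomorphic[OF \<alpha>(1)]])
           (use Mnz in auto)
    qed (use h1 in auto)
    ultimately have holh: "h holomorphic_on ball 0 1"
      by (subst un) (intro holomorphic_on_Un; simp add: open_delete)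
    have h\<alpha>: "h \<alpha> \<noteq> 0" using g one_minus_cnj_mult_nonzero[OF \<alpha>(1) \<alpha>(1)] by (simp add: h_def)
    have zeros: "{z \<in> ball 0 1. h z = 0} = {z \<in> ball 0 1. \<phi> z = 0} - {\<alpha>}"
    proof -
      have "h z = 0 \<longleftrightarrow> \<phi> z = 0 \<and> z \<noteq> \<alpha>" if "norm z < 1" for z
        using h\<alpha> h1[OF that] Mnz[OF that] by (cases "z = \<alpha>") auto
      then show ?thesis by auto
    qed
    have card: "card {z \<in> ball 0 1. h z = 0} < card {z \<in> ball 0 1. \<phi> z = 0}"
      unfolding zeros using fin \<alpha> by (intro card_Diff1_less) auto
    have eq: "\<phi> z = h z * Moebius_function 0 \<alpha> z ^ m" if "norm z < 1" for z
      using h1[OF that] Mnz[OF that] \<alpha> g(1) by (cases "z = \<alpha>") (auto simp: Moebius_function_eq_zero)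
    have "((\<lambda>z. norm (\<phi> z) / norm (Moebius_function 0 \<alpha> z) ^ m) \<longlongrightarrow> 1 / 1 ^ m) circle_filter"
      by (intro tendsto_intros lim norm_Moebius_tendsto_1 \<alpha>) simp
    moreover have "\<forall>\<^sub>F z in circle_filter. norm (\<phi> z) / norm (Moebius_function 0 \<alpha> z) ^ m = norm (h z)"
    proof -
      have "\<forall>\<^sub>F z in circle_filter. 0 < norm (Moebius_function 0 \<alpha> z)"
        by (rule order_tendstoD(1)[OF norm_Moebius_tendsto_1[OF \<alpha>(1)]]) simp
      then show ?thesis using eventually_in_disk
        by eventually_elim (auto simp: eq norm_mult norm_power)
    qed
    ultimately have limh: "((\<lambda>z. norm (h z)) \<longlongrightarrow> 1) circle_filter" by (simp add: tendsto_cong)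
    show ?thesis
      by (rule finite_Blaschke_product_mult_power[OF less.hyps[OF card holh limh] \<alpha>(1) eq])
  qed
qed

text \<open>By contraposition |\<phi>| does not tend to 1 at the circle; as it stays below 1, it
  must drop to 1 - e at points arbitrarily close to the circle.\<close>

lemma not_finite_Blaschke_product_sequence:
  assumes hol: "\<phi> holomorphic_on ball 0 1" and self: "\<And>z. norm z < 1 \<Longrightarrow> norm (\<phi> z) < 1"
    and nb: "\<not> finite_Blaschke_product \<phi>"
  obtains \<delta> z where "0 < \<delta>" "\<And>n::nat. norm (z n) < 1" "\<And>n. norm (\<phi> (z n)) \<le> 1 - \<delta>"
    "(\<lambda>n. norm (z n)) \<longlonglongrightarrow> 1"
proof -
  have "\<not> ((\<lambda>z. norm (\<phi> z)) \<longlongrightarrow> 1) circle_filter"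
    using nb circle_limit_imp_finite_Blaschke_product[OF hol] by blast
  then obtain e where e: "0 < e" "\<not> (\<forall>\<^sub>F z in circle_filter. dist (norm (\<phi> z)) 1 < e)"
    by (auto simp: tendsto_iff)
  have "\<exists>z. 1 - 1 / real (n + 1) < norm z \<and> norm z < 1 \<and> norm (\<phi> z) \<le> 1 - e" for n
  proof (rule ccontr)
    assume *: "\<not> ?thesis"
    have "dist (norm (\<phi> z)) 1 < e" if "1 - 1 / real (n + 1) < norm z" "norm z < 1" for z
      using * that self[OF that(2)] by (auto simp: dist_real_def abs_real_def)
    then have "\<forall>\<^sub>F z in circle_filter. dist (norm (\<phi> z)) 1 < e"
      unfolding eventually_circle_filter by (intro exI[of _ "1 - 1 / real (n + 1)"]) auto
    then show False using e by blast
  qed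
  then obtain z where z: "\<And>n. 1 - 1 / real (n + 1) < norm (z n)" "\<And>n. norm (z n) < 1" "\<And>n. norm (\<phi> (z n)) \<le> 1 - e"
    by metis
  have "(\<lambda>n. norm (z n)) \<longlonglongrightarrow> 1"
  proof (rule tendsto_sandwich)
    have "(\<lambda>n. 1 - 1 / real (n + 1)) \<longlonglongrightarrow> 1 - 0"
      using LIMSEQ_inverse_real_of_nat by (intro tendsto_diff tendsto_const) (simp add: inverse_eq_divide)
    then show "(\<lambda>n. 1 - 1 / real (n + 1)) \<longlonglongrightarrow> 1" by simp
  qed (use z in \<open>auto intro!: always_eventually less_imp_le\<close>)
  then show ?thesis using that e(1) z(2,3) by blast
qed

section \<open>Boundary distance under a finite Blaschke product\<close>

lemma one_minus_prod_le_sum: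
  fixes t :: "nat \<Rightarrow> real"
  assumes "\<And>k. k < n \<Longrightarrow> 0 \<le> t k" "\<And>k. k < n \<Longrightarrow> t k \<le> 1"
  shows "1 - (\<Prod>k<n. t k) \<le> (\<Sum>k<n. 1 - t k)"
  using assms
proof (induction n)
  case (Suc n)
  have P: "0 \<le> (\<Prod>k<n. t k)" "(\<Prod>k<n. t k) \<le> 1" using Suc.prems by (auto intro!: prod_nonneg prod_le_1)
  have "0 \<le> (1 - (\<Prod>k<n. t k)) * (1 - t n)" using P Suc.prems by (intro mult_nonneg_nonneg) auto
  then have "1 - (\<Prod>k<n. t k) * t n \<le> (1 - (\<Prod>k<n. t k)) + (1 - t n)" by (simp add: algebra_simps)
  also have "\<dots> \<le> (\<Sum>k<n. 1 - t k) + (1 - t n)" using Suc by simp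
  finally show ?case by simp
qed simp

text \<open>The deficit of a product is at most the sum of the deficits of its factors, and each of
  these is controlled by the Moebius identity.\<close>

lemma finite_Blaschke_product_boundary_distance:
  assumes "finite_Blaschke_product \<phi>"
  obtains D where "1 \<le> D" "\<And>z. norm z < 1 \<Longrightarrow> 1 - norm (\<phi> z) \<le> D * (1 - norm z)"
proof -
  obtain c and n :: nat and a where B: "norm c = 1" "\<forall>k<n. a k \<in> ball 0 1"
    "\<forall>z\<in>ball 0 1. \<phi> z = c * (\<Prod>k<n. Moebius_function 0 (a k) z)"
    using assms unfolding finite_Blaschke_product_def by blast
  have c: "norm c = 1" "\<And>k. k < n \<Longrightarrow> norm (a k) < 1"
    "\<And>z. norm z < 1 \<Longrightarrow> \<phi> z = c * (\<Prod>k<n. Moebius_function 0 (a k) z)"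
    using B by auto
  \<comment> \<open>The summand 1 guarantees D >= 1, which the later comparison of powers of D with
    1 relies on.\<close>
  define D where "D = 1 + (\<Sum>k<n. 2 / (1 - norm (a k))\<^sup>2)"
  have "1 - norm (\<phi> z) \<le> D * (1 - norm z)" if z: "norm z < 1" for z
  proof -
    have t1: "norm (Moebius_function 0 (a k) z) < 1" if "k < n" for k
      by (rule Moebius_function_norm_lt_1[OF c(2)[OF that] z])
    have "1 - norm (\<phi> z) = 1 - (\<Prod>k<n. norm (Moebius_function 0 (a k) z))"
      using c z by (simp add: norm_mult prod_norm)
    also have "\<dots> \<le> (\<Sum>k<n. 1 - norm (Moebius_function 0 (a k) z))"
      by (rule one_minus_prod_le_sum) (use t1 in \<open>auto intro: less_imp_le\<close>)
    also have "\<dots> \<le> (\<Sum>k<n. 2 / (1 - norm (a k))\<^sup>2 * (1 - norm z))"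
    proof (rule sum_mono)
      fix k assume "k \<in> {..<n}"
      then have k: "k < n" by simp
      note a = c(2)[OF k]
      have "1 - norm (Moebius_function 0 (a k) z) \<le> 1 - (norm (Moebius_function 0 (a k) z))\<^sup>2"
        using t1[OF k] by (simp add: power2_eq_square mult_left_le)
      also have "\<dots> = (1 - (norm (a k))\<^sup>2) * (1 - (norm z)\<^sup>2) / (norm (1 - cnj (a k) * z))\<^sup>2"
        by (rule one_minus_norm_Moebius_sq[OF a z])
      also have "\<dots> \<le> (1 * (2 * (1 - norm z))) / (1 - norm (a k))\<^sup>2"
      proof (intro frac_le mult_mono power_mono norm_one_minus_cnj_mult_ge(2) a z)
        have "1 - (norm z)\<^sup>2 = (1 + norm z) * (1 - norm z)" by (simp add: power2_eq_square algebra_simps)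
        also have "\<dots> \<le> 2 * (1 - norm z)" using z by (intro mult_right_mono) auto
        finally show "1 - (norm z)\<^sup>2 \<le> 2 * (1 - norm z)" .
      qed (use a z in \<open>auto simp: power_le_one\<close>)
      finally show "1 - norm (Moebius_function 0 (a k) z) \<le> 2 / (1 - norm (a k))\<^sup>2 * (1 - norm z)" by simp
    qed
    also have "\<dots> = (D - 1) * (1 - norm z)" by (simp add: D_def sum_distrib_right)
    also have "\<dots> \<le> D * (1 - norm z)" using z by (intro mult_right_mono) auto
    finally show ?thesis .
  qed
  moreover have "1 \<le> D" by (simp add: D_def sum_nonneg)
  ultimately show ?thesis using that by blast
qed

section \<open>Multipliers of weighted composition operators\<close>

context doubling_weight
begin

text \<open>The normalisation 1 / pi of the area measure does not affect finiteness, so all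
  estimates can use Lebesgue measure.\<close>

lemma bergman_iff:
  assumes "0 < p"
  shows "f \<in> bergman p \<omega> \<longleftrightarrow> f holomorphic_on ball 0 1 \<and> wnorm p \<omega> f < \<infinity>"
proof (cases "f holomorphic_on ball 0 1")
  case True
  have "(\<integral>\<^sup>+z\<in>ball 0 1. ennreal (norm (f z) powr p * \<omega> (norm z)) \<partial>dA) = ennreal (1 / pi) * wnorm p \<omega> f"
    unfolding dA_def wnorm_def using wnorm_measurable[OF True assms] by (intro nn_integral_scale_measure) simp
  then show ?thesis using True by (auto simp: bergman_def H_disk_def ennreal_mult_less_top)
qed (simp add: bergman_def H_disk_def)

lemma wnorm_mono_mult:
  assumes f: "f holomorphic_on ball 0 1" and p: "0 < p" and B: "0 \<le> B"
    and le: "\<And>z. norm z < 1 \<Longrightarrow> norm (g z) \<le> B * norm (f z)"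
  shows "wnorm p \<omega> g \<le> ennreal (B powr p) * wnorm p \<omega> f"
proof -
  have "wnorm p \<omega> g \<le> (\<integral>\<^sup>+z. ennreal (B powr p) * (ennreal (norm (f z) powr p * \<omega> (norm z)) * indicator (ball 0 1) z) \<partial>lborel)"
    unfolding wnorm_def
  proof (rule nn_integral_mono)
    fix z :: complex
    show "ennreal (norm (g z) powr p * \<omega> (norm z)) * indicator (ball 0 1) z
       \<le> ennreal (B powr p) * (ennreal (norm (f z) powr p * \<omega> (norm z)) * indicator (ball 0 1) z)"
    proof (cases "norm z < 1")
      case True
      have "norm (g z) powr p \<le> (B * norm (f z)) powr p"
        using le[OF True] p by (intro powr_mono2) auto
      also have "\<dots> = B powr p * norm (f z) powr p" by (rule powr_mult)
      finally have "norm (g z) powr p * \<omega> (norm z) \<le> B powr p * norm (f z) powr p * \<omega> (norm z)"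
        using weight_nonneg[of "norm z"] True by (intro mult_right_mono) auto
      then show ?thesis using True by (simp add: ennreal_mult'[symmetric] ennreal_leI mult.assoc)
    qed simp
  qed
  also have "\<dots> = ennreal (B powr p) * wnorm p \<omega> f"
    unfolding wnorm_def using wnorm_measurable[OF f p] by (intro nn_integral_cmult) simp
  finally show ?thesis .
qed

text \<open>The radial estimate at s = 1, where the minimum is 1. Constants thus belong to the
  space, and so does every multiplier u, being the image of 1.\<close>

lemma wnorm_one_finite: "wnorm p \<omega> (\<lambda>z. 1) < \<infinity>"
proof -
  have "wnorm p \<omega> (\<lambda>z. 1) = (\<integral>\<^sup>+z\<in>ball (0::complex) 1. ennreal (\<omega> (norm z) * min 1 (1 / (1 - norm z)) powr (K + 2)) \<partial>lborel)"
    unfolding wnorm_def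
  proof (rule nn_integral_cong)
    fix z :: complex
    have "min 1 (1 / (1 - norm z)) = 1" if "norm z < 1"
      using that by (intro min_absorb1) simp
    then show "ennreal (norm (1::complex) powr p * \<omega> (norm z)) * indicator (ball 0 1) z =
       ennreal (\<omega> (norm z) * min 1 (1 / (1 - norm z)) powr (K + 2)) * indicator (ball 0 1) z"
      by (auto simp: indicator_def)
  qed
  also have "\<dots> \<le> ennreal (C\<^sub>0 * 1 * \<omega> (1 - 1))"
    by (rule radial_integral_le) auto
  also have "\<dots> < \<infinity>" by simp
  finally show ?thesis .
qed

text \<open>The density V = 1; the circle mean of the harmonic function is its value at the centre,
  at most 2 / (1 - |\<phi> 0|).\<close>

lemma composition_bounded:
  assumes p: "1 < p" and hol: "\<phi> holomorphic_on ball 0 1" and self: "\<And>z. norm z < 1 \<Longrightarrow> norm (\<phi> z) < 1"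
  obtains C where "0 \<le> C" "\<And>f. f holomorphic_on ball 0 1 \<Longrightarrow> wnorm p \<omega> (\<lambda>z. f (\<phi> z)) \<le> ennreal C * wnorm p \<omega> f"
proof -
  obtain c where c: "0 < c" "c \<le> 1" "\<And>z. norm z < 1 \<Longrightarrow> c * (1 - norm z) \<le> 1 - norm (\<phi> z)"
    using self_map_boundary_distance[OF hol self] by blast
  define C where "C = 18 * 5 powr (K + 4) / pi * (2 / c) powr (K + 2) * C\<^sub>0 * (2 / (1 - norm (\<phi> 0)))"
  have Q: "0 \<le> 2 / (1 - norm (\<phi> 0))" using self[of 0] by simp
  have "wnorm p \<omega> (\<lambda>z. f (\<phi> z)) \<le> ennreal C * wnorm p \<omega> f" if f: "f holomorphic_on ball 0 1" for f
    using composition_integral_le[OF p f holomorphic_on_imp_continuous_on[OF hol] _ c, of "\<lambda>_. 1" "2 / (1 - norm (\<phi> 0))"]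
      cayley_mean_le[OF hol self] self Q
    by (simp add: wnorm_def C_def image_subset_iff)
  moreover have "0 \<le> C" using C0_pos c Q by (simp add: C_def)
  ultimately show ?thesis using that by blast
qed

text \<open>The density is the p-th power of the peak. C depends neither on z0 nor on f, so one
  sparse sequence of peaks can serve all f; f = 1 bounds the norms of the peaks themselves.\<close>

lemma peak_composition_small:
  assumes p: "1 < p" and hol: "\<phi> holomorphic_on ball 0 1" and self: "\<And>z. norm z < 1 \<Longrightarrow> norm (\<phi> z) < 1"
    and \<delta>: "0 < \<delta>"
  obtains C where "0 \<le> C" "\<And>f z0. f holomorphic_on ball 0 1 \<Longrightarrow> norm z0 < 1 \<Longrightarrow> norm (\<phi> z0) \<le> 1 - \<delta> \<Longrightarrow>
    wnorm p \<omega> (\<lambda>z. peak p z0 z * f (\<phi> z)) \<le> ennreal (C * (1 - (norm z0)\<^sup>2) powr (1/2)) * wnorm p \<omega> f"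
proof -
  obtain c where c: "0 < c" "c \<le> 1" "\<And>z. norm z < 1 \<Longrightarrow> c * (1 - norm z) \<le> 1 - norm (\<phi> z)"
    using self_map_boundary_distance[OF hol self] by blast
  define C where "C = 18 * 5 powr (K + 4) / pi * (2 / c) powr (K + 2) * C\<^sub>0 * (4 powr p / \<delta>\<^sup>2)"
  have "wnorm p \<omega> (\<lambda>z. peak p z0 z * f (\<phi> z)) \<le> ennreal (C * (1 - (norm z0)\<^sup>2) powr (1/2)) * wnorm p \<omega> f"
    if f: "f holomorphic_on ball 0 1" and z0: "norm z0 < 1" "norm (\<phi> z0) \<le> 1 - \<delta>" for f z0
  proof -
    have "wnorm p \<omega> (\<lambda>z. peak p z0 z * f (\<phi> z)) = (\<integral>\<^sup>+z\<in>ball 0 1. ennreal (norm (f (\<phi> z)) powr p * norm (peak p z0 z) powr p * \<omega> (norm z)) \<partial>lborel)"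
      by (simp add: wnorm_def norm_mult powr_mult mult_ac)
    also have "\<dots> \<le> ennreal (18 * 5 powr (K + 4) / pi * (2 / c) powr (K + 2) * C\<^sub>0 * (4 powr p / \<delta>\<^sup>2 * (1 - (norm z0)\<^sup>2) powr (1/2))) * wnorm p \<omega> f"
    proof (rule composition_integral_le[OF p f holomorphic_on_imp_continuous_on[OF hol] _ c])
      show "continuous_on (ball 0 1) (\<lambda>z. norm (peak p z0 z) powr p)"
        using p z0 by (intro continuous_on_norm_powr holomorphic_on_imp_continuous_on holomorphic_on_peak) auto
    qed (use self peak_mean_le[OF hol self _ _ z0(1) \<delta> z0(2) p] in \<open>auto simp: image_subset_iff\<close>)
    finally show ?thesis by (simp add: C_def mult.assoc)
  qed
  moreover have "0 \<le> C" using C0_pos c by (simp add: C_def)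
  ultimately show ?thesis using that by blast
qed

text \<open>Powers of the kernel with value 1 at a. The norm bound is
  \<open>kernel_integral_le\<close> for the identity map with V = 1, c = 1 and Q = 2.\<close>

lemma test_functions:
  assumes p: "1 < p"
  obtains C and h :: "complex \<Rightarrow> complex \<Rightarrow> complex" where "0 \<le> C"
    "\<And>a. norm a < 1 \<Longrightarrow> h a holomorphic_on ball 0 1"
    "\<And>a. norm a < 1 \<Longrightarrow> wnorm p \<omega> (h a) \<le> ennreal (C * (\<omega> (norm a) * (1 - norm a)\<^sup>2))"
    "\<And>a. norm a < 1 \<Longrightarrow> h a a = 1"
    "\<And>a. norm a < 1 \<Longrightarrow> \<exists>B. \<forall>z. norm z < 1 \<longrightarrow> norm (h a z) \<le> B"
proof -
  \<comment> \<open>A natural exponent keeps the powers analytic; K + 4 is large enough for N * p -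
    2 >= K + 2.\<close>
  define N where "N = nat \<lceil>K + 4\<rceil>"
  have N: "K + 4 \<le> real N" using K by (simp add: N_def)
  define M where "M = real N * p - 2"
  have "real N * 1 \<le> real N * p" using p by (intro mult_left_mono) auto
  then have M: "K + 2 \<le> M" using N by (simp add: M_def)
  define h :: "complex \<Rightarrow> complex \<Rightarrow> complex" where "h = (\<lambda>a z. ((1 - of_real ((norm a)\<^sup>2)) / (1 - cnj a * z)) ^ N)"
  define C where "C = 2 * (2 / 1) powr M * C\<^sub>0 * 2"
  have nh: "norm (h a z) = bkernel a z ^ N" if a: "norm a < 1" for a z
  proof -
    have "norm (1 - complex_of_real ((norm a)\<^sup>2)) = 1 - (norm a)\<^sup>2"
      using a by (metis abs_of_nonneg diff_ge_0_iff_ge less_imp_le norm_ge_zero norm_of_real of_real_1 of_real_diff power_le_one)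
    then show ?thesis by (simp add: h_def norm_power norm_divide bkernel_def)
  qed
  have 1: "0 \<le> C" using C0_pos by (simp add: C_def)
  have 2: "h a holomorphic_on ball 0 1" if a: "norm a < 1" for a
    unfolding h_def using one_minus_cnj_mult_nonzero[OF a] by (intro holomorphic_intros) auto
  have 3: "wnorm p \<omega> (h a) \<le> ennreal (C * (\<omega> (norm a) * (1 - norm a)\<^sup>2))" if a: "norm a < 1" for a
  proof -
    have nz: "0 < bkernel a z" if z: "norm z < 1" for z
      using one_minus_cnj_mult_nonzero[OF a z] a by (auto simp: bkernel_def abs_square_less_1)
    have "wnorm p \<omega> (h a) = (\<integral>\<^sup>+z\<in>ball 0 1. ennreal (bkernel a z powr (M + 2) * 1 * \<omega> (norm z)) \<partial>lborel)"
      unfolding wnorm_def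
    proof (rule nn_integral_cong)
      fix z :: complex
      have "(bkernel a z ^ N) powr p = bkernel a z powr (M + 2)" if "norm z < 1"
        using nz[OF that] by (simp add: powr_realpow[symmetric] powr_powr M_def)
      then show "ennreal (norm (h a z) powr p * \<omega> (norm z)) * indicator (ball 0 1) z =
         ennreal (bkernel a z powr (M + 2) * 1 * \<omega> (norm z)) * indicator (ball 0 1) z"
        by (auto simp: indicator_def nh[OF a])
    qed
    also have "\<dots> \<le> ennreal (2 * (2 / 1) powr M * C\<^sub>0 * 2 * ((1 - norm a)\<^sup>2 * \<omega> (norm a)))"
    proof (rule kernel_integral_le)
      show "(\<integral>\<^sup>+t\<in>{0..2*pi}. ennreal (Re (cayley a (cis t * z)) * 1) \<partial>lborel) \<le> ennreal (2 * pi * 2)" if "norm z < 1" for z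
        using cayley_mean_le[of "\<lambda>z. z", OF _ _ a that] by simp
    qed (use M a in auto)
    finally show ?thesis by (simp add: C_def mult_ac)
  qed
  have 4: "h a a = 1" if a: "norm a < 1" for a
  proof -
    have "cnj a * a = of_real ((norm a)\<^sup>2)" by (metis complex_norm_square mult.commute of_real_power)
    then show ?thesis using one_minus_cnj_mult_nonzero[OF a a] by (simp add: h_def)
  qed
  have 5: "\<exists>B. \<forall>z. norm z < 1 \<longrightarrow> norm (h a z) \<le> B" if a: "norm a < 1" for a
    using bkernel_bounds(1)[OF a] bkernel_nonneg[OF a] by (intro exI[of _ "2 ^ N"]) (auto simp: nh[OF a] intro!: power_mono)
  show ?thesis by (rule that[of C h]) (rule 1 2 3 4 5; assumption)+
qed

text \<open>The product of the weight and the squared distance at \<phi> z is at most a constant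
  multiple of that at z, so point evaluation at z can be stated with the factor belonging to \<phi>
  z.\<close>

lemma composed_point_evaluation:
  fixes h \<phi> :: "complex \<Rightarrow> complex"
  assumes p: "1 < p" and h: "h holomorphic_on ball 0 1" "wnorm p \<omega> h < \<infinity>"
    and D: "1 \<le> D" and self: "\<And>z. norm z < 1 \<Longrightarrow> norm (\<phi> z) < 1"
    and \<phi>: "\<And>z. norm z < 1 \<Longrightarrow> 1 - norm (\<phi> z) \<le> D * (1 - norm z)"
  obtains B where "\<And>z. norm z < 1 \<Longrightarrow> norm (h z) * (\<omega> (norm (\<phi> z)) * (1 - norm (\<phi> z))\<^sup>2) powr (1/p) \<le> B"
proof -
  define W where "W = (\<lambda>z::complex. \<omega> (norm z) * (1 - norm z)\<^sup>2)"
  define A where "A = 4 * 2 powr (K + 1) / pi * enn2real (wnorm p \<omega> h)"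
  have W0: "0 \<le> W z" if "norm z < 1" for z using that weight_nonneg by (simp add: W_def)
  have pe: "norm (h z) powr p * W z \<le> A" if z: "norm z < 1" for z
  proof -
    have "ennreal (norm (h z) powr p * W z) \<le> ennreal (4 * 2 powr (K + 1) / pi) * wnorm p \<omega> h"
      unfolding W_def by (rule point_evaluation[OF h(1) p z])
    also have "wnorm p \<omega> h = ennreal (enn2real (wnorm p \<omega> h))" using h(2) by (simp add: less_top)
    finally have "ennreal (norm (h z) powr p * W z) \<le> ennreal A"
      unfolding A_def by (subst ennreal_mult') auto
    then show ?thesis by (subst (asm) ennreal_le_iff) (auto simp: A_def)
  qed
  have WW: "W (\<phi> z) \<le> D powr (K + 2) * W z" if z: "norm z < 1" for z
  proof -
    define t where "t = (1 - norm (\<phi> z)) / (1 - norm z)"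
    have t: "0 < t" "t \<le> D" using self[OF z] z \<phi>[OF z] by (auto simp: t_def divide_le_eq)
    have sq: "(1 - norm (\<phi> z))\<^sup>2 = t powr 2 * (1 - norm z)\<^sup>2" using z t by (simp add: t_def power_divide)
    \<comment> \<open>If \<phi> z is closer to the circle than z, the weight may grow like
      \<open>t powr (- \<kappa>)\<close>, but the squared distance contributes
      \<open>t powr 2\<close> and \<kappa> < 1. Otherwise the exponent is K and t <= D is
      used.\<close>
    have "\<exists>e. t powr (e + 2) \<le> D powr (K + 2) \<and> \<omega> (norm (\<phi> z)) \<le> t powr e * \<omega> (norm z)"
    proof (cases "norm z \<le> norm (\<phi> z)")
      case True
      then have "t \<le> 1" using z by (simp add: t_def)
      then have "t powr (- \<kappa> + 2) \<le> 1 powr (- \<kappa> + 2)" using t \<kappa> by (intro powr_mono2) auto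
      also have "\<dots> \<le> D powr (K + 2)" using D K by (simp add: ge_one_powr_ge_zero)
      finally show ?thesis using weight_upper[of "norm z" "norm (\<phi> z)"] True self[OF z]
        by (intro exI[of _ "- \<kappa>"]) (simp add: t_def)
    next
      case False
      have "t powr (K + 2) \<le> D powr (K + 2)" using t K by (intro powr_mono2) auto
      then show ?thesis using weight_lower[of "norm (\<phi> z)" "norm z"] False z
        by (intro exI[of _ K]) (simp add: t_def)
    qed
    then obtain e where e: "t powr (e + 2) \<le> D powr (K + 2)" "\<omega> (norm (\<phi> z)) \<le> t powr e * \<omega> (norm z)" by blast
    have "W (\<phi> z) \<le> (t powr e * \<omega> (norm z)) * (t powr 2 * (1 - norm z)\<^sup>2)"
      unfolding W_def sq by (intro mult_right_mono e) auto
    also have "\<dots> = t powr (e + 2) * W z" by (simp add: W_def powr_add mult_ac)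
    also have "\<dots> \<le> D powr (K + 2) * W z" by (intro mult_right_mono e W0 z)
    finally show ?thesis .
  qed
  have "norm (h z) * W (\<phi> z) powr (1/p) \<le> (D powr (K + 2) * A) powr (1/p)" if z: "norm z < 1" for z
  proof -
    have "norm (h z) powr p * W (\<phi> z) \<le> norm (h z) powr p * (D powr (K + 2) * W z)"
      by (intro mult_left_mono WW z) auto
    also have "\<dots> = D powr (K + 2) * (norm (h z) powr p * W z)" by simp
    also have "\<dots> \<le> D powr (K + 2) * A" by (intro mult_left_mono pe z) auto
    finally have "(norm (h z) powr p * W (\<phi> z)) powr (1/p) \<le> (D powr (K + 2) * A) powr (1/p)"
      using p W0[OF self[OF z]] by (intro powr_mono2) auto
    moreover have "(norm (h z) powr p * W (\<phi> z)) powr (1/p) = (norm (h z) powr p) powr (1/p) * W (\<phi> z) powr (1/p)"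
      by (rule powr_mult)
    ultimately show ?thesis using p by (simp add: powr_powr)
  qed
  then show ?thesis using that unfolding W_def by blast
qed

theorem weighted_composition_multipliers:
  assumes p: "1 < p" and hol: "\<phi> holomorphic_on ball 0 1" and self: "\<phi> ` ball 0 1 \<subseteq> ball 0 1"
  shows "{u \<in> H_disk. weighted_comp u \<phi> ` bergman p \<omega> \<subseteq> bergman p \<omega>} = H_infinity
         \<longleftrightarrow> finite_Blaschke_product \<phi>" (is "?X = _ \<longleftrightarrow> _")
proof -
  have s: "norm (\<phi> z) < 1" if "norm z < 1" for z using self that by (simp add: image_subset_iff)
  have p0: "0 < p" using p by simp
  have comp: "(\<lambda>z. f (\<phi> z)) holomorphic_on ball 0 1" if "f holomorphic_on ball 0 1" for f
    using holomorphic_on_compose_gen[OF hol that self] by (simp add: o_def)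
  have sub: "H_infinity \<subseteq> ?X"
  proof
    fix u assume u: "u \<in> H_infinity"
    then have uh: "u holomorphic_on ball 0 1" by (simp add: H_infinity_def H_disk_def)
    obtain B where B: "0 < B" "\<And>z. norm z < 1 \<Longrightarrow> norm (u z) \<le> B"
      using u by (auto simp: H_infinity_def bounded_pos)
    obtain C where C: "\<And>f. f holomorphic_on ball 0 1 \<Longrightarrow> wnorm p \<omega> (\<lambda>z. f (\<phi> z)) \<le> ennreal C * wnorm p \<omega> f"
      using composition_bounded[OF p hol s] by blast
    have "weighted_comp u \<phi> f \<in> bergman p \<omega>" if "f \<in> bergman p \<omega>" for f
    proof -
      have f: "f holomorphic_on ball 0 1" "wnorm p \<omega> f < \<infinity>" using that by (auto simp: bergman_iff[OF p0])
      have "wnorm p \<omega> (weighted_comp u \<phi> f) \<le> ennreal (B powr p) * wnorm p \<omega> (\<lambda>z. f (\<phi> z))"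
        using B by (intro wnorm_mono_mult comp f p0) (auto simp: weighted_comp_def norm_mult mult_right_mono)
      also have "\<dots> \<le> ennreal (B powr p) * (ennreal C * wnorm p \<omega> f)" by (intro mult_left_mono C f) auto
      also have "\<dots> < \<infinity>" using f(2) by (simp add: ennreal_mult_less_top)
      finally show ?thesis
        unfolding bergman_iff[OF p0] weighted_comp_def by (auto intro!: holomorphic_intros uh comp f)
    qed
    then show "u \<in> ?X" using u by (auto simp: H_infinity_def)
  qed
  have "?X \<subseteq> H_infinity" if fb: "finite_Blaschke_product \<phi>"
  proof
    fix u assume "u \<in> ?X"
    then have uh: "u holomorphic_on ball 0 1" and uX: "\<And>f. f \<in> bergman p \<omega> \<Longrightarrow> weighted_comp u \<phi> f \<in> bergman p \<omega>"
      by (auto simp: H_disk_def)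
    obtain D where D: "1 \<le> D" "\<And>z. norm z < 1 \<Longrightarrow> 1 - norm (\<phi> z) \<le> D * (1 - norm z)"
      using finite_Blaschke_product_boundary_distance[OF fb] by blast
    show "u \<in> H_infinity"
    proof (rule ccontr)
      assume "u \<notin> H_infinity"
      then have nb: "\<not> bounded (u ` ball 0 1)" using uh by (simp add: H_infinity_def H_disk_def)
      have "\<exists>z. norm z < 1 \<and> real (n + 1) \<le> norm (u z)" for n
      proof (rule ccontr)
        assume "\<not> ?thesis"
        then have "norm (u z) \<le> real (n + 1)" if "norm z < 1" for z
          using that by (meson less_imp_le not_le)
        then have "bounded (u ` ball 0 1)" by (intro boundedI[of _ "real (n + 1)"]) auto
        then show False using nb by contradiction
      qed
      then obtain z where z: "\<And>n. norm (z n) < 1" "\<And>n. real (n + 1) \<le> norm (u (z n))" by metis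
      define W where "W = (\<lambda>n. \<omega> (norm (\<phi> (z n))) * (1 - norm (\<phi> (z n)))\<^sup>2)"
      have Wpos: "0 < W n" for n using s[OF z(1)[of n]] weight_pos[of "norm (\<phi> (z n))"] by (simp add: W_def)
      define \<mu> where "\<mu> = (\<lambda>n. norm (u (z n)))"
      have \<mu>: "real (n + 1) \<le> \<mu> n" "0 < \<mu> n" for n using z(2)[of n] by (auto simp: \<mu>_def)
      obtain C h where C: "0 \<le> C" and h: "\<And>a. norm a < 1 \<Longrightarrow> h a holomorphic_on ball 0 1"
        "\<And>a. norm a < 1 \<Longrightarrow> wnorm p \<omega> (h a) \<le> ennreal (C * (\<omega> (norm a) * (1 - norm a)\<^sup>2))"
        "\<And>a. norm a < 1 \<Longrightarrow> h a a = 1"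
        "\<And>a. norm a < 1 \<Longrightarrow> \<exists>B. \<forall>z. norm z < 1 \<longrightarrow> norm (h a z) \<le> B"
        using test_functions[OF p] by metis
      \<comment> \<open>The power of W normalises the kernel at \<phi> (z n). The growth of \<mu> is
        split evenly: the norms tend to 0 like \<open>\<mu> n powr (- 1/2)\<close>, and the values
        of the images at z n still grow like \<open>\<mu> n powr (1/2)\<close> on the scale of
        W.\<close>
      define c where "c = (\<lambda>n. \<mu> n powr (- 1/2) * W n powr (- 1/p))"
      have c0: "0 \<le> c n" for n by (simp add: c_def)
      define g where "g = (\<lambda>n w. of_real (c n) * h (\<phi> (z n)) w)"
      have gh: "g n holomorphic_on ball 0 1" for n
        unfolding g_def by (intro holomorphic_intros h s z)
      define b where "b = (\<lambda>n. C * real (n + 1) powr (- p / 2))"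
      have gn: "wnorm p \<omega> (g n) \<le> ennreal (b n)" for n
      proof -
        have "wnorm p \<omega> (g n) \<le> ennreal (c n powr p) * wnorm p \<omega> (h (\<phi> (z n)))"
          by (intro wnorm_mono_mult h s z p0 c0) (simp add: g_def norm_mult c0)
        also have "\<dots> \<le> ennreal (c n powr p) * ennreal (C * W n)"
          unfolding W_def by (intro mult_left_mono h s z) auto
        also have "\<dots> = ennreal (c n powr p * (C * W n))" by (simp add: ennreal_mult')
        also have "c n powr p * (C * W n) = C * \<mu> n powr (- p / 2)"
        proof -
          have "c n powr p = (\<mu> n powr (- 1/2)) powr p * (W n powr (- 1/p)) powr p"
            unfolding c_def by (rule powr_mult)
          also have "\<dots> = \<mu> n powr (- p / 2) * W n powr (- 1)"
            using p unfolding powr_powr by simp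
          finally show ?thesis using Wpos[of n] by (simp add: powr_minus)
        qed
        also have "\<dots> \<le> b n" unfolding b_def using \<mu>[of n] C p by (intro mult_left_mono powr_mono2') auto
        finally show ?thesis by (simp add: ennreal_leI)
      qed
      have "(\<lambda>n. real (n + 1) powr (- p / 2)) \<longlonglongrightarrow> 0"
        using p by (intro tendsto_neg_powr filterlim_compose[OF filterlim_real_sequentially]) (auto simp: filterlim_Suc)
      then have b0: "b \<longlonglongrightarrow> 0" unfolding b_def by (rule tendsto_mult_right_zero)
      \<comment> \<open>The scale \<open>W n powr (1/p)\<close> is the one at which functions of the
        space stay bounded at z n, by \<open>composed_point_evaluation\<close>.\<close>
      define \<Lambda> where "\<Lambda> = (\<lambda>n. u (z n) * of_real (W n powr (1/p)))"
      have "weighted_comp u \<phi> (\<lambda>z. 1) \<in> bergman p \<omega>"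
        by (rule uX) (use wnorm_one_finite[of p] in \<open>simp add: bergman_iff[OF p0]\<close>)
      then have "wnorm p \<omega> u < \<infinity>" by (simp add: bergman_iff[OF p0] weighted_comp_def)
      then obtain B where B: "\<And>x. norm x < 1 \<Longrightarrow> norm (u x) * (\<omega> (norm (\<phi> x)) * (1 - norm (\<phi> x))\<^sup>2) powr (1/p) \<le> B"
        using composed_point_evaluation[OF p uh _ D(1) s D(2)] by blast
      have \<Lambda>B: "norm (\<Lambda> m) \<le> B" for m using B[OF z(1)[of m]] by (simp add: \<Lambda>_def W_def norm_mult)
      have row: "\<exists>B. \<forall>m. norm (\<Lambda> m * g n (\<phi> (z m))) \<le> B" for n
      proof -
        obtain B' where B': "\<And>w. norm w < 1 \<Longrightarrow> norm (h (\<phi> (z n)) w) \<le> B'" using h(4)[OF s[OF z(1)]] by blast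
        have "norm (\<Lambda> m * g n (\<phi> (z m))) \<le> B * (c n * B')" for m
          unfolding norm_mult g_def using c0[of n] B'[OF s[OF z(1)]] order_trans[OF norm_ge_zero \<Lambda>B]
          by (intro mult_mono \<Lambda>B) (auto intro!: mult_left_mono)
        then show ?thesis by blast
      qed
      have diag: "filterlim (\<lambda>n. norm (\<Lambda> n * g n (\<phi> (z n)))) at_top sequentially"
      proof (rule filterlim_at_top_mono)
        show "filterlim (\<lambda>n. real (n + 1) powr (1/2)) at_top sequentially"
        proof -
          have "filterlim (\<lambda>n. sqrt (real (Suc n))) at_top sequentially"
            by (intro filterlim_compose[OF sqrt_at_top] filterlim_compose[OF filterlim_real_sequentially] filterlim_Suc)
          then show ?thesis by (simp add: powr_half_sqrt)
        qed
        have "real (n + 1) powr (1/2) \<le> norm (\<Lambda> n * g n (\<phi> (z n)))" for n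
        proof -
          have "norm (\<Lambda> n * g n (\<phi> (z n))) = \<mu> n * W n powr (1/p) * c n"
            using c0[of n] by (simp add: \<Lambda>_def g_def norm_mult h(3)[OF s[OF z(1)]] \<mu>_def)
          also have "\<dots> = \<mu> n * \<mu> n powr (- 1/2)"
            using Wpos[of n] by (simp add: c_def powr_minus field_simps)
          also have "\<dots> = \<mu> n powr (1/2)" using powr_mult_base[of "\<mu> n" "- 1/2"] \<mu>(2)[of n] by simp
          also have "\<dots> \<ge> real (n + 1) powr (1/2)" using \<mu>(1)[of n] by (intro powr_mono2) auto
          finally show ?thesis .
        qed
        then show "\<forall>\<^sub>F n in sequentially. real (n + 1) powr (1/2) \<le> norm (\<Lambda> n * g n (\<phi> (z n)))" by simp
      qed
      obtain r where r: "\<And>k. wnorm p \<omega> (g (r k)) \<le> ennreal (1 * (4 ^ k) powr (- p))"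
        "\<And>k. real k \<le> norm (\<Lambda> (r k) * (\<Sum>j. g (r j) (\<phi> (z (r k)))))"
        by (rule bergman_gliding_hump[OF gh p gn b0 s[OF z(1)] row diag]) blast
      define F where "F = (\<lambda>w. \<Sum>j. g (r j) w)"
      have "F holomorphic_on ball 0 1" "wnorm p \<omega> F < \<infinity>"
        unfolding F_def using bergman_series(2,3)[of "\<lambda>j. g (r j)", OF gh p _ r(1)] by auto
      then have "weighted_comp u \<phi> F \<in> bergman p \<omega>" by (intro uX) (simp add: bergman_iff[OF p0])
      then have "weighted_comp u \<phi> F holomorphic_on ball 0 1" "wnorm p \<omega> (weighted_comp u \<phi> F) < \<infinity>"
        by (auto simp: bergman_iff[OF p0])
      then obtain B2 where B2: "\<And>x. norm x < 1 \<Longrightarrow> norm (weighted_comp u \<phi> F x) * (\<omega> (norm (\<phi> x)) * (1 - norm (\<phi> x))\<^sup>2) powr (1/p) \<le> B2"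
        using composed_point_evaluation[OF p _ _ D(1) s D(2)] by blast
      \<comment> \<open>At the selected points the image of F exceeds k on the scale of W, although
        it lies in the space.\<close>
      have "real k \<le> B2" for k
        using r(2)[of k] B2[OF z(1)[of "r k"]] by (simp add: \<Lambda>_def W_def F_def weighted_comp_def norm_mult mult_ac)
      then show False using reals_Archimedean2[of B2] by (meson not_le)
    qed
  qed
  moreover have False if nb: "\<not> finite_Blaschke_product \<phi>" and X: "?X = H_infinity"
  proof -
    obtain \<delta> z where \<delta>: "0 < \<delta>" and z: "\<And>n::nat. norm (z n) < 1" "\<And>n. norm (\<phi> (z n)) \<le> 1 - \<delta>"
      "(\<lambda>n. norm (z n)) \<longlonglongrightarrow> 1"
      using not_finite_Blaschke_product_sequence[OF hol s nb] by blast
    obtain C where C: "0 \<le> C" "\<And>f z0. f holomorphic_on ball 0 1 \<Longrightarrow> norm z0 < 1 \<Longrightarrow> norm (\<phi> z0) \<le> 1 - \<delta> \<Longrightarrow>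
      wnorm p \<omega> (\<lambda>z. peak p z0 z * f (\<phi> z)) \<le> ennreal (C * (1 - (norm z0)\<^sup>2) powr (1/2)) * wnorm p \<omega> f"
      using peak_composition_small[OF p hol s \<delta>] by blast
    define y where "y = (\<lambda>n. 1 - (norm (z n))\<^sup>2)"
    have y: "0 < y n" for n using z(1)[of n] by (simp add: y_def abs_square_less_1)
    have "y \<longlonglongrightarrow> 1 - 1\<^sup>2" unfolding y_def by (intro tendsto_intros z)
    then have y0: "y \<longlonglongrightarrow> 0" by simp
    define g where "g = (\<lambda>n. peak p (z n))"
    have gh: "g n holomorphic_on ball 0 1" for n unfolding g_def by (rule holomorphic_on_peak[OF z(1)])
    have bound: "wnorm p \<omega> (\<lambda>x. g n x * f (\<phi> x)) \<le> ennreal (C * enn2real (wnorm p \<omega> f) * y n powr (1/2))"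
      if f: "f holomorphic_on ball 0 1" "wnorm p \<omega> f < \<infinity>" for f n
    proof -
      have "wnorm p \<omega> (\<lambda>x. g n x * f (\<phi> x)) \<le> ennreal (C * y n powr (1/2)) * wnorm p \<omega> f"
        unfolding g_def y_def by (rule C(2)[OF f(1) z(1,2)])
      also have "wnorm p \<omega> f = ennreal (enn2real (wnorm p \<omega> f))" using f(2) by (simp add: less_top)
      also have "ennreal (C * y n powr (1/2)) * \<dots> = ennreal (C * enn2real (wnorm p \<omega> f) * y n powr (1/2))"
        using C(1) by (simp add: ennreal_mult[symmetric] mult_ac)
      finally show ?thesis .
    qed
    \<comment> \<open>The added 1 gives A >= 1, so that a bound on b also bounds
      \<open>y n powr (1/2)\<close>, which governs the products with arbitrary f.\<close>
    define A where "A = C * enn2real (wnorm p \<omega> (\<lambda>z. 1)) + 1"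
    have A: "1 \<le> A" using C(1) by (simp add: A_def)
    define b where "b = (\<lambda>n. A * y n powr (1/2))"
    have gn: "wnorm p \<omega> (g n) \<le> ennreal (b n)" for n
    proof -
      have "wnorm p \<omega> (g n) \<le> ennreal (C * enn2real (wnorm p \<omega> (\<lambda>z. 1)) * y n powr (1/2))"
        using bound[of "\<lambda>z. 1" n] wnorm_one_finite by simp
      also have "\<dots> \<le> ennreal (b n)" unfolding b_def A_def by (intro ennreal_leI mult_right_mono) auto
      finally show ?thesis .
    qed
    have "(\<lambda>n. y n powr (1/2)) \<longlonglongrightarrow> 0 powr (1/2)"
      by (intro tendsto_powr' y0 tendsto_const) (use y in \<open>auto intro!: always_eventually less_imp_le\<close>)
    then have b0: "b \<longlonglongrightarrow> 0" unfolding b_def by (intro tendsto_mult_right_zero) simp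
    have ng: "norm (g n x) = y n powr (- 1 / (2 * p)) * (bkernel (z n) x)\<^sup>2" for n x
      unfolding g_def y_def by (rule norm_peak[OF z(1)])
    have row: "\<exists>B. \<forall>m. norm (1 * g n (z m)) \<le> B" for n
    proof -
      have "norm (1 * g n (z m)) \<le> y n powr (- 1 / (2 * p)) * 2\<^sup>2" for m
        unfolding mult_1 ng by (intro mult_left_mono power_mono bkernel_bounds bkernel_nonneg z) auto
      then show ?thesis by blast
    qed
    have diag: "filterlim (\<lambda>n. norm (1 * g n (z n))) at_top sequentially"
    proof -
      \<comment> \<open>The kernel equals 1 at its own point, so the peak there is a negative power
        of y n, and y n tends to 0.\<close>
      have "cnj a * a = of_real ((norm a)\<^sup>2)" for a by (metis complex_norm_square mult.commute of_real_power)
      moreover have "norm (1 - complex_of_real ((norm (z n))\<^sup>2)) = y n" for n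
        using y[of n] unfolding y_def by (metis abs_of_pos norm_of_real of_real_1 of_real_diff)
      ultimately have "bkernel (z n) (z n) = 1" for n using y[of n] by (simp add: bkernel_def y_def)
      then have "norm (1 * g n (z n)) = inverse (y n powr (1 / (2 * p)))" for n
        by (simp add: ng powr_minus)
      moreover have "filterlim (\<lambda>n. inverse (y n powr (1 / (2 * p)))) at_top sequentially"
      proof (rule filterlim_inverse_at_top)
        have "(\<lambda>n. y n powr (1 / (2 * p))) \<longlonglongrightarrow> 0 powr (1 / (2 * p))"
          by (intro tendsto_powr' y0 tendsto_const) (use y p in \<open>auto intro!: always_eventually less_imp_le\<close>)
        then show "(\<lambda>n. y n powr (1 / (2 * p))) \<longlonglongrightarrow> 0" by simp
        show "\<forall>\<^sub>F n in sequentially. 0 < y n powr (1 / (2 * p))" using y by (intro always_eventually allI) (simp add: less_le)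
      qed
      ultimately show ?thesis by simp
    qed
    obtain r where r: "\<And>k. b (r k) \<le> (4 ^ k) powr (- p)"
      "\<And>k. wnorm p \<omega> (g (r k)) \<le> ennreal (1 * (4 ^ k) powr (- p))"
      "\<And>k. real k \<le> norm (1 * (\<Sum>j. g (r j) (z (r k))))"
      by (rule bergman_gliding_hump[OF gh p gn b0 z(1) row diag]) blast
    define u where "u = (\<lambda>x. \<Sum>j. g (r j) x)"
    have uh: "u holomorphic_on ball 0 1" and usum: "\<And>x. norm x < 1 \<Longrightarrow> summable (\<lambda>j. norm (g (r j) x))"
      unfolding u_def using bergman_series(1,2)[of "\<lambda>j. g (r j)", OF gh p _ r(2)] by auto
    have "weighted_comp u \<phi> f \<in> bergman p \<omega>" if "f \<in> bergman p \<omega>" for f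
    proof -
      have f: "f holomorphic_on ball 0 1" "wnorm p \<omega> f < \<infinity>" using that by (auto simp: bergman_iff[OF p0])
      \<comment> \<open>The sequence r works for every f, because f enters the norm bounds of these
        terms only through a constant factor.\<close>
      define v where "v = (\<lambda>j x. g (r j) x * f (\<phi> x))"
      have vh: "v j holomorphic_on ball 0 1" for j unfolding v_def by (intro holomorphic_intros gh comp f)
      have vn: "wnorm p \<omega> (v j) \<le> ennreal (C * enn2real (wnorm p \<omega> f) * (4 ^ j) powr (- p))" for j
      proof -
        have "1 * y (r j) powr (1/2) \<le> A * y (r j) powr (1/2)" by (intro mult_right_mono A) auto
        then have "y (r j) powr (1/2) \<le> (4 ^ j) powr (- p)" using r(1)[of j] by (simp add: b_def)
        then have "C * enn2real (wnorm p \<omega> f) * y (r j) powr (1/2) \<le> C * enn2real (wnorm p \<omega> f) * (4 ^ j) powr (- p)"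
          using C(1) by (intro mult_left_mono) auto
        then show ?thesis unfolding v_def by (intro order_trans[OF bound[OF f]] ennreal_leI)
      qed
      have "wnorm p \<omega> (\<lambda>x. \<Sum>j. v j x) < \<infinity>"
        by (rule bergman_series(3)[OF vh p _ vn]) (use C(1) in simp)
      moreover have "wnorm p \<omega> (weighted_comp u \<phi> f) = wnorm p \<omega> (\<lambda>x. \<Sum>j. v j x)"
        unfolding wnorm_def
      proof (rule nn_integral_cong)
        fix x :: complex
        have "weighted_comp u \<phi> f x = (\<Sum>j. v j x)" if "norm x < 1"
          unfolding weighted_comp_def u_def v_def
          by (rule suminf_mult2[OF summable_norm_cancel[OF usum[OF that]]])
        then show "ennreal (norm (weighted_comp u \<phi> f x) powr p * \<omega> (norm x)) * indicator (ball 0 1) x =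
           ennreal (norm (\<Sum>j. v j x) powr p * \<omega> (norm x)) * indicator (ball 0 1) x"
          by (auto simp: indicator_def)
      qed
      moreover have "weighted_comp u \<phi> f holomorphic_on ball 0 1"
        unfolding weighted_comp_def by (intro holomorphic_intros uh comp f)
      ultimately show ?thesis by (simp add: bergman_iff[OF p0])
    qed
    then have "u \<in> ?X" using uh by (auto simp: H_disk_def)
    then have "u \<in> H_infinity" using X by simp
    then obtain B where "\<forall>x\<in>ball 0 1. norm (u x) \<le> B"
      by (auto simp: H_infinity_def bounded_iff)
    then have B: "norm (u x) \<le> B" if "norm x < 1" for x using that by simp
    have "real k \<le> B" for k using r(3)[of k] B[OF z(1)[of "r k"]] by (simp add: u_def)
    then show False using reals_Archimedean2[of B] by (meson not_le)
  qed
  ultimately show ?thesis using sub by blast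
qed

end

section \<open>The two families of weights\<close>

lemma log_weight_ge_1:
  assumes "0 \<le> r" "r < (1::real)"
  shows "1 \<le> ln (exp 1 / (1 - r))"
  using assms by (simp add: ln_div)

lemma log_weight_diff:
  assumes "r < (1::real)" "s < 1"
  shows "ln (exp 1 / (1 - s)) - ln (exp 1 / (1 - r)) = ln ((1 - r) / (1 - s))"
  using assms by (simp add: ln_div)

lemma log_weight_mono:
  assumes "r \<le> s" "s < (1::real)"
  shows "ln (exp 1 / (1 - r)) \<le> ln (exp 1 / (1 - s))"
  using assms by (simp add: ln_div)

text \<open>With t the ratio of distances and L >= 1 the logarithm at r, L + ln t <= L + (t - 1) <=
  t * L. A negative power of the logarithm is thereby compensated by a power of the
  distance.\<close>

lemma log_weight_le_mult:
  assumes "0 \<le> r" "r \<le> s" "s < (1::real)"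
  shows "ln (exp 1 / (1 - s)) \<le> (1 - r) / (1 - s) * ln (exp 1 / (1 - r))"
proof -
  define t where "t = (1 - r) / (1 - s)"
  define L where "L = ln (exp 1 / (1 - r))"
  have t: "1 \<le> t" using assms by (simp add: t_def field_simps)
  have L: "1 \<le> L" unfolding L_def using assms by (intro log_weight_ge_1) auto
  have "ln (exp 1 / (1 - s)) = L + ln t"
    using log_weight_diff[of r s] assms by (simp add: L_def t_def)
  also have "\<dots> \<le> L + (t - 1) * 1" using t ln_le_minus_one[of t] by simp
  also have "\<dots> \<le> L + (t - 1) * L" using t L by (intro add_left_mono mult_left_mono) auto
  finally show ?thesis by (simp add: t_def L_def algebra_simps)
qed

text \<open>As \<beta> <= 0, the logarithmic factor does not increase toward the circle, so only a
  negative \<alpha> contributes to the upper exponent. Its decay costs at most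
  \<open>t powr (- \<beta>)\<close> for the ratio t of distances, which adds -\<beta> to the lower
  exponent.\<close>

lemma doubling_weight_power_log:
  assumes \<alpha>: "-1 < \<alpha>" and \<beta>: "\<beta> \<le> 0"
    and \<omega>: "\<And>r. r \<in> {0..<1} \<Longrightarrow> \<omega> r = (1 - r) powr \<alpha> * ln (exp 1 / (1 - r)) powr \<beta>"
  shows "doubling_weight \<omega> (max 0 (- \<alpha>)) (max 0 (\<alpha> - \<beta>))"
proof
  define L where "L = (\<lambda>r::real. ln (exp 1 / (1 - r)))"
  have L1: "1 \<le> L r" if "0 \<le> r" "r < 1" for r unfolding L_def using that by (rule log_weight_ge_1)
  have wL: "\<omega> r = (1 - r) powr \<alpha> * L r powr \<beta>" if "0 \<le> r" "r < 1" for r using \<omega> that by (simp add: L_def)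
  show "0 < \<omega> r" if "0 \<le> r" "r < 1" for r using L1[OF that] that by (simp add: wL)
  have "continuous_on {0..<1} (\<lambda>r. (1 - r) powr \<alpha> * L r powr \<beta>)"
    unfolding L_def using L1 by (intro continuous_intros) (auto simp: L_def, fastforce)
  then show "continuous_on {0..<1} \<omega>" by (rule continuous_on_eq) (simp add: wL)
  show "0 \<le> max 0 (- \<alpha>)" "max 0 (- \<alpha>) < 1" "0 \<le> max 0 (\<alpha> - \<beta>)" using \<alpha> by auto
  fix r s :: real assume rs: "0 \<le> r" "r \<le> s" "s < 1"
  then have r1: "r < 1" and s0: "0 \<le> s" by auto
  show "\<omega> s \<le> ((1 - s) / (1 - r)) powr (- max 0 (- \<alpha>)) * \<omega> r"
  proof -
    define t where "t = (1 - s) / (1 - r)"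
    have t: "0 < t" "t \<le> 1" using rs by (auto simp: t_def)
    have "L s powr \<beta> \<le> L r powr \<beta>"
      using \<beta> L1[OF rs(1) r1] log_weight_mono[OF rs(2,3)] by (intro powr_mono2') (auto simp: L_def)
    moreover have "(1 - s) powr \<alpha> = t powr \<alpha> * (1 - r) powr \<alpha>"
      using rs by (simp add: t_def powr_mult[symmetric])
    moreover have "t powr \<alpha> \<le> t powr (- max 0 (- \<alpha>))" using t by (intro powr_mono') auto
    ultimately have "(1 - s) powr \<alpha> * L s powr \<beta> \<le> (t powr (- max 0 (- \<alpha>)) * (1 - r) powr \<alpha>) * L r powr \<beta>"
      by (intro mult_mono) (auto intro!: mult_right_mono)
    then show ?thesis by (simp add: wL rs r1 s0 t_def mult.assoc)
  qed
  show "\<omega> r \<le> ((1 - r) / (1 - s)) powr (max 0 (\<alpha> - \<beta>)) * \<omega> s"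
  proof -
    define t where "t = (1 - r) / (1 - s)"
    have t: "1 \<le> t" using rs by (simp add: t_def)
    have "L s / t \<le> L r" using log_weight_le_mult[OF rs] t by (simp add: L_def t_def[symmetric] divide_le_eq mult.commute)
    then have "L r powr \<beta> \<le> (L s / t) powr \<beta>"
      using \<beta> L1[OF s0 rs(3)] t by (intro powr_mono2') auto
    also have "\<dots> = t powr (- \<beta>) * L s powr \<beta>" using t L1[OF s0 rs(3)] by (simp add: powr_divide powr_minus field_simps)
    finally have 1: "L r powr \<beta> \<le> t powr (- \<beta>) * L s powr \<beta>" .
    have 2: "(1 - r) powr \<alpha> = t powr \<alpha> * (1 - s) powr \<alpha>"
      using rs by (simp add: t_def powr_mult[symmetric])
    have "\<omega> r \<le> (t powr \<alpha> * (1 - s) powr \<alpha>) * (t powr (- \<beta>) * L s powr \<beta>)"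
      unfolding wL[OF rs(1) r1] 2 by (intro mult_left_mono 1) auto
    also have "\<dots> = t powr (\<alpha> - \<beta>) * \<omega> s" using t by (simp add: wL s0 rs powr_diff powr_minus field_simps)
    also have "\<dots> \<le> t powr (max 0 (\<alpha> - \<beta>)) * \<omega> s"
      using t L1[OF s0 rs(3)] by (intro mult_right_mono powr_mono) (auto simp: wL s0 rs)
    finally show ?thesis by (simp add: t_def)
  qed
qed

text \<open>The weight is decreasing, hence the exponent 0. For \<alpha> <= 1 and logarithms at
  least 1, the increment of the power \<alpha> of the logarithm is at most that of the logarithm,
  which is the log of the ratio of distances; exponentiation gives the exponent \<beta>.\<close>

lemma doubling_weight_exp_log:
  assumes \<alpha>: "0 < \<alpha>" "\<alpha> \<le> 1" and \<beta>: "0 < \<beta>"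
    and \<omega>: "\<And>r. r \<in> {0..<1} \<Longrightarrow> \<omega> r = exp (- \<beta> * ln (exp 1 / (1 - r)) powr \<alpha>)"
  shows "doubling_weight \<omega> 0 \<beta>"
proof
  define L where "L = (\<lambda>r::real. ln (exp 1 / (1 - r)))"
  have L1: "1 \<le> L r" if "0 \<le> r" "r < 1" for r unfolding L_def using that by (rule log_weight_ge_1)
  have wL: "\<omega> r = exp (- \<beta> * L r powr \<alpha>)" if "0 \<le> r" "r < 1" for r using \<omega> that by (simp add: L_def)
  show "0 < \<omega> r" if "0 \<le> r" "r < 1" for r using that by (simp add: wL)
  have "continuous_on {0..<1} (\<lambda>r. exp (- \<beta> * L r powr \<alpha>))"
    unfolding L_def using L1 by (intro continuous_intros) (auto simp: L_def, fastforce)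
  then show "continuous_on {0..<1} \<omega>" by (rule continuous_on_eq) (simp add: wL)
  fix r s :: real assume rs: "0 \<le> r" "r \<le> s" "s < 1"
  then have r1: "r < 1" and s0: "0 \<le> s" by auto
  have Lrs: "L r \<le> L s" unfolding L_def by (rule log_weight_mono[OF rs(2,3)])
  show "\<omega> s \<le> ((1 - s) / (1 - r)) powr (- 0) * \<omega> r"
  proof -
    have "L r powr \<alpha> \<le> L s powr \<alpha>" using Lrs L1[OF rs(1) r1] \<alpha> by (intro powr_mono2) auto
    then show ?thesis using \<beta> rs by (simp add: wL r1 s0)
  qed
  show "\<omega> r \<le> ((1 - r) / (1 - s)) powr \<beta> * \<omega> s"
  proof -
    define q where "q = L s / L r"
    have q: "1 \<le> q" using Lrs L1[OF rs(1) r1] by (simp add: q_def)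
    have Ls: "L s = q * L r" using L1[OF rs(1) r1] by (simp add: q_def)
    have "L s powr \<alpha> - L r powr \<alpha> = L r powr \<alpha> * (q powr \<alpha> - 1)"
      unfolding Ls by (simp add: powr_mult algebra_simps)
    \<comment> \<open>Both factors grow when \<alpha> is raised to 1, since L r >= 1 and q >=
      1.\<close>
    also have "\<dots> \<le> L r powr 1 * (q powr 1 - 1)"
      using L1[OF rs(1) r1] q \<alpha> by (intro mult_mono powr_mono diff_right_mono) (auto simp: ge_one_powr_ge_zero)
    also have "\<dots> = L s - L r" using q L1[OF rs(1) r1] by (simp add: Ls algebra_simps)
    also have "\<dots> = ln ((1 - r) / (1 - s))" unfolding L_def using r1 rs by (intro log_weight_diff)
    finally have "\<beta> * (L s powr \<alpha> - L r powr \<alpha>) \<le> \<beta> * ln ((1 - r) / (1 - s))"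
      using \<beta> by (intro mult_left_mono) auto
    then have "- \<beta> * L r powr \<alpha> \<le> \<beta> * ln ((1 - r) / (1 - s)) + (- \<beta> * L s powr \<alpha>)"
      by (simp add: algebra_simps)
    then have "exp (- \<beta> * L r powr \<alpha>) \<le> exp (\<beta> * ln ((1 - r) / (1 - s))) * exp (- \<beta> * L s powr \<alpha>)"
      by (simp add: exp_add[symmetric])
    then show ?thesis using rs r1 by (simp add: wL s0 powr_def)
  qed
qed (use \<beta> in auto)

theorem corollary7:
  fixes p :: real and \<phi> :: "complex \<Rightarrow> complex" and \<omega> :: "real \<Rightarrow> real"
  assumes "1 < p"
    and "\<phi> holomorphic_on ball 0 1" and "\<phi> ` ball 0 1 \<subseteq> ball 0 1"
    and "(\<exists>\<alpha> \<beta>. \<alpha> > -1 \<and> \<beta> \<le> 0 \<and>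
            (\<forall>r\<in>{0..<1}. \<omega> r = (1 - r) powr \<alpha> * ln (exp 1 / (1 - r)) powr \<beta>)) \<or>
         (\<exists>\<alpha> \<beta>. 0 < \<alpha> \<and> \<alpha> \<le> 1 \<and> \<beta> > 0 \<and>
            (\<forall>r\<in>{0..<1}. \<omega> r = exp (- \<beta> * ln (exp 1 / (1 - r)) powr \<alpha>)))"
  shows "{u \<in> H_disk. weighted_comp u \<phi> ` bergman p \<omega> \<subseteq> bergman p \<omega>} = H_infinity
         \<longleftrightarrow> finite_Blaschke_product \<phi>"
proof -
  have "\<exists>\<kappa> K. doubling_weight \<omega> \<kappa> K"
    using assms(4) doubling_weight_power_log[of _ _ \<omega>] doubling_weight_exp_log[of _ _ \<omega>] by blast
  then obtain \<kappa> K where "doubling_weight \<omega> \<kappa> K" by blast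
  then show ?thesis
    using assms(1-3) by (rule doubling_weight.weighted_composition_multipliers)
qed

end
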